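(* Consider the weight-dependent random connection model in $\mathbb{R}^d$ with parameters $\gamma\in[0,1)$, $\gamma'\in[0,2-\gamma)$ and $\delta\in(1,\infty]$ (as defined in the context). If $\delta>2$, $\gamma<1-1/\delta$ and $\gamma'<1-\gamma$, then there exists $\eta>0$ such that for all $L\in\mathbb{N}$, $$\limsup_{m\to\infty}\frac{\log \mathbb{P}\big(\neg\mathcal{D}^{\eta}_{L}(m)\big)}{\log m}\ \leq\ d\,\zeta,$$ where $$\zeta=\max\Big\{2-\delta,\ 1-\tfrac{\delta-1}{\gamma\delta},\ \tfrac{\gamma'+\gamma-1}{\gamma},\ \tfrac{2(\gamma'+\gamma-1)}{\gamma'+\gamma}\Big\}<0$$ and $$\mathcal{D}^{\eta}_{L}(m)=\big\{\operatorname{d}(\boldsymbol{x},\boldsymbol{y})\geq \eta|x-y| \text{ for all vertices } \boldsymbol{x} \text{ with } x\in\Lambda_L(o)\text{ and } \boldsymbol{y} \text{ with } y\in\Lambda_m(o)^{\mathsf c}\big\}.$$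
   Context: Weight-dependent random connection model. The vertex locations are given either by a homogeneous Poisson point process on $\mathbb{R}^d$ of some intensity $\lambda>0$ or by a Bernoulli site-percolated lattice $\mathbb{Z}^d$. Each vertex carries additionally an independent mark uniformly distributed on $(0,1)$. A vertex is written $\boldsymbol{x}=(x,u_x)\in\mathbb{R}^d\times(0,1)$, and $\mathscr{V}$ is the set of marked vertices. Given $\mathscr{V}$, each pair of vertices $\boldsymbol{x},\boldsymbol{y}$ is connected by an edge independently with probability $$\rho\big((u_x\wedge u_y)^{\gamma}(u_x\vee u_y)^{\gamma'}|x-y|^d\big).$$ Here $\rho:[0,\infty)\to[0,1]$ is a decreasing, integrable profile function: for $\delta\in(1,\infty)$ it satisfies $\rho(x)\asymp 1\wedge x^{-\delta}$ ($f\asymp g$ means that $f/g$ is bounded away from zero and infinity), and the case $\delta=\infty$ corresponds to $\rho=\mathbf{1}_{[0,1]}$. Notation. $|\cdot|$ is the Euclidean norm, $o$ the origin, $\Lambda_m(x)=x+[-m/2,m/2)^d$, $\neg$ denotes complement, $a\wedge b=\min\{a,b\}$, $a\vee b=\max\{a,b\}$, and $\operatorname{d}(\boldsymbol{x},\boldsymbol{y})$ is the graph distance (number of edges of a shortest path, $\infty$ if there is none). $\log 0=-\infty$. Conventions for $\zeta$: for $\delta=\infty$ read $1/\delta=0$, $2-\delta=-\infty$ and $(\delta-1)/\delta=1$; a term of the maximum whose denominator vanishes ($\gamma=0$ or $\gamma+\gamma'=0$) is read as $-\infty$. *)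

theory Defs
  imports "HOL-Probability.Probability"
begin

text \<open>
  The number of points of an enumerated point configuration \<open>x 0, x 1, \<dots>\<close> in a set,
  counted with multiplicity.
\<close>

definition point_count :: "(nat \<Rightarrow> 'b) \<Rightarrow> 'b set \<Rightarrow> ennreal" where
  "point_count x A = emeasure (count_space UNIV) {i. x i \<in> A}"

definition int_lattice :: "(real ^ 'd) set" where
  "int_lattice = {z. \<forall>k. z $ k \<in> \<int>}"

text \<open>
  Both vertex processes have almost surely infinitely many points, so they are given as random
  sequences \<open>X 0, X 1, \<dots>\<close>; only the random set of points is prescribed, not the order in which
  they are listed.  As the Poisson counts respect multiplicities, the points of a Poisson process
  are almost surely distinct.
\<close>

definition (in prob_space) poisson_process :: "real \<Rightarrow> (nat \<Rightarrow> 'a \<Rightarrow> real ^ 'd) \<Rightarrow> bool" where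
  "poisson_process \<beta> X \<longleftrightarrow>
     (\<forall>i. random_variable borel (X i)) \<and>
     (\<forall>A \<in> sets borel. emeasure lborel A < \<infinity> \<longrightarrow>
        (\<forall>k::nat. prob {\<omega> \<in> space M. point_count (\<lambda>i. X i \<omega>) A = of_nat k} =
           exp (- (\<beta> * measure lborel A)) * (\<beta> * measure lborel A) ^ k / fact k)) \<and>
     (\<forall>A :: nat \<Rightarrow> (real ^ 'd) set. range A \<subseteq> sets borel \<and> disjoint_family A \<longrightarrow>
        indep_vars (\<lambda>_. borel) (\<lambda>n \<omega>. point_count (\<lambda>i. X i \<omega>) (A n)) UNIV)"

definition (in prob_space) percolated_lattice :: "real \<Rightarrow> (nat \<Rightarrow> 'a \<Rightarrow> real ^ 'd) \<Rightarrow> bool" where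
  "percolated_lattice p X \<longleftrightarrow>
     (\<forall>i. random_variable borel (X i)) \<and>
     (AE \<omega> in M. inj (\<lambda>i. X i \<omega>) \<and> range (\<lambda>i. X i \<omega>) \<subseteq> int_lattice) \<and>
     (\<forall>z \<in> int_lattice. prob {\<omega> \<in> space M. z \<in> range (\<lambda>i. X i \<omega>)} = p) \<and>
     indep_events (\<lambda>z. {\<omega> \<in> space M. z \<in> range (\<lambda>i. X i \<omega>)}) int_lattice"

text \<open>
  For finite \<open>\<delta>\<close> the two-sided bound is required for \<open>x > 0\<close> only, because \<open>0 powr (- \<delta>) = 0\<close>;
  monotonicity gives the bound \<open>\<rho> \<asymp> 1\<close> at \<open>0\<close>.
\<close>

definition profile_function :: "ereal \<Rightarrow> (real \<Rightarrow> real) \<Rightarrow> bool" where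
  "profile_function \<delta> \<rho> \<longleftrightarrow>
     (\<forall>x \<ge> 0. 0 \<le> \<rho> x \<and> \<rho> x \<le> 1) \<and>
     antimono_on {0..} \<rho> \<and>
     set_integrable lborel {0..} \<rho> \<and>
     (if \<delta> = \<infinity> then \<forall>x \<ge> 0. \<rho> x = indicator {0..1} x
      else \<exists>c > 0. \<exists>C > 0. \<forall>x > 0.
             c * min 1 (x powr (- real_of_ereal \<delta>)) \<le> \<rho> x \<and>
             \<rho> x \<le> C * min 1 (x powr (- real_of_ereal \<delta>)))"

definition connection_prob ::
  "real \<Rightarrow> real \<Rightarrow> (real \<Rightarrow> real) \<Rightarrow> (real ^ 'd) \<times> real \<Rightarrow> (real ^ 'd) \<times> real \<Rightarrow> real" where
  "connection_prob \<gamma> \<gamma>' \<rho> = (\<lambda>(x, u) (y, v).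
     \<rho> (min u v powr \<gamma> * max u v powr \<gamma>' * norm (x - y) ^ CARD('d)))"

text \<open>
  The vertices are identified with their indices: vertex \<open>i\<close> has location \<open>X i\<close> and mark \<open>U i\<close>,
  and \<open>E\<close> is the random set of edges.  By \<open>marks_distr\<close> the marks are independent, uniform on
  \<open>(0, 1)\<close> and independent of the locations.  The last assumption states that, conditionally on all
  locations and marks, the events that \<open>i\<close> and \<open>j\<close> are joined by an edge, \<open>i < j\<close>, are
  independent and have the prescribed probabilities.
\<close>

locale wdrcm = prob_space M
  for M :: "'w measure" +
  fixes \<gamma> \<gamma>' :: real and \<delta> :: ereal and \<rho> :: "real \<Rightarrow> real"
    and X :: "nat \<Rightarrow> 'w \<Rightarrow> real ^ 'd" and U :: "nat \<Rightarrow> 'w \<Rightarrow> real"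
    and E :: "'w \<Rightarrow> (nat \<times> nat) set"
  assumes profile: "profile_function \<delta> \<rho>"
    and locations: "(\<exists>\<beta> > 0. poisson_process \<beta> X) \<or> (\<exists>p. 0 < p \<and> p \<le> 1 \<and> percolated_lattice p X)"
    and marks_measurable: "\<And>i. random_variable borel (U i)"
    and marks_distr:
      "distr M (Pi\<^sub>M UNIV (\<lambda>_. borel) \<Otimes>\<^sub>M Pi\<^sub>M UNIV (\<lambda>_. borel)) (\<lambda>\<omega>. (\<lambda>i. X i \<omega>, \<lambda>i. U i \<omega>)) =
       distr M (Pi\<^sub>M UNIV (\<lambda>_. borel)) (\<lambda>\<omega> i. X i \<omega>) \<Otimes>\<^sub>M
       Pi\<^sub>M UNIV (\<lambda>_. uniform_measure lborel {0<..<1})"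
    and edges_sym: "\<And>\<omega>. \<omega> \<in> space M \<Longrightarrow> sym (E \<omega>)"
    and edges_irrefl: "\<And>\<omega>. \<omega> \<in> space M \<Longrightarrow> irrefl (E \<omega>)"
    and edges_measurable: "\<And>i j. {\<omega> \<in> space M. (i, j) \<in> E \<omega>} \<in> events"
    and edges_cond_indep: "\<And>F. finite F \<Longrightarrow> F \<subseteq> {(i, j). i < j} \<Longrightarrow>
      AE \<omega> in M.
        real_cond_exp M (vimage_algebra (space M) (\<lambda>\<omega> i. (X i \<omega>, U i \<omega>)) (Pi\<^sub>M UNIV (\<lambda>_. borel)))
          (indicator {\<omega> \<in> space M. F \<subseteq> E \<omega>}) \<omega> =
        (\<Prod>(i, j) \<in> F. connection_prob \<gamma> \<gamma>' \<rho> (X i \<omega>, U i \<omega>) (X j \<omega>, U j \<omega>))"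

definition graph_paths :: "('v \<times> 'v) set \<Rightarrow> 'v \<Rightarrow> 'v \<Rightarrow> 'v list set" where
  "graph_paths R v w = {vs. vs \<noteq> [] \<and> hd vs = v \<and> last vs = w \<and> distinct vs \<and>
     successively (\<lambda>a b. (a, b) \<in> R) vs}"

definition graph_dist :: "('v \<times> 'v) set \<Rightarrow> 'v \<Rightarrow> 'v \<Rightarrow> enat" where
  "graph_dist R v w = (INF vs \<in> graph_paths R v w. enat (length vs - 1))"

lemma le_graph_dist_iff:
  "ereal a \<le> ereal_of_enat (graph_dist R v w) \<longleftrightarrow> (\<forall>vs \<in> graph_paths R v w. a \<le> real (length vs - 1))"
proof
  assume a: "ereal a \<le> ereal_of_enat (graph_dist R v w)"
  show "\<forall>vs \<in> graph_paths R v w. a \<le> real (length vs - 1)"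
  proof
    fix vs assume "vs \<in> graph_paths R v w"
    then have "graph_dist R v w \<le> enat (length vs - 1)"
      unfolding graph_dist_def by (rule INF_lower)
    then have "ereal_of_enat (graph_dist R v w) \<le> ereal_of_enat (enat (length vs - 1))"
      by (simp only: ereal_of_enat_le_iff)
    with a show "a \<le> real (length vs - 1)"
      by (metis ereal_less_eq(3) ereal_of_enat_simps(1) order_trans)
  qed
next
  assume a: "\<forall>vs \<in> graph_paths R v w. a \<le> real (length vs - 1)"
  show "ereal a \<le> ereal_of_enat (graph_dist R v w)"
  proof (cases "graph_paths R v w = {}")
    case True
    then show ?thesis by (simp add: graph_dist_def top_enat_def)
  next
    case False
    have "graph_dist R v w \<in> (\<lambda>vs. enat (length vs - 1)) ` graph_paths R v w"
      unfolding graph_dist_def using False by (auto intro!: wellorder_InfI)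
    then show ?thesis using a by auto
  qed
qed

definition cube :: "real \<Rightarrow> real ^ 'd \<Rightarrow> (real ^ 'd) set" where
  "cube m x = {y. \<forall>k. x $ k - m / 2 \<le> y $ k \<and> y $ k < x $ k + m / 2}"

definition linear_dist_event ::
  "(nat \<Rightarrow> 'w \<Rightarrow> real ^ 'd) \<Rightarrow> ('w \<Rightarrow> (nat \<times> nat) set) \<Rightarrow> real \<Rightarrow> real \<Rightarrow> real \<Rightarrow> 'w set" where
  "linear_dist_event X E \<eta> L m =
     {\<omega>. \<forall>i j. X i \<omega> \<in> cube L 0 \<and> X j \<omega> \<notin> cube m 0 \<longrightarrow>
            ereal (\<eta> * norm (X i \<omega> - X j \<omega>)) \<le> ereal_of_enat (graph_dist (E \<omega>) i j)}"

lemma (in wdrcm) linear_dist_event_measurable: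
  "space M - linear_dist_event X E \<eta> L m \<in> events"
proof -
  have X [measurable]: "X i \<in> borel_measurable M" for i
    using locations unfolding poisson_process_def percolated_lattice_def by auto
  have adj [measurable]: "Measurable.pred M (\<lambda>\<omega>. (i, j) \<in> E \<omega>)" for i j
    using edges_measurable by (simp add: pred_def)
  have succ [measurable]: "Measurable.pred M (\<lambda>\<omega>. successively (\<lambda>a b. (a, b) \<in> E \<omega>) vs)" for vs
    by (simp add: successively_conv_nth)
  have "space M - linear_dist_event X E \<eta> L m =
     {\<omega> \<in> space M. \<not> (\<forall>i j. (\<forall>k. - (L / 2) \<le> X i \<omega> $ k \<and> X i \<omega> $ k < L / 2) \<and>
        \<not> (\<forall>k. - (m/2) \<le> X j \<omega> $ k \<and> X j \<omega> $ k < m / 2)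
      \<longrightarrow> (\<forall>vs. vs \<noteq> [] \<and> hd vs = i \<and> last vs = j \<and> distinct vs \<and>
        successively (\<lambda>a b. (a, b) \<in> E \<omega>) vs \<longrightarrow> \<eta> * norm (X i \<omega> - X j \<omega>) \<le> real (length vs - 1)))}"
    unfolding linear_dist_event_def cube_def le_graph_dist_iff graph_paths_def by auto
  also have "\<dots> \<in> events" by measurable
  finally show ?thesis .
qed

definition log_ext :: "real \<Rightarrow> ereal" where
  "log_ext p = (if p = 0 then - \<infinity> else ereal (ln p))"

definition zeta :: "real \<Rightarrow> real \<Rightarrow> ereal \<Rightarrow> ereal" where
  "zeta \<gamma> \<gamma>' \<delta> =
    (let r = (if \<delta> = \<infinity> then 1 else (real_of_ereal \<delta> - 1) / real_of_ereal \<delta>)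
     in Max {2 - \<delta>,
             if \<gamma> = 0 then - \<infinity> else ereal (1 - r / \<gamma>),
             if \<gamma> = 0 then - \<infinity> else ereal ((\<gamma>' + \<gamma> - 1) / \<gamma>),
             if \<gamma> + \<gamma>' = 0 then - \<infinity> else ereal (2 * (\<gamma>' + \<gamma> - 1) / (\<gamma>' + \<gamma>))})"

end

theory Submission
  imports Defs
begin

text \<open>
  A path that travels far in few steps either uses a long edge, or it crosses many
  smaller boxes too fast as well. Say that the box of size \<open>K\<close> around \<open>x\<close> has a fast crossing if some
  path inside it covers a distance \<open>K\<close> with fewer than \<open>\<eta> K\<close> steps (\<open>fast_crossing\<close>). Compare the
  scales \<open>l \<ll> k \<ll> K\<close>. If the box of size \<open>K\<close> contains no edge of length \<open>l\<close>, and at most \<open>c\<close>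
  mutually distant boxes of size \<open>k\<close> have a fast crossing, then a path can gain only a distance of
  order \<open>c k\<close> for free; the rest it has to cover through slow boxes, at a price of \<open>\<eta> k\<close> steps for a
  distance of at most \<open>k + l\<close> (\<open>path_displacement_bound\<close>). So the larger box is slow as well, with a
  speed constant \<open>\<eta>'\<close> that differs from \<open>\<eta>\<close> by a factor close to \<open>1\<close> (\<open>fast_crossing_subset\<close>).

  With \<open>K = k powr (1 + \<alpha>)\<close> and \<open>l = k powr (1 - \<alpha>)\<close>, the probabilities \<open>p k\<close> of a fast crossing
  therefore satisfy, up to constants,
  \<open>p K \<le> P (edge of length l in the box) + (k powr (\<alpha> d) * p k) ^ (c + 1)\<close>.
  The probability of a long edge is at most \<open>l powr (d \<zeta>)\<close> up to an arbitrarily small change of the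
  exponent, once \<open>\<alpha>\<close> is small. Two consequences are drawn. With \<open>c = 1\<close>, induction over the scales
  gives a polynomial bound \<open>K powr (- s)\<close> with \<^emph>\<open>some\<close> \<open>s > 0\<close> (\<open>fast_crossing_decay\<close>); the losses in
  \<open>\<eta>\<close> are summable over the scales, and the induction starts for free, because no path covers a
  positive distance in less than one step. After that, one single step with a large \<open>c\<close> makes the
  second term negligible and yields every exponent above \<open>d \<zeta>\<close> at the price of a factor \<open>2\<close> in \<open>\<eta>\<close>
  (\<open>fast_crossing_decay_boost\<close>). As the exponent is improved only after \<open>\<eta>\<close> has been fixed, one
  \<open>\<eta>\<close> serves all exponents, hence the limit superior. A violation of the linear lower bound on
  distances implies a fast crossing around the origin on one of the scales \<open>2 ^ n * m / 6\<close>
  (\<open>not_linear_dist_subset\<close>), and the resulting bounds form a geometric series.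

  The square, or the \<open>(c + 1)\<close>-st power, in the recursion comes from independence of distant boxes.
  As the points of the process are listed in an arbitrary order, conditional probabilities of box
  events are awkward to handle. The recursion is unfolded instead: a fast crossing is contained in a
  finite union of finite intersections of elementary requirements, each of which asks for a vertex
  of small mark in one unit cell or for a long edge between two unit cells, and all cells in one
  intersection are different (\<open>covered\<close>). Covers can be united and, over disjoint regions,
  intersected, and their weights behave like probabilities of independent events. Only for
  intersections of elementary requirements has the product bound to be proved (\<open>witness_prob\<close>); it
  follows by summing over the indices of the vertices involved, since a finite set of edges has an
  explicit conditional probability, the marks are independent, and the mean of a product of vertex
  counts over different cells is bounded by a power of a constant.

  The exponent \<open>\<zeta>\<close> arises as follows. Put \<open>D = l ^ d\<close> and let \<open>D powr (- A)\<close> and \<open>D powr (- B)\<close>,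
  \<open>B \<le> A\<close>, be the marks of the two ends of an edge of length \<open>l\<close>. In a box of volume \<open>D\<close>, the expected
  number of such edges is of order \<open>D powr (2 - A - B - \<delta> * max 0 (1 - \<gamma> * A - \<gamma>' * B))\<close>, whereas a
  vertex with a mark below \<open>D powr (- (1 + \<theta>))\<close> exists with a probability of order \<open>D powr (- \<theta>)\<close> at most. On
  \<open>0 \<le> B \<le> A \<le> 1 + \<theta>\<close> the exponent is piecewise linear, and the four terms of \<open>\<zeta>\<close> are what its
  corners require for it to stay below \<open>- \<theta>\<close> (\<open>admissible\<close>, \<open>mark_cost_bound\<close>).
\<close>

section \<open>Displacement along a path\<close>

text \<open>
  A maximal separated subset covers. This is how a bound on the number of mutually distant bad
  boxes turns into a bound on the number of balls that are needed to cover all of them.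
\<close>

lemma finite_separated_net:
  fixes Z :: "'a::metric_space set"
  assumes "finite Z" "0 \<le> r"
  shows "\<exists>N\<subseteq>Z. pairwise (\<lambda>a b. r < dist a b) N \<and> Z \<subseteq> (\<Union>a\<in>N. cball a r)"
  using assms(1)
proof (induction Z rule: finite_induct)
  case (insert z Z)
  then obtain N where N: "N \<subseteq> Z" "pairwise (\<lambda>a b. r < dist a b) N" "Z \<subseteq> (\<Union>a\<in>N. cball a r)"
    by blast
  show ?case
  proof (cases "z \<in> (\<Union>a\<in>N. cball a r)")
    case True
    then show ?thesis using N by (intro exI[of _ N]) auto
  next
    case False
    then have "pairwise (\<lambda>a b. r < dist a b) (insert z N)"
      using N(2) by (auto simp: pairwise_insert dist_commute not_le)
    moreover have "insert z Z \<subseteq> (\<Union>a\<in>insert z N. cball a r)"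
      using N(3) assms(2) by auto
    ultimately show ?thesis using N(1) by (intro exI[of _ "insert z N"]) auto
  qed
qed auto

text \<open>
  Walk along the path. From a point outside the bad sets \<open>\<B>\<close>, wait until the displacement reaches
  \<open>k\<close>: this costs \<open>\<tau>\<close> steps and gains at most \<open>k + l\<close>. From a point in a bad set \<open>S\<close>, jump to the last
  visit of \<open>S\<close> and take one more step: this gains at most \<open>D + l\<close>, is free of charge, and happens
  at most once for each bad set. The summand \<open>k\<close> accounts for the unfinished last stretch.
\<close>

lemma path_displacement_bound:
  fixes f :: "'v \<Rightarrow> 'a::metric_space" and k l D \<tau> :: real
  assumes pos: "0 < k" "0 \<le> l" "0 \<le> D" "0 < \<tau>"
    and fin: "finite \<B>"
    and diam: "\<And>S a b. S \<in> \<B> \<Longrightarrow> a \<in> S \<Longrightarrow> b \<in> S \<Longrightarrow> dist a b \<le> D"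
    and vs: "vs \<noteq> []"
    and steps: "successively (\<lambda>a b. dist (f a) (f b) \<le> l) vs"
    and slow: "\<And>as ws bs. vs = as @ ws @ bs \<Longrightarrow> ws \<noteq> [] \<Longrightarrow> f (hd ws) \<notin> \<Union>\<B> \<Longrightarrow>
      k \<le> dist (f (hd ws)) (f (last ws)) \<Longrightarrow>
      (\<And>w. w \<in> set ws \<Longrightarrow> dist (f (hd ws)) (f w) \<le> k + l) \<Longrightarrow> \<tau> \<le> real (length ws - 1)"
  shows "dist (f (hd vs)) (f (last vs)) \<le>
    real (length vs - 1) / \<tau> * (k + l) + real (card \<B>) * (D + l) + k"
  using fin diam vs steps slow
proof (induction "length vs" arbitrary: vs \<B> rule: less_induct)
  case less
  note fin = less.prems(1) and diam = less.prems(2) and vs = less.prems(3)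
    and steps = less.prems(4) and slow = less.prems(5)
  have nonneg: "0 \<le> real (length ws - 1) / \<tau> * (k + l)" for ws :: "'v list"
    using pos by auto
  have nonneg_card: "0 \<le> real (card \<B>) * (D + l)" using pos by auto
  consider (short) "dist (f (hd vs)) (f (last vs)) \<le> k"
    | (bad) S where "S \<in> \<B>" "f (hd vs) \<in> S"
    | (good) "k < dist (f (hd vs)) (f (last vs))" "f (hd vs) \<notin> \<Union>\<B>"
    by fastforce
  then show ?case
  proof cases
    case short
    then show ?thesis using nonneg[of vs] nonneg_card by linarith
  next
    case bad
    have "\<exists>v\<in>set vs. f v \<in> S" using bad vs by auto
    then obtain as v bs where split: "vs = as @ v # bs" "f v \<in> S" "\<forall>w\<in>set bs. f w \<notin> S"
      using split_list_last_prop[of vs "\<lambda>v. f v \<in> S"] by blast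
    have dv: "dist (f (hd vs)) (f v) \<le> D" using diam bad split by blast
    have card: "card \<B> \<ge> 1" using bad fin by (metis One_nat_def Suc_leI card_gt_0_iff empty_iff)
    have cardD: "D + l \<le> real (card \<B>) * (D + l)"
      using card pos by (metis add_nonneg_nonneg mult_left_mono mult_1 mult_right_mono of_nat_1 of_nat_mono)
    show ?thesis
    proof (cases "bs = []")
      case True
      have "last vs = v" using split True by simp
      show ?thesis unfolding \<open>last vs = v\<close> using dv nonneg[of vs] cardD pos by linarith
    next
      case False
      have st: "successively (\<lambda>a b. dist (f a) (f b) \<le> l) bs" "dist (f v) (f (hd bs)) \<le> l"
        using steps False by (auto simp: split(1) successively_append_iff successively_Cons)
      have IH: "dist (f (hd bs)) (f (last bs)) \<le>
        real (length bs - 1) / \<tau> * (k + l) + real (card (\<B> - {S})) * (D + l) + k"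
      proof (rule less.hyps)
        show "length bs < length vs" by (simp add: split(1))
        show "\<tau> \<le> real (length ws - 1)"
          if "bs = xs @ ws @ ys" "ws \<noteq> []" "f (hd ws) \<notin> \<Union> (\<B> - {S})"
            "k \<le> dist (f (hd ws)) (f (last ws))"
            "\<And>w. w \<in> set ws \<Longrightarrow> dist (f (hd ws)) (f w) \<le> k + l" for xs ws ys
        proof (rule slow)
          show "vs = (as @ v # xs) @ ws @ ys" using that(1) split(1) by simp
          have "hd ws \<in> set bs" using that(1,2) by simp
          then show "f (hd ws) \<notin> \<Union>\<B>" using that(3) split(3) by blast
        qed (use that in auto)
      qed (use fin diam False st in auto)
      have "real (card (\<B> - {S})) * (D + l) = real (card \<B>) * (D + l) - (D + l)"
      proof -
        have "real (card (\<B> - {S})) = real (card \<B>) - 1"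
          using bad fin card by (simp add: card_Diff_singleton)
        then show ?thesis by (simp add: left_diff_distrib)
      qed
      note card_Diff = this
      have last: "last vs = last bs" using False split(1) by simp
      have len: "real (length bs - 1) / \<tau> * (k + l) \<le> real (length vs - 1) / \<tau> * (k + l)"
        using pos split(1) by (intro mult_right_mono divide_right_mono) auto
      have "dist (f (hd vs)) (f (last bs)) \<le> D + (l + dist (f (hd bs)) (f (last bs)))"
        using dv st(2) dist_triangle[of "f (hd vs)" "f (last bs)" "f v"]
          dist_triangle[of "f v" "f (last bs)" "f (hd bs)"] by linarith
      then show ?thesis
        unfolding last using IH card_Diff len by linarith
    qed
  next
    case good
    have "\<exists>v\<in>set vs. k \<le> dist (f (hd vs)) (f v)"
      using good(1) vs by (intro bexI[of _ "last vs"]) simp_all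
    then obtain as v bs where split: "vs = as @ v # bs" "k \<le> dist (f (hd vs)) (f v)"
      "\<forall>w\<in>set as. \<not> k \<le> dist (f (hd vs)) (f w)"
      using split_list_first_prop[of vs "\<lambda>v. k \<le> dist (f (hd vs)) (f v)"] by blast
    have as: "as \<noteq> []" using split pos by auto
    have hdas: "hd as = hd vs" using as split(1) by simp
    have st: "successively (\<lambda>a b. dist (f a) (f b) \<le> l) (v # bs)" "dist (f (last as)) (f v) \<le> l"
      using steps as by (auto simp: split(1) successively_append_iff)
    have "dist (f (hd vs)) (f (last as)) < k"
      using split(3) last_in_set[OF as] not_le by blast
    then have dv: "dist (f (hd vs)) (f v) \<le> k + l"
      using st(2) dist_triangle[of "f (hd vs)" "f v" "f (last as)"] by linarith
    have "\<tau> \<le> real (length (as @ [v]) - 1)"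
    proof (rule slow)
      show "vs = [] @ (as @ [v]) @ bs" using split(1) by simp
      show "dist (f (hd (as @ [v]))) (f w) \<le> k + l" if "w \<in> set (as @ [v])" for w
        using that dv split(3) pos unfolding hd_append2[OF as] hdas
        by (cases "w = v") (auto simp: not_le intro: less_imp_le[THEN order_trans])
    qed (use as hdas good split in auto)
    then have "1 \<le> real (length as) / \<tau>" using pos by simp
    then have \<tau>: "k + l \<le> real (length as) / \<tau> * (k + l)"
      using pos mult_right_mono[of 1 "real (length as) / \<tau>" "k + l"] by simp
    have IH: "dist (f (hd (v # bs))) (f (last (v # bs))) \<le>
      real (length (v # bs) - 1) / \<tau> * (k + l) + real (card \<B>) * (D + l) + k"
    proof (rule less.hyps)
      show "length (v # bs) < length vs" using as by (simp add: split(1))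
      show "\<tau> \<le> real (length ws - 1)"
        if "v # bs = xs @ ws @ ys" "ws \<noteq> []" "f (hd ws) \<notin> \<Union>\<B>"
          "k \<le> dist (f (hd ws)) (f (last ws))"
          "\<And>w. w \<in> set ws \<Longrightarrow> dist (f (hd ws)) (f w) \<le> k + l" for xs ws ys
        by (rule slow[of "as @ xs" ws ys]) (use that split(1) in auto)
    qed (use fin diam st in auto)
    have ends: "last (v # bs) = last vs" "hd (v # bs) = v" using split(1) by simp_all
    have len: "real (length vs - 1) / \<tau> * (k + l) =
        real (length as) / \<tau> * (k + l) + real (length (v # bs) - 1) / \<tau> * (k + l)"
      using as by (simp add: split(1) add_divide_distrib[symmetric] distrib_right[symmetric])
    have "dist (f (hd vs)) (f (last vs)) \<le> dist (f (hd vs)) (f v) + dist (f v) (f (last vs))"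
      by (rule dist_triangle)
    then show ?thesis using IH[unfolded ends] len dv \<tau> by linarith
  qed
qed

section \<open>Unit cells and grid points\<close>

definition cell :: "real ^ 'd \<Rightarrow> int ^ 'd" where
  "cell y = (\<chi> k. \<lfloor>y $ k\<rfloor>)"

definition cell_corner :: "int ^ 'd \<Rightarrow> real ^ 'd" where
  "cell_corner z = (\<chi> k. real_of_int (z $ k))"

text \<open>
  Distances are measured in the Euclidean norm throughout; the dimension serves as a crude bound for
  the diameter \<open>sqrt d\<close> of a unit cell.
\<close>

lemma norm_cell_offset: "norm (y - cell_corner (cell y)) \<le> real CARD('d)"
  for y :: "real ^ 'd"
proof -
  have "norm (y - cell_corner (cell y)) \<le> (\<Sum>k\<in>UNIV. \<bar>(y - cell_corner (cell y)) $ k\<bar>)"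
    by (rule norm_le_l1_cart)
  also have "\<dots> \<le> (\<Sum>k\<in>(UNIV::'d set). 1)"
    by (intro sum_mono) (simp add: cell_def cell_corner_def, linarith)
  finally show ?thesis by simp
qed

lemma dist_same_cell:
  fixes x y :: "real ^ 'd"
  assumes "cell x = cell y"
  shows "dist x y \<le> real CARD('d)"
proof -
  have "\<bar>(x - y) $ k\<bar> \<le> 1" for k
  proof -
    have "\<lfloor>x $ k\<rfloor> = \<lfloor>y $ k\<rfloor>" using assms by (simp add: cell_def vec_eq_iff)
    then show ?thesis by (simp) linarith
  qed
  then have "(\<Sum>k\<in>UNIV. \<bar>(x - y) $ k\<bar>) \<le> (\<Sum>k\<in>(UNIV::'d set). 1)" by (intro sum_mono) auto
  then show ?thesis using norm_le_l1_cart[of "x - y"] by (simp add: dist_norm)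
qed

lemma card_cells_cball:
  fixes x :: "real ^ 'd"
  assumes "0 \<le> R"
  shows "finite (cell ` cball x R)" "real (card (cell ` cball x R)) \<le> (2 * R + 2) ^ CARD('d)"
proof -
  define A where "A k = {\<lfloor>x $ k - R\<rfloor>..\<lfloor>x $ k + R\<rfloor>}" for k :: 'd
  have sub: "cell ` cball x R \<subseteq> vec_lambda ` (PiE UNIV A)"
  proof
    fix z assume "z \<in> cell ` cball x R"
    then obtain y where y: "dist x y \<le> R" "z = cell y" by auto
    have "z $ k \<in> A k" for k
    proof -
      have "\<bar>(x - y) $ k\<bar> \<le> R" using y component_le_norm_cart[of "x - y" k] by (simp add: dist_norm)
      then have "x $ k - R \<le> y $ k" "y $ k \<le> x $ k + R" by auto
      then show ?thesis unfolding A_def y(2) cell_def by (auto intro: floor_mono)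
    qed
    then have "(\<lambda>k. z $ k) \<in> PiE UNIV A" by auto
    moreover have "z = vec_lambda (\<lambda>k. z $ k)" by simp
    ultimately show "z \<in> vec_lambda ` (PiE UNIV A)" by blast
  qed
  have fin: "finite (PiE UNIV A)" by (intro finite_PiE) (auto simp: A_def)
  then show "finite (cell ` cball x R)" using sub finite_surj by blast
  have "card (cell ` cball x R) \<le> card (PiE UNIV A)"
    using sub fin by (meson card_image_le card_mono finite_imageI order_trans)
  also have "\<dots> = (\<Prod>k\<in>UNIV. card (A k))" by (simp add: card_PiE)
  finally have "real (card (cell ` cball x R)) \<le> (\<Prod>k\<in>UNIV. real (card (A k)))"
    by (metis of_nat_mono of_nat_prod)
  also have "\<dots> \<le> (\<Prod>k\<in>(UNIV::'d set). 2 * R + 2)"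
  proof (intro prod_mono conjI)
    fix k
    have "0 \<le> \<lfloor>x $ k + R\<rfloor> - \<lfloor>x $ k - R\<rfloor> + 1" using assms floor_mono[of "x $ k - R" "x $ k + R"] by simp
    then have "real (card (A k)) = real_of_int (\<lfloor>x $ k + R\<rfloor> - \<lfloor>x $ k - R\<rfloor> + 1)"
      by (simp add: A_def)
    also have "\<dots> \<le> 2 * R + 2" by simp linarith
    finally show "real (card (A k)) \<le> 2 * R + 2" .
  qed auto
  finally show "real (card (cell ` cball x R)) \<le> (2 * R + 2) ^ CARD('d)" by simp
qed

lemma cell_vimage_measurable [measurable]: "{y. cell y = z} \<in> sets borel"
  for z :: "int ^ 'd"
proof -
  have "{y. cell y = z} = {y \<in> space borel. \<forall>k. \<lfloor>y $ k\<rfloor> = z $ k}"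
    by (simp add: cell_def vec_eq_iff)
  also have "\<dots> \<in> sets borel" by measurable
  finally show ?thesis .
qed

lemma cell_emeasure: "emeasure lborel {y :: real ^ 'd. cell y = z} \<le> 1"
proof -
  have "{y. cell y = z} \<subseteq> cbox (cell_corner z) (cell_corner z + 1)"
    by (auto simp: mem_box_cart cell_corner_def cell_def less_imp_le)
  then have "emeasure lborel {y. cell y = z} \<le> emeasure lborel (cbox (cell_corner z) (cell_corner z + 1))"
    by (intro emeasure_mono) auto
  also have "\<dots> = 1"
    by (subst emeasure_lborel_cbox) (auto simp: Basis_vec_def inner_axis intro!: prod.neutral)
  finally show ?thesis .
qed

text \<open>
  Rounding to a lattice of mesh \<open>h\<close>. With \<open>h = k / d\<close> the rounded point is within distance \<open>k\<close>, and a
  ball of radius \<open>K\<close> contains of order \<open>(K / k) ^ d\<close> of these points; this number enters the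
  recursion, so that taking all unit cells as centres would be too wasteful.
\<close>

definition grid_point :: "real \<Rightarrow> real ^ 'd \<Rightarrow> real ^ 'd" where
  "grid_point h y = h *\<^sub>R cell_corner (cell ((1 / h) *\<^sub>R y))"

lemma dist_grid_point:
  fixes y :: "real ^ 'd"
  assumes "0 < h"
  shows "dist y (grid_point h y) \<le> h * real CARD('d)"
proof -
  have "y - grid_point h y = h *\<^sub>R ((1 / h) *\<^sub>R y - cell_corner (cell ((1 / h) *\<^sub>R y)))"
    using assms by (simp add: grid_point_def scaleR_diff_right)
  then show ?thesis
    using assms norm_cell_offset[of "(1 / h) *\<^sub>R y"] by (simp add: dist_norm)
qed

lemma card_grid_points:
  fixes x :: "real ^ 'd"
  assumes "0 < h" "0 \<le> R"
  shows "finite (grid_point h ` cball x R)"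
    "real (card (grid_point h ` cball x R)) \<le> (2 * R / h + 2) ^ CARD('d)"
proof -
  let ?C = "cell ` cball ((1 / h) *\<^sub>R x) (R / h)"
  have sub: "grid_point h ` cball x R \<subseteq> (\<lambda>z. h *\<^sub>R cell_corner z) ` ?C"
  proof
    fix p assume "p \<in> grid_point h ` cball x R"
    then obtain y where y: "dist x y \<le> R" "p = grid_point h y" by auto
    have "dist ((1 / h) *\<^sub>R x) ((1 / h) *\<^sub>R y) = dist x y / h"
      using assms by (simp add: dist_norm scaleR_diff_right[symmetric])
    also have "\<dots> \<le> R / h" using y assms by (simp add: divide_right_mono)
    finally show "p \<in> (\<lambda>z. h *\<^sub>R cell_corner z) ` ?C"
      unfolding y(2) grid_point_def by auto
  qed
  have C: "finite ?C" "real (card ?C) \<le> (2 * (R / h) + 2) ^ CARD('d)"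
    using assms by (intro card_cells_cball; simp)+
  show "finite (grid_point h ` cball x R)" using sub C finite_surj by blast
  have "card (grid_point h ` cball x R) \<le> card ?C"
    by (rule surj_card_le[OF C(1) sub])
  then show "real (card (grid_point h ` cball x R)) \<le> (2 * R / h + 2) ^ CARD('d)"
    using C(2) by simp
qed

section \<open>Products of cell counts\<close>

lemma prod_mono_ennreal:
  fixes f g :: "'a \<Rightarrow> ennreal"
  assumes "\<And>x. x \<in> A \<Longrightarrow> f x \<le> g x"
  shows "prod f A \<le> prod g A"
  using assms by (induction A rule: infinite_finite_induct) (auto intro: mult_mono)

text \<open>
  The probabilities force \<open>N\<close> to be almost surely a natural number; \<open>k \<le> 2 ^ k\<close> then reduces the
  expectation to the exponential series.
\<close>

lemma nn_integral_poisson_le: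
  assumes [measurable]: "N \<in> borel_measurable M" and "prob_space M" and "0 \<le> b"
    and N: "\<And>k::nat. measure M {\<omega> \<in> space M. N \<omega> = (of_nat k :: ennreal)} = exp (- b) * b ^ k / fact k"
  shows "(\<integral>\<^sup>+\<omega>. N \<omega> \<partial>M) \<le> ennreal (exp b)"
proof -
  interpret prob_space M by fact
  define A where "A k = {\<omega> \<in> space M. N \<omega> = of_nat k}" for k :: nat
  have A [measurable]: "A k \<in> events" for k unfolding A_def by measurable
  have disj: "disjoint_family A" by (auto simp: disjoint_family_on_def A_def)
  have exps: "(\<lambda>k. c ^ k / fact k) sums exp c" for c :: real
    using exp_converges[of c] by (simp add: divide_inverse mult.commute)
  have "exp (- b) * exp b = 1" by (simp flip: exp_add)
  moreover have "(\<lambda>k. prob (A k)) sums (exp (- b) * exp b)"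
    using sums_mult[OF exps[of b], of "exp (- b)"] by (simp add: A_def N)
  moreover have "(\<lambda>k. prob (A k)) sums prob (\<Union>k. A k)"
    using disj by (intro finite_measure_UNION) auto
  ultimately have "prob (\<Union>k. A k) = 1" by (simp add: sums_unique2)
  then have AE: "AE \<omega> in M. \<omega> \<in> (\<Union>k. A k)"
    by (subst prob_eq_1[symmetric]) auto
  have "(\<integral>\<^sup>+\<omega>. N \<omega> \<partial>M) \<le> (\<integral>\<^sup>+\<omega>. (\<Sum>k. of_nat k * indicator (A k) \<omega>) \<partial>M)"
  proof (rule nn_integral_mono_AE)
    show "AE \<omega> in M. N \<omega> \<le> (\<Sum>k. of_nat k * indicator (A k) \<omega>)"
      using AE
    proof eventually_elim
      case (elim \<omega>)
      then obtain k where k: "\<omega> \<in> A k" by auto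
      then have "N \<omega> = (\<Sum>j\<in>{k}. of_nat j * indicator (A j) \<omega>)" by (auto simp: A_def)
      also have "\<dots> \<le> (\<Sum>j. of_nat j * indicator (A j) \<omega>)" by (intro sum_le_suminf) auto
      finally show ?case .
    qed
  qed
  also have "\<dots> = (\<Sum>k. of_nat k * emeasure M (A k))"
    by (subst nn_integral_suminf) (auto simp: nn_integral_cmult)
  also have "\<dots> \<le> (\<Sum>k. ennreal (exp (- b) * ((2 * b) ^ k / fact k)))"
  proof (intro suminf_le)
    fix k
    have "of_nat k * emeasure M (A k) = ennreal (real k * (exp (- b) * b ^ k / fact k))"
      unfolding emeasure_eq_measure A_def N unfolding ennreal_of_nat_eq_real_of_nat
      using \<open>0 \<le> b\<close> by (subst ennreal_mult) auto
    also have "\<dots> \<le> ennreal (2 ^ k * (exp (- b) * b ^ k / fact k))"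
      using \<open>0 \<le> b\<close> by (intro ennreal_leI mult_right_mono) (auto simp: of_nat_less_two_power less_imp_le)
    finally show "of_nat k * emeasure M (A k) \<le> ennreal (exp (- b) * ((2 * b) ^ k / fact k))"
      by (simp add: power_mult_distrib field_simps)
  qed auto
  also have "\<dots> = ennreal (exp (- b) * exp (2 * b))"
    using \<open>0 \<le> b\<close> by (intro suminf_ennreal_eq sums_mult exps) auto
  also have "\<dots> = ennreal (exp b)" by (simp flip: exp_add)
  finally show ?thesis .
qed

context wdrcm
begin

lemma X_measurable [measurable]: "X i \<in> borel_measurable M"
  using locations unfolding poisson_process_def percolated_lattice_def by auto

lemmas U_measurable [measurable] = marks_measurable

definition vertex_count :: "int ^ 'd \<Rightarrow> 'w \<Rightarrow> ennreal" where
  "vertex_count z \<omega> = (\<integral>\<^sup>+i. indicator {y. cell y = z} (X i \<omega>) \<partial>count_space UNIV)"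

lemma vertex_count_eq: "vertex_count z \<omega> = point_count (\<lambda>i. X i \<omega>) {y. cell y = z}"
proof -
  have "vertex_count z \<omega> = (\<integral>\<^sup>+i. indicator {i. X i \<omega> \<in> {y. cell y = z}} i \<partial>count_space UNIV)"
    unfolding vertex_count_def by (auto intro!: nn_integral_cong simp: indicator_def)
  also have "\<dots> = point_count (\<lambda>i. X i \<omega>) {y. cell y = z}"
    unfolding point_count_def by (rule nn_integral_indicator) simp
  finally show ?thesis .
qed

lemma vertex_count_measurable [measurable]: "vertex_count z \<in> borel_measurable M"
  unfolding vertex_count_def[abs_def] nn_integral_count_space_nat by measurable

text \<open>
  The distribution of the locations enters the proof only through this bound. For the Poisson
  process the counts of different cells are independent with bounded means; in the lattice case a
  unit cell contains exactly one lattice point, so that each count is at most \<open>1\<close>.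
\<close>

lemma vertex_count_moments:
  "\<exists>\<nu>\<ge>1. \<forall>S. finite S \<longrightarrow> (\<integral>\<^sup>+\<omega>. (\<Prod>z\<in>S. vertex_count z \<omega>) \<partial>M) \<le> ennreal \<nu> ^ card S"
  using locations
proof (elim disjE exE conjE)
  fix \<beta> :: real assume \<beta>: "0 < \<beta>" "poisson_process \<beta> X"
  note pp = \<beta>(2)[unfolded poisson_process_def]
  have mean: "(\<integral>\<^sup>+\<omega>. vertex_count z \<omega> \<partial>M) \<le> ennreal (exp \<beta>)" for z
  proof -
    let ?A = "{y :: real ^ 'd. cell y = z}"
    have 1: "measure lborel ?A \<le> 1"
      using enn2real_mono[OF cell_emeasure[of z]] by (simp add: measure_def)
    have fin: "emeasure lborel ?A < \<infinity>"
      by (rule le_less_trans[OF cell_emeasure]) simp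
    have "(\<integral>\<^sup>+\<omega>. vertex_count z \<omega> \<partial>M) \<le> ennreal (exp (\<beta> * measure lborel ?A))"
    proof (rule nn_integral_poisson_le)
      fix k :: nat
      show "prob {\<omega> \<in> space M. vertex_count z \<omega> = of_nat k} =
          exp (- (\<beta> * measure lborel ?A)) * (\<beta> * measure lborel ?A) ^ k / fact k"
        unfolding vertex_count_eq
        by (rule pp[THEN conjunct2, THEN conjunct1, rule_format, OF cell_vimage_measurable fin])
    qed (use \<beta> in \<open>auto simp: prob_space_axioms\<close>)
    also have "\<dots> \<le> ennreal (exp \<beta>)"
      using 1 \<beta>(1) by (intro ennreal_leI) (simp add: mult_left_le)
    finally show ?thesis .
  qed
  have "(\<integral>\<^sup>+\<omega>. (\<Prod>z\<in>S. vertex_count z \<omega>) \<partial>M) \<le> ennreal (exp \<beta>) ^ card S" if finS: "finite S" for S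
  proof -
    obtain g where g: "bij_betw g {0..<card S} S"
      using ex_bij_betw_nat_finite[OF finS] by blast
    define A where "A n = (if n < card S then {y. cell y = g n} else {})" for n
    have "range A \<subseteq> sets borel" by (auto simp: A_def)
    moreover have "disjoint_family A"
      using bij_betw_imp_inj_on[OF g] by (auto simp: disjoint_family_on_def A_def inj_on_def)
    ultimately have "indep_vars (\<lambda>_. borel) (\<lambda>n \<omega>. point_count (\<lambda>i. X i \<omega>) (A n)) UNIV"
      by (intro pp[THEN conjunct2, THEN conjunct2, rule_format] conjI)
    then have ind: "indep_vars (\<lambda>_. borel) (\<lambda>n \<omega>. point_count (\<lambda>i. X i \<omega>) (A n)) {0..<card S}"
      by (rule indep_vars_subset) auto
    have A: "point_count (\<lambda>i. X i \<omega>) (A n) = vertex_count (g n) \<omega>" if "n \<in> {0..<card S}" for n \<omega>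
      using that by (simp add: A_def vertex_count_eq)
    have "(\<integral>\<^sup>+\<omega>. (\<Prod>z\<in>S. vertex_count z \<omega>) \<partial>M) =
        (\<integral>\<^sup>+\<omega>. (\<Prod>n\<in>{0..<card S}. point_count (\<lambda>i. X i \<omega>) (A n)) \<partial>M)"
      by (intro nn_integral_cong) (simp add: A flip: prod.reindex_bij_betw[OF g])
    also have "\<dots> = (\<Prod>n\<in>{0..<card S}. \<integral>\<^sup>+\<omega>. point_count (\<lambda>i. X i \<omega>) (A n) \<partial>M)"
      by (rule indep_vars_nn_integral[OF _ ind]) auto
    also have "\<dots> \<le> (\<Prod>n\<in>{0..<card S}. ennreal (exp \<beta>))"
      using mean by (intro prod_mono_ennreal) (simp add: A)
    finally show ?thesis by simp
  qed
  then show ?thesis using \<beta>(1) by (intro exI[of _ "exp \<beta>"]) auto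
next
  fix p assume p: "percolated_lattice p X"
  then have ae: "AE \<omega> in M. inj (\<lambda>i. X i \<omega>) \<and> range (\<lambda>i. X i \<omega>) \<subseteq> int_lattice"
    unfolding percolated_lattice_def by blast
  have le1: "AE \<omega> in M. \<forall>z. vertex_count z \<omega> \<le> 1"
    using ae
  proof eventually_elim
    case (elim \<omega>)
    show ?case
    proof
      fix z
      have corner: "X i \<omega> = cell_corner (cell (X i \<omega>))" for i
      proof -
        have "X i \<omega> \<in> int_lattice" using elim by auto
        then have "X i \<omega> $ k = of_int \<lfloor>X i \<omega> $ k\<rfloor>" for k
          using of_int_floor unfolding int_lattice_def by force
        then show ?thesis
          unfolding cell_def cell_corner_def vec_eq_iff vec_lambda_beta by (rule allI)
      qed
      have sub: "i = j" if "cell (X i \<omega>) = z" "cell (X j \<omega>) = z" for i j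
      proof -
        have "X i \<omega> = X j \<omega>" using corner that by metis
        then show ?thesis using elim by (auto dest: injD)
      qed
      obtain i where "{i. X i \<omega> \<in> {y. cell y = z}} \<subseteq> {i}"
        using sub by (cases "\<exists>i. cell (X i \<omega>) = z") auto
      then have "emeasure (count_space UNIV) {i. X i \<omega> \<in> {y. cell y = z}} \<le> emeasure (count_space UNIV) {i}"
        by (intro emeasure_mono) auto
      then show "vertex_count z \<omega> \<le> 1" unfolding vertex_count_eq point_count_def by simp
    qed
  qed
  have "(\<integral>\<^sup>+\<omega>. (\<Prod>z\<in>S. vertex_count z \<omega>) \<partial>M) \<le> ennreal 1 ^ card S" for S
  proof -
    have "(\<integral>\<^sup>+\<omega>. (\<Prod>z\<in>S. vertex_count z \<omega>) \<partial>M) \<le> (\<integral>\<^sup>+\<omega>. 1 \<partial>M)"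
      using le1 by (intro nn_integral_mono_AE, eventually_elim) (auto intro!: prod_mono_ennreal[where g = "\<lambda>_. 1", simplified])
    then show ?thesis by (simp add: emeasure_space_1)
  qed
  then show ?thesis by (intro exI[of _ 1]) auto
qed

end

section \<open>Elementary requirements and their joint probability\<close>

abbreviation uniform01 :: "real measure" where
  "uniform01 \<equiv> uniform_measure lborel {0<..<1}"

lemma prob_space_uniform01: "prob_space uniform01"
  by (rule prob_space_uniform_measure) auto

lemma nn_integral_uniform01:
  assumes "g \<in> borel_measurable borel"
  shows "(\<integral>\<^sup>+a. g a \<partial>uniform01) = (\<integral>\<^sup>+a. g a * indicator {0<..<1} a \<partial>lborel)"
  using assms by (subst nn_integral_uniform_measure) (auto simp: divide_ennreal_def)

lemma nn_integral_uniform01_atMost: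
  assumes "0 \<le> u"
  shows "(\<integral>\<^sup>+a. indicator {..u} a \<partial>uniform01) \<le> ennreal u"
proof -
  have "(\<integral>\<^sup>+a. indicator {..u} a \<partial>uniform01) = (\<integral>\<^sup>+a. indicator {..u} a * indicator {0<..<1} a \<partial>lborel)"
    by (rule nn_integral_uniform01) auto
  also have "\<dots> \<le> (\<integral>\<^sup>+a. indicator {0..u} a \<partial>lborel)"
    by (intro nn_integral_mono) (auto simp: indicator_def)
  also have "\<dots> = ennreal u" using assms by simp
  finally show ?thesis .
qed

text \<open>
  In the bound \<open>\<kappa> / (a * b)\<close> on the connection probability the two marks separate, and each of them
  contributes only a logarithm.
\<close>

lemma nn_integral_uniform01_inverse:
  assumes "0 < u" "u \<le> 1"
  shows "(\<integral>\<^sup>+a. indicator {u..} a * ennreal (1 / a) \<partial>uniform01) \<le> ennreal (ln (1 / u))"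
proof -
  have "(\<integral>\<^sup>+a. indicator {u..} a * ennreal (1 / a) \<partial>uniform01) =
      (\<integral>\<^sup>+a. (indicator {u..} a * ennreal (1 / a)) * indicator {0<..<1} a \<partial>lborel)"
    by (rule nn_integral_uniform01) measurable
  also have "\<dots> \<le> (\<integral>\<^sup>+a. ennreal (1 / a) * indicator {u..1} a \<partial>lborel)"
    by (intro nn_integral_mono) (auto simp: indicator_def)
  also have "\<dots> = ennreal (ln 1 - ln u)"
    using assms
    by (intro nn_integral_FTC_Icc)
      (auto intro!: derivative_eq_intros simp: has_real_derivative_iff_has_vector_derivative[symmetric])
  finally show ?thesis using assms by (simp add: ln_div)
qed

text \<open>
  An elementary requirement concerns one or two unit cells. \<open>Strong z u\<close> asks for a vertex with mark
  at most \<open>u\<close> in the cell \<open>z\<close>. \<open>Long z w l u \<kappa>\<close> asks for an edge of length at least \<open>l\<close> between the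
  cells \<open>z\<close> and \<open>w\<close> with both marks at least \<open>u\<close>; the number \<open>\<kappa>\<close> only records a bound
  \<open>\<kappa> / (a * b)\<close> on the connection probability at distance \<open>l\<close>, from which the weight is computed.
\<close>

datatype 'z req = Strong 'z real | Long 'z 'z real real real

primrec req_cells :: "'z req \<Rightarrow> 'z set" where
  "req_cells (Strong z u) = {z}"
| "req_cells (Long z w l u \<kappa>) = {z, w}"

primrec req_factor :: "'z req \<Rightarrow> real" where
  "req_factor (Strong z u) = 1"
| "req_factor (Long z w l u \<kappa>) = \<kappa>"

primrec mark_density :: "'z req \<Rightarrow> real \<Rightarrow> ennreal" where
  "mark_density (Strong z u) = indicator {..u}"
| "mark_density (Long z w l u \<kappa>) = (\<lambda>a. indicator {u..} a * ennreal (1 / a))"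

text \<open>
  Here \<open>\<nu>\<close> bounds the mean number of vertices in a cell; the remaining factor bounds the
  probability for given vertices, integrated over their marks.
\<close>

primrec req_weight :: "real \<Rightarrow> 'z req \<Rightarrow> real" where
  "req_weight \<nu> (Strong z u) = \<nu> * u"
| "req_weight \<nu> (Long z w l u \<kappa>) = \<kappa> * (\<nu> * ln (1 / u))\<^sup>2"

lemma req_cells_finite [simp]: "finite (req_cells r)" by (cases r) auto

lemma req_cells_nonempty: "req_cells r \<noteq> {}" by (cases r) auto

lemma mark_density_measurable [measurable]: "mark_density r \<in> borel_measurable borel"
  by (cases r) auto

context wdrcm
begin

primrec valid_req :: "(int ^ 'd) req \<Rightarrow> bool" where
  "valid_req (Strong z u) \<longleftrightarrow> 0 \<le> u"
| "valid_req (Long z w l u \<kappa>) \<longleftrightarrow> z \<noteq> w \<and> 0 \<le> l \<and> 0 < u \<and> u \<le> 1 \<and> 0 \<le> \<kappa> \<and>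
     (\<forall>a b. u \<le> a \<longrightarrow> a \<le> b \<longrightarrow> b < 1 \<longrightarrow> \<rho> (a powr \<gamma> * b powr \<gamma>' * l ^ CARD('d)) \<le> \<kappa> / (a * b))"

primrec occurs :: "(int ^ 'd) req \<Rightarrow> 'w \<Rightarrow> bool" where
  "occurs (Strong z u) \<omega> \<longleftrightarrow> (\<exists>i. cell (X i \<omega>) = z \<and> U i \<omega> \<le> u)"
| "occurs (Long z w l u \<kappa>) \<omega> \<longleftrightarrow> (\<exists>i j. cell (X i \<omega>) = z \<and> cell (X j \<omega>) = w \<and>
     l \<le> dist (X i \<omega>) (X j \<omega>) \<and> u \<le> U i \<omega> \<and> u \<le> U j \<omega> \<and> (i, j) \<in> E \<omega>)"

text \<open>
  The split into a condition on locations and marks and a finite set of edges matches the form in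
  which conditional edge probabilities are given. Edges are stored as increasing pairs.
\<close>

primrec vertex_part :: "(int ^ 'd) req \<Rightarrow> (int ^ 'd \<Rightarrow> nat) \<Rightarrow> 'w \<Rightarrow> bool" where
  "vertex_part (Strong z u) f \<omega> \<longleftrightarrow> cell (X (f z) \<omega>) = z \<and> U (f z) \<omega> \<le> u"
| "vertex_part (Long z w l u \<kappa>) f \<omega> \<longleftrightarrow> cell (X (f z) \<omega>) = z \<and> cell (X (f w) \<omega>) = w \<and>
     l \<le> dist (X (f z) \<omega>) (X (f w) \<omega>) \<and> u \<le> U (f z) \<omega> \<and> u \<le> U (f w) \<omega>"

primrec edge_part :: "(int ^ 'd) req \<Rightarrow> (int ^ 'd \<Rightarrow> nat) \<Rightarrow> (nat \<times> nat) set" where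
  "edge_part (Strong z u) f = {}"
| "edge_part (Long z w l u \<kappa>) f = {(min (f z) (f w), max (f z) (f w))}"

lemma edge_measurable [measurable]: "Measurable.pred M (\<lambda>\<omega>. (i, j) \<in> E \<omega>)"
  using edges_measurable by (simp add: pred_def)

lemma cell_eq_measurable [measurable]: "Measurable.pred M (\<lambda>\<omega>. cell (X i \<omega>) = z)"
  using measurable_sets[OF X_measurable cell_vimage_measurable[of z], of i]
  by (simp add: pred_def vimage_def Int_def conj_commute)

lemma occurs_measurable [measurable]: "Measurable.pred M (occurs r)"
  by (cases r) (simp_all cong: measurable_cong)

text \<open>
  Vertices are assigned to cells, not to requirements: as the cells of a family of requirements are
  disjoint, one function \<open>f\<close> from cells to vertex indices can witness all of them.
\<close>

lemma occurs_witness: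
  assumes "valid_req r" "occurs r \<omega>" "\<omega> \<in> space M"
  shows "\<exists>f. vertex_part r f \<omega> \<and> edge_part r f \<subseteq> E \<omega>"
proof (cases r)
  case (Strong z u)
  then obtain i where "cell (X i \<omega>) = z" "U i \<omega> \<le> u" using assms by auto
  then show ?thesis using Strong by (intro exI[of _ "\<lambda>_. i"]) auto
next
  case (Long z w l u \<kappa>)
  then obtain i j where ij: "cell (X i \<omega>) = z" "cell (X j \<omega>) = w" "l \<le> dist (X i \<omega>) (X j \<omega>)"
    "u \<le> U i \<omega>" "u \<le> U j \<omega>" "(i, j) \<in> E \<omega>" using assms by auto
  have "(j, i) \<in> E \<omega>" using edges_sym[OF assms(3)] ij(6) by (auto dest: symD)
  then have "(min i j, max i j) \<in> E \<omega>" using ij(6) by (auto simp: min_def max_def)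
  moreover have "z \<noteq> w" using assms(1) Long by simp
  ultimately show ?thesis
    using Long ij by (intro exI[of _ "\<lambda>x. if x = z then i else j"]) auto
qed

lemma vertex_part_cong:
  "(\<And>z. z \<in> req_cells r \<Longrightarrow> f z = g z) \<Longrightarrow> vertex_part r f \<omega> = vertex_part r g \<omega>"
  "(\<And>z. z \<in> req_cells r \<Longrightarrow> f z = g z) \<Longrightarrow> edge_part r f = edge_part r g"
  by (cases r; auto)+

lemma vertex_part_cell: "vertex_part r f \<omega> \<Longrightarrow> z \<in> req_cells r \<Longrightarrow> cell (X (f z) \<omega>) = z"
  by (cases r) auto

abbreviation vertex_algebra :: "'w measure" where
  "vertex_algebra \<equiv> vimage_algebra (space M) (\<lambda>\<omega> i. (X i \<omega>, U i \<omega>)) (Pi\<^sub>M UNIV (\<lambda>_. borel))"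

lemma vertex_algebra_measurable:
  "X i \<in> borel_measurable vertex_algebra" "U i \<in> borel_measurable vertex_algebra"
proof -
  have "(\<lambda>\<omega> i. (X i \<omega>, U i \<omega>)) \<in> vertex_algebra \<rightarrow>\<^sub>M Pi\<^sub>M UNIV (\<lambda>_. borel)"
    by (rule measurable_vimage_algebra1) (auto simp: space_PiM)
  then have m: "(\<lambda>\<omega>. (X i \<omega>, U i \<omega>)) \<in> vertex_algebra \<rightarrow>\<^sub>M borel"
    by (rule measurable_compose[OF _ measurable_component_singleton]) auto
  show "X i \<in> borel_measurable vertex_algebra"
    using measurable_compose[OF m borel_measurable_continuous_onI[OF continuous_on_fst[OF continuous_on_id]]]
    by simp
  show "U i \<in> borel_measurable vertex_algebra"
    using measurable_compose[OF m borel_measurable_continuous_onI[OF continuous_on_snd[OF continuous_on_id]]]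
    by simp
qed

lemma vertex_algebra_subalgebra: "subalgebra M vertex_algebra"
proof -
  have "(\<lambda>\<omega>. \<omega>) \<in> M \<rightarrow>\<^sub>M vertex_algebra"
    by (rule measurable_vimage_algebra2)
      (auto intro!: measurable_PiM_single' borel_measurable_Pair simp: space_PiM)
  then have "A \<in> sets M" if "A \<in> sets vertex_algebra" for A
  proof -
    have "(\<lambda>\<omega>. \<omega>) -` A \<inter> space M = A" using sets.sets_into_space[OF that] by auto
    with measurable_sets[OF \<open>(\<lambda>\<omega>. \<omega>) \<in> M \<rightarrow>\<^sub>M vertex_algebra\<close> that] show ?thesis by simp
  qed
  then show ?thesis by (auto simp: subalgebra_def)
qed

lemma vertex_part_measurable: "{\<omega> \<in> space M. vertex_part r f \<omega>} \<in> sets vertex_algebra"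
proof -
  note [measurable] = vertex_algebra_measurable
  have [measurable]: "Measurable.pred vertex_algebra (\<lambda>\<omega>. cell (X i \<omega>) = z)" for i z
    using measurable_sets[OF vertex_algebra_measurable(1) cell_vimage_measurable[of z], of i]
    by (simp add: pred_def vimage_def Int_def conj_commute)
  have "Measurable.pred vertex_algebra (vertex_part r f)"
    by (cases r) (simp_all cong: measurable_cong)
  then show ?thesis by (simp add: pred_def)
qed

text \<open>
  The defining property of the conditional expectation, integrated over an event \<open>H\<close> that depends on
  locations and marks only.
\<close>

lemma emeasure_edges:
  assumes F: "finite F" "F \<subseteq> {(i, j). i < j}" and H: "H \<in> sets vertex_algebra"
  shows "emeasure M {\<omega> \<in> H. F \<subseteq> E \<omega>} = (\<integral>\<^sup>+\<omega>. indicator H \<omega> *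
    ennreal (\<Prod>(i, j)\<in>F. connection_prob \<gamma> \<gamma>' \<rho> (X i \<omega>, U i \<omega>) (X j \<omega>, U j \<omega>)) \<partial>M)"
proof -
  interpret sub: finite_measure_subalgebra M vertex_algebra
    by unfold_locales (rule vertex_algebra_subalgebra)
  have HM [measurable]: "H \<in> events"
    using H vertex_algebra_subalgebra by (auto simp: subalgebra_def)
  have FM [measurable]: "{\<omega> \<in> space M. F \<subseteq> E \<omega>} \<in> events"
  proof -
    have "{\<omega> \<in> space M. F \<subseteq> E \<omega>} = {\<omega> \<in> space M. \<forall>e\<in>F. (fst e, snd e) \<in> E \<omega>}" by auto
    also have "\<dots> \<in> events" using F(1) by measurable
    finally show ?thesis .
  qed
  define g :: "'w \<Rightarrow> real" where "g = indicator {\<omega> \<in> space M. F \<subseteq> E \<omega>}"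
  let ?r = "real_cond_exp M vertex_algebra g"
  have g: "integrable M g" unfolding g_def by (simp add: integrable_indicator_iff emeasure_eq_measure)
  have rint: "integrable M ?r" by (rule sub.real_cond_exp_int(1)[OF g])
  have ae: "AE \<omega> in M. ?r \<omega> = (\<Prod>(i, j)\<in>F. connection_prob \<gamma> \<gamma>' \<rho> (X i \<omega>, U i \<omega>) (X j \<omega>, U j \<omega>))"
    using edges_cond_indep[OF F] by (simp add: g_def)
  have pos: "AE \<omega> in M. 0 \<le> ?r \<omega>"
    by (rule sub.real_cond_exp_pos) (auto simp: g_def)
  have "emeasure M {\<omega> \<in> H. F \<subseteq> E \<omega>} = ennreal (LINT \<omega>:H|M. g \<omega>)"
  proof -
    have "(\<lambda>\<omega>. indicator H \<omega> *\<^sub>R g \<omega>) = indicator {\<omega> \<in> H. F \<subseteq> E \<omega>}"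
      using sets.sets_into_space[OF HM] by (auto simp: g_def indicator_def fun_eq_iff)
    moreover have "{\<omega> \<in> H. F \<subseteq> E \<omega>} = H \<inter> {\<omega> \<in> space M. F \<subseteq> E \<omega>}"
      using sets.sets_into_space[OF HM] by auto
    then have "{\<omega> \<in> H. F \<subseteq> E \<omega>} \<in> events" by simp
    ultimately show ?thesis by (simp add: set_lebesgue_integral_def emeasure_eq_measure)
  qed
  also have "(LINT \<omega>:H|M. g \<omega>) = (LINT \<omega>:H|M. ?r \<omega>)"
    by (rule sub.real_cond_exp_intA[OF g H])
  also have "ennreal \<dots> = (\<integral>\<^sup>+\<omega>. ennreal (indicator H \<omega> * ?r \<omega>) \<partial>M)"
    unfolding set_lebesgue_integral_def
    using pos rint by (subst nn_integral_eq_integral) (auto intro!: integrable_mult_indicator[of H M ?r, simplified])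
  also have "\<dots> = (\<integral>\<^sup>+\<omega>. indicator H \<omega> *
      ennreal (\<Prod>(i, j)\<in>F. connection_prob \<gamma> \<gamma>' \<rho> (X i \<omega>, U i \<omega>) (X j \<omega>, U j \<omega>)) \<partial>M)"
    using ae by (intro nn_integral_cong_AE, eventually_elim) (simp add: indicator_def)
  finally show ?thesis .
qed

lemma nn_integral_positions_marks:
  assumes A: "A \<in> sets (Pi\<^sub>M UNIV (\<lambda>_. borel))"
    and g: "g \<in> borel_measurable (Pi\<^sub>M UNIV (\<lambda>_. borel))"
  shows "(\<integral>\<^sup>+\<omega>. indicator A (\<lambda>i. X i \<omega>) * g (\<lambda>i. U i \<omega>) \<partial>M) =
    emeasure M {\<omega> \<in> space M. (\<lambda>i. X i \<omega>) \<in> A} * (\<integral>\<^sup>+u. g u \<partial>Pi\<^sub>M UNIV (\<lambda>_. uniform01))"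
proof -
  let ?PX = "Pi\<^sub>M UNIV (\<lambda>_::nat. borel :: (real ^ 'd) measure)"
  let ?PU = "Pi\<^sub>M UNIV (\<lambda>_::nat. borel :: real measure)"
  let ?DX = "distr M ?PX (\<lambda>\<omega> i. X i \<omega>)"
  let ?DU = "Pi\<^sub>M UNIV (\<lambda>_::nat. uniform01)"
  note A [measurable] g [measurable]
  interpret PU: prob_space ?DU by (intro prob_space_PiM prob_space_uniform01)
  have sets [measurable_cong]: "sets ?DU = sets ?PU" by (intro sets_PiM_cong) auto
  have mX [measurable]: "(\<lambda>\<omega> i. X i \<omega>) \<in> M \<rightarrow>\<^sub>M ?PX" by (rule measurable_PiM_single') auto
  have mU [measurable]: "(\<lambda>\<omega> i. U i \<omega>) \<in> M \<rightarrow>\<^sub>M ?PU" by (rule measurable_PiM_single') auto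
  have "(\<integral>\<^sup>+\<omega>. indicator A (\<lambda>i. X i \<omega>) * g (\<lambda>i. U i \<omega>) \<partial>M) =
    (\<integral>\<^sup>+(x, u). indicator A x * g u \<partial>distr M (?PX \<Otimes>\<^sub>M ?PU) (\<lambda>\<omega>. (\<lambda>i. X i \<omega>, \<lambda>i. U i \<omega>)))"
    by (subst nn_integral_distr) auto
  also have "\<dots> = (\<integral>\<^sup>+(x, u). indicator A x * g u \<partial>(?DX \<Otimes>\<^sub>M ?DU))"
    by (simp only: marks_distr)
  also have "\<dots> = (\<integral>\<^sup>+x. \<integral>\<^sup>+u. indicator A x * g u \<partial>?DU \<partial>?DX)"
    by (subst PU.nn_integral_fst[symmetric]) auto
  also have "\<dots> = (\<integral>\<^sup>+x. indicator A x * (\<integral>\<^sup>+u. g u \<partial>?DU) \<partial>?DX)"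
    by (intro nn_integral_cong nn_integral_cmult) measurable
  also have "\<dots> = emeasure ?DX A * (\<integral>\<^sup>+u. g u \<partial>?DU)"
    by (subst nn_integral_multc) auto
  also have "emeasure ?DX A = emeasure M {\<omega> \<in> space M. (\<lambda>i. X i \<omega>) \<in> A}"
    by (subst emeasure_distr) (auto intro!: arg_cong[where f = "emeasure M"])
  finally show ?thesis .
qed

lemma AE_marks: "AE \<omega> in M. \<forall>i. U i \<omega> \<in> {0<..<1}"
proof (subst AE_all_countable, rule allI)
  fix i
  let ?g = "\<lambda>u :: nat \<Rightarrow> real. indicator (- {0<..<1}) (u i) :: ennreal"
  have m: "?g \<in> borel_measurable (Pi\<^sub>M UNIV (\<lambda>_. borel))" by measurable
  have "AE u in Pi\<^sub>M UNIV (\<lambda>_. uniform01). u i \<in> {0<..<1}"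
    by (intro AE_PiM_component prob_space_uniform01) (auto intro!: AE_uniform_measureI)
  then have "AE u in Pi\<^sub>M UNIV (\<lambda>_. uniform01). ?g u = 0"
    by eventually_elim simp
  then have "(\<integral>\<^sup>+u. ?g u \<partial>Pi\<^sub>M UNIV (\<lambda>_. uniform01)) = 0"
    by (simp cong: nn_integral_cong_AE)
  then have "(\<integral>\<^sup>+\<omega>. ?g (\<lambda>i. U i \<omega>) \<partial>M) = 0"
    using nn_integral_positions_marks[of UNIV, OF _ m]
      sets.top[of "Pi\<^sub>M UNIV (\<lambda>_::nat. borel :: (real ^ 'd) measure)"]
    by (simp add: space_PiM)
  then have "AE \<omega> in M. ?g (\<lambda>i. U i \<omega>) = 0"
    by (subst (asm) nn_integral_0_iff_AE) measurable
  then show "AE \<omega> in M. U i \<omega> \<in> {0<..<1}"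
    by eventually_elim (auto simp: indicator_def split: if_splits)
qed

text \<open>
  Disjointness of the cells makes the vertices that serve different requirements different.
\<close>

definition witness :: "(int ^ 'd) req set \<Rightarrow> bool" where
  "witness W \<longleftrightarrow> finite W \<and> (\<forall>r\<in>W. valid_req r) \<and> disjoint_family_on req_cells W"

lemma req_weight_nonneg: "valid_req r \<Longrightarrow> 0 \<le> \<nu> \<Longrightarrow> 0 \<le> req_weight \<nu> r"
  by (cases r) auto

lemma nn_integral_slots:
  assumes S: "finite S" and f: "inj_on f S" and h: "\<And>z. z \<in> S \<Longrightarrow> h z \<in> borel_measurable borel"
  shows "(\<integral>\<^sup>+\<omega>. (\<Prod>z\<in>S. indicator {y. cell y = z} (X (f z) \<omega>) * h z (U (f z) \<omega>)) \<partial>M) =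
    (\<integral>\<^sup>+\<omega>. (\<Prod>z\<in>S. indicator {y. cell y = z} (X (f z) \<omega>)) \<partial>M) * (\<Prod>z\<in>S. \<integral>\<^sup>+a. h z a \<partial>uniform01)"
proof -
  let ?PX = "Pi\<^sub>M UNIV (\<lambda>_::nat. borel :: (real ^ 'd) measure)"
  let ?PU = "Pi\<^sub>M UNIV (\<lambda>_::nat. borel :: real measure)"
  define A where "A = {x \<in> space ?PX. \<forall>z\<in>S. x (f z) \<in> {y. cell y = z}}"
  have A: "A \<in> sets ?PX"
    unfolding A_def using S by measurable
  have ind: "(\<Prod>z\<in>S. indicator {y. cell y = z} (X (f z) \<omega>)) = (indicator A (\<lambda>i. X i \<omega>) :: ennreal)" for \<omega>
    using S by (auto simp: A_def space_PiM indicator_def intro!: prod.neutral)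
  define g where "g u = (\<Prod>z\<in>S. h z (u (f z)))" for u :: "nat \<Rightarrow> real"
  have g: "g \<in> borel_measurable ?PU"
    unfolding g_def
    by (intro borel_measurable_prod_ennreal measurable_compose[OF _ h] measurable_component_singleton) auto
  interpret product_sigma_finite "\<lambda>_::int ^ 'd. uniform01"
    by (intro product_sigma_finite.intro prob_space_imp_sigma_finite prob_space_uniform01)
  have "(\<integral>\<^sup>+\<omega>. (\<Prod>z\<in>S. indicator {y. cell y = z} (X (f z) \<omega>) * h z (U (f z) \<omega>)) \<partial>M) =
      (\<integral>\<^sup>+\<omega>. indicator A (\<lambda>i. X i \<omega>) * g (\<lambda>i. U i \<omega>) \<partial>M)"
    by (simp add: prod.distrib ind g_def)
  also have "\<dots> = emeasure M {\<omega> \<in> space M. (\<lambda>i. X i \<omega>) \<in> A} * (\<integral>\<^sup>+u. g u \<partial>Pi\<^sub>M UNIV (\<lambda>_. uniform01))"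
    by (rule nn_integral_positions_marks[OF A g])
  also have "emeasure M {\<omega> \<in> space M. (\<lambda>i. X i \<omega>) \<in> A} =
      (\<integral>\<^sup>+\<omega>. (\<Prod>z\<in>S. indicator {y. cell y = z} (X (f z) \<omega>)) \<partial>M)"
  proof -
    have mX: "(\<lambda>\<omega> i. X i \<omega>) \<in> M \<rightarrow>\<^sub>M ?PX" by (rule measurable_PiM_single') auto
    have "{\<omega> \<in> space M. (\<lambda>i. X i \<omega>) \<in> A} \<in> events"
      using measurable_sets[OF mX A] by (simp add: vimage_def Int_def conj_commute)
    moreover have "(\<integral>\<^sup>+\<omega>. indicator A (\<lambda>i. X i \<omega>) \<partial>M) =
        (\<integral>\<^sup>+\<omega>. indicator {\<omega> \<in> space M. (\<lambda>i. X i \<omega>) \<in> A} \<omega> \<partial>M)"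
      by (intro nn_integral_cong) (simp add: indicator_def)
    ultimately show ?thesis unfolding ind by simp
  qed
  also have "(\<integral>\<^sup>+u. g u \<partial>Pi\<^sub>M UNIV (\<lambda>_::nat. uniform01)) = (\<Prod>z\<in>S. \<integral>\<^sup>+a. h z a \<partial>uniform01)"
  proof -
    have re: "distr (Pi\<^sub>M UNIV (\<lambda>_::nat. uniform01)) (Pi\<^sub>M S (\<lambda>_. uniform01)) (\<lambda>u. \<lambda>z\<in>S. u (f z)) =
        Pi\<^sub>M S (\<lambda>_. uniform01)"
      by (rule distr_PiM_reindex) (auto simp: prob_space_uniform01 f)
    have m: "(\<lambda>u. \<lambda>z\<in>S. u (f z)) \<in> Pi\<^sub>M UNIV (\<lambda>_::nat. uniform01) \<rightarrow>\<^sub>M Pi\<^sub>M S (\<lambda>_. uniform01)"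
      by (intro measurable_restrict measurable_component_singleton) auto
    have h': "h z \<in> borel_measurable uniform01" if "z \<in> S" for z
      using h[OF that] by (simp cong: measurable_cong_sets)
    have m': "(\<lambda>v. \<Prod>z\<in>S. h z (v z)) \<in> borel_measurable (Pi\<^sub>M S (\<lambda>_. uniform01))"
      by (intro borel_measurable_prod_ennreal measurable_compose[OF _ h'] measurable_component_singleton) auto
    have "(\<integral>\<^sup>+u. g u \<partial>Pi\<^sub>M UNIV (\<lambda>_::nat. uniform01)) =
        (\<integral>\<^sup>+v. (\<Prod>z\<in>S. h z (v z)) \<partial>distr (Pi\<^sub>M UNIV (\<lambda>_::nat. uniform01)) (Pi\<^sub>M S (\<lambda>_. uniform01)) (\<lambda>u. \<lambda>z\<in>S. u (f z)))"
      by (subst nn_integral_distr[OF m]) (use m' in \<open>simp_all add: g_def[abs_def]\<close>)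
    also have "\<dots> = (\<Prod>z\<in>S. \<integral>\<^sup>+a. h z a \<partial>uniform01)"
      unfolding re using S h' by (rule product_nn_integral_prod)
    finally show ?thesis .
  qed
  finally show ?thesis .
qed

text \<open>
  Summing over all assignments of vertex indices to cells turns products of indicators into products
  of vertex counts. The order in which the vertices are enumerated thereby disappears.
\<close>

lemma nn_integral_all_slots:
  assumes S: "finite S"
  shows "(\<integral>\<^sup>+f. (\<integral>\<^sup>+\<omega>. (\<Prod>z\<in>S. indicator {y. cell y = z} (X (f z) \<omega>)) \<partial>M) \<partial>count_space (PiE S (\<lambda>_. UNIV))) =
    (\<integral>\<^sup>+\<omega>. (\<Prod>z\<in>S. vertex_count z \<omega>) \<partial>M)"
proof -
  interpret product_sigma_finite "\<lambda>_::int ^ 'd. count_space (UNIV :: nat set)"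
    by (intro product_sigma_finite.intro sigma_finite_measure_count_space_countable) auto
  have [measurable]: "(\<lambda>\<omega>. indicator {y. cell y = z} (X i \<omega>) :: ennreal) \<in> borel_measurable M" for i z
    by measurable
  have "(\<integral>\<^sup>+f. (\<integral>\<^sup>+\<omega>. (\<Prod>z\<in>S. indicator {y. cell y = z} (X (f z) \<omega>)) \<partial>M) \<partial>count_space (PiE S (\<lambda>_. UNIV))) =
      (\<integral>\<^sup>+\<omega>. (\<integral>\<^sup>+f. (\<Prod>z\<in>S. indicator {y. cell y = z} (X (f z) \<omega>)) \<partial>count_space (PiE S (\<lambda>_. UNIV))) \<partial>M)"
    using S by (intro nn_integral_count_space_nn_integral[symmetric] countable_PiE) auto
  also have "\<dots> = (\<integral>\<^sup>+\<omega>. (\<Prod>z\<in>S. vertex_count z \<omega>) \<partial>M)"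
  proof (rule nn_integral_cong)
    fix \<omega>
    have "count_space (PiE S (\<lambda>_. UNIV :: nat set)) = Pi\<^sub>M S (\<lambda>_. count_space UNIV)"
      using S by (intro count_space_PiM_finite[symmetric]) auto
    then show "(\<integral>\<^sup>+f. (\<Prod>z\<in>S. indicator {y. cell y = z} (X (f z) \<omega>)) \<partial>count_space (PiE S (\<lambda>_. UNIV))) =
        (\<Prod>z\<in>S. vertex_count z \<omega>)"
      unfolding vertex_count_def using S
      by (simp only:) (rule product_nn_integral_prod, auto)
  qed
  finally show ?thesis .
qed

text \<open>
  Since \<open>\<rho>\<close> decreases, the connection probability at a distance of at least \<open>l\<close> is at most the one at
  distance \<open>l\<close>, to which \<open>valid_req\<close> applies.
\<close>

lemma edge_part_bound:
  assumes valid: "valid_req r" and inj: "inj_on f (req_cells r)" and vp: "vertex_part r f \<omega>"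
    and marks: "\<And>i. U i \<omega> \<in> {0<..<1}"
  shows "ennreal (\<Prod>(i, j)\<in>edge_part r f. connection_prob \<gamma> \<gamma>' \<rho> (X i \<omega>, U i \<omega>) (X j \<omega>, U j \<omega>)) \<le>
    ennreal (req_factor r) * (\<Prod>z\<in>req_cells r. mark_density r (U (f z) \<omega>))"
proof (cases r)
  case (Strong z u)
  then show ?thesis using vp by simp
next
  case (Long z w l u \<kappa>)
  have zw: "z \<noteq> w" "0 \<le> l" "0 < u" "0 \<le> \<kappa>" using valid Long by auto
  have \<rho>: "\<And>a b. u \<le> a \<Longrightarrow> a \<le> b \<Longrightarrow> b < 1 \<Longrightarrow> \<rho> (a powr \<gamma> * b powr \<gamma>' * l ^ CARD('d)) \<le> \<kappa> / (a * b)"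
    using valid Long by auto
  define i j a b where "i = f z" and "j = f w" and "a = U i \<omega>" and "b = U j \<omega>"
  have ab: "u \<le> a" "u \<le> b" "a < 1" "b < 1"
    using vp Long marks[of i] marks[of j] by (auto simp: i_def j_def a_def b_def)
  have l: "l \<le> norm (X i \<omega> - X j \<omega>)" using vp Long by (simp add: i_def j_def dist_norm)
  have "(\<Prod>(i, j)\<in>edge_part r f. connection_prob \<gamma> \<gamma>' \<rho> (X i \<omega>, U i \<omega>) (X j \<omega>, U j \<omega>)) =
      \<rho> (min a b powr \<gamma> * max a b powr \<gamma>' * norm (X i \<omega> - X j \<omega>) ^ CARD('d))"
    by (auto simp: Long i_def[symmetric] j_def[symmetric] a_def b_def connection_prob_def min_def max_def
        norm_minus_commute)
  also have "\<dots> \<le> \<rho> (min a b powr \<gamma> * max a b powr \<gamma>' * l ^ CARD('d))"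
  proof -
    have "antimono_on {0..} \<rho>" using profile by (simp add: profile_function_def)
    then show ?thesis
      by (rule monotone_onD) (use zw l in \<open>auto intro!: mult_left_mono power_mono\<close>)
  qed
  also have "\<dots> \<le> \<kappa> / (min a b * max a b)"
    by (rule \<rho>) (use ab in auto)
  also have "\<dots> = \<kappa> * (1 / a * (1 / b))" by (simp add: min_def max_def)
  finally have "ennreal (\<Prod>(i, j)\<in>edge_part r f. connection_prob \<gamma> \<gamma>' \<rho> (X i \<omega>, U i \<omega>) (X j \<omega>, U j \<omega>)) \<le>
      ennreal (\<kappa> * (1 / a * (1 / b)))" by (rule ennreal_leI)
  also have "\<dots> = ennreal \<kappa> * (ennreal (1 / a) * ennreal (1 / b))"
    using ab zw by (subst ennreal_mult, simp, simp, subst ennreal_mult) auto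
  also have "\<dots> = ennreal (req_factor r) * (\<Prod>z\<in>req_cells r. mark_density r (U (f z) \<omega>))"
    using zw ab by (simp add: Long a_def b_def i_def j_def)
  finally show ?thesis .
qed

text \<open>
  A union bound over all assignments \<open>f\<close> of vertex indices to the cells. For a fixed injective \<open>f\<close>,
  conditioning on the vertices replaces the edges by their connection probabilities, which are
  bounded by a product over cells of functions of single marks; marks are independent of each
  other and of the locations. Assignments that are not injective are impossible, because each vertex
  lies in only one cell. The sum over \<open>f\<close> of the location probabilities is the mixed moment of
  the vertex counts.
\<close>

lemma witness_prob:
  assumes \<nu>: "0 \<le> \<nu>" "\<And>S. finite S \<Longrightarrow> (\<integral>\<^sup>+\<omega>. (\<Prod>z\<in>S. vertex_count z \<omega>) \<partial>M) \<le> ennreal \<nu> ^ card S"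
    and W: "witness W"
  shows "prob {\<omega> \<in> space M. \<forall>r\<in>W. occurs r \<omega>} \<le> (\<Prod>r\<in>W. req_weight \<nu> r)"
proof -
  have fin: "finite W" and valid: "\<And>r. r \<in> W \<Longrightarrow> valid_req r" and disj: "disjoint_family_on req_cells W"
    using W by (auto simp: witness_def)
  define S where "S = (\<Union>r\<in>W. req_cells r)"
  have S: "finite S" using fin by (simp add: S_def)
  have inS: "z \<in> S" if "r \<in> W" "z \<in> req_cells r" for r z using that by (auto simp: S_def)
  \<comment> \<open>Each cell belongs to exactly one requirement, so that products over requirements and over
    cells can be exchanged.\<close>
  define own where "own z = (THE r. r \<in> W \<and> z \<in> req_cells r)" for z
  have own: "own z = r" if "r \<in> W" "z \<in> req_cells r" for r z
    unfolding own_def using that disj by (intro the_equality) (auto simp: disjoint_family_on_def)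
  have prod_S: "prod g S = (\<Prod>r\<in>W. \<Prod>z\<in>req_cells r. g z)" for g :: "int ^ 'd \<Rightarrow> ennreal"
    unfolding S_def using fin disj
    by (intro prod.UNION_disjoint) (auto simp: disjoint_family_on_def)
  define h where "h z = mark_density (own z)" for z
  define c where "c = (\<Prod>r\<in>W. ennreal (req_factor r))"
  define B where "B f = {\<omega> \<in> space M. \<forall>r\<in>W. vertex_part r f \<omega> \<and> edge_part r f \<subseteq> E \<omega>}" for f
  define H where "H f = {\<omega> \<in> space M. \<forall>r\<in>W. vertex_part r f \<omega>}" for f
  define F where "F f = (\<Union>r\<in>W. edge_part r f)" for f
  have HF: "B f = {\<omega> \<in> H f. F f \<subseteq> E \<omega>}" for f by (auto simp: B_def H_def F_def)
  have finF: "finite (F f)" for f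
  proof -
    have "finite (edge_part r f)" for r by (cases r) auto
    then show ?thesis using fin by (simp add: F_def)
  qed
  have Hm: "H f \<in> sets vertex_algebra" for f
  proof -
    have "H f = {\<omega> \<in> space vertex_algebra. \<forall>r\<in>W. \<omega> \<in> {\<omega> \<in> space M. vertex_part r f \<omega>}}"
      by (auto simp: H_def)
    also have "\<dots> \<in> sets vertex_algebra"
      using fin vertex_part_measurable by (intro sets.sets_Collect_finite_All) auto
    finally show ?thesis .
  qed
  have Bm: "B f \<in> events" for f
  proof -
    have "B f = H f \<inter> {\<omega> \<in> space M. \<forall>e\<in>F f. (fst e, snd e) \<in> E \<omega>}"
      by (auto simp: HF H_def)
    moreover have "{\<omega> \<in> space M. \<forall>e\<in>F f. (fst e, snd e) \<in> E \<omega>} \<in> events"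
      using finF[of f] by measurable
    moreover have "H f \<in> events"
      using Hm vertex_algebra_subalgebra by (auto simp: subalgebra_def)
    ultimately show ?thesis by simp
  qed
  have cell_H: "cell (X (f z) \<omega>) = z" if "\<omega> \<in> H f" "z \<in> S" for f z \<omega>
    using that vertex_part_cell by (auto simp: H_def S_def)
  have one: "emeasure M (B f) \<le> c * (\<Prod>z\<in>S. \<integral>\<^sup>+a. h z a \<partial>uniform01) *
      (\<integral>\<^sup>+\<omega>. (\<Prod>z\<in>S. indicator {y. cell y = z} (X (f z) \<omega>)) \<partial>M)" for f
  proof (cases "inj_on f S")
    case False
    have "B f = {}"
    proof (rule ccontr)
      assume "B f \<noteq> {}"
      then obtain \<omega> where "\<omega> \<in> H f" by (auto simp: HF)
      then have "inj_on f S" by (intro inj_on_inverseI[of _ "\<lambda>i. cell (X i \<omega>)"]) (simp add: cell_H)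
      with False show False by simp
    qed
    then show ?thesis by simp
  next
    case inj: True
    have ne: "min (f z) (f w) < max (f z) (f w)" if "z \<in> S" "w \<in> S" "z \<noteq> w" for z w
    proof -
      have "f z \<noteq> f w" using inj that by (auto dest: inj_onD)
      then show ?thesis by (simp add: min_def max_def)
    qed
    have F_lt: "F f \<subseteq> {(i, j). i < j}"
    proof
      fix e assume "e \<in> F f"
      then obtain r where r: "r \<in> W" "e \<in> edge_part r f" by (auto simp: F_def)
      then show "e \<in> {(i, j). i < j}"
      proof (cases r)
        case (Long z w l u \<kappa>)
        then have "z \<in> S" "w \<in> S" using inS[OF r(1)] by auto
        then show ?thesis using ne[of z w] r Long valid[OF r(1)] by auto
      qed simp
    qed
    have edge_disj: "edge_part r f \<inter> edge_part r' f = {}" if "r \<in> W" "r' \<in> W" "r \<noteq> r'" for r r'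
    proof (rule ccontr)
      assume "edge_part r f \<inter> edge_part r' f \<noteq> {}"
      then obtain z w l u \<kappa> z' w' l' u' \<kappa>' where rr: "r = Long z w l u \<kappa>" "r' = Long z' w' l' u' \<kappa>'"
        "min (f z) (f w) = min (f z') (f w')" "max (f z) (f w) = max (f z') (f w')"
        by (cases r; cases r') auto
      have "f z = f z' \<or> f z = f w'" using rr(3,4) by (auto simp: min_def max_def split: if_splits)
      moreover have "z \<in> S" "z' \<in> S" "w' \<in> S" using rr(1,2) inS[OF that(1)] inS[OF that(2)] by auto
      ultimately have "z = z' \<or> z = w'" using inj by (auto dest: inj_onD)
      then have "z \<in> req_cells r \<inter> req_cells r'" using rr(1,2) by auto
      then show False using disj that by (auto simp: disjoint_family_on_def)
    qed
    have fin_edge: "finite (edge_part r f)" for r by (cases r) auto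
    let ?cp = "\<lambda>\<omega> (i, j). connection_prob \<gamma> \<gamma>' \<rho> (X i \<omega>, U i \<omega>) (X j \<omega>, U j \<omega>)"
    have cp_nonneg: "0 \<le> ?cp \<omega> e" for \<omega> e
      using profile by (auto simp: profile_function_def connection_prob_def split: prod.splits)
    have "emeasure M (B f) = (\<integral>\<^sup>+\<omega>. indicator (H f) \<omega> * ennreal (prod (?cp \<omega>) (F f)) \<partial>M)"
      unfolding HF by (rule emeasure_edges[OF finF F_lt Hm])
    also have "\<dots> \<le> (\<integral>\<^sup>+\<omega>. c * (\<Prod>z\<in>S. indicator {y. cell y = z} (X (f z) \<omega>) * h z (U (f z) \<omega>)) \<partial>M)"
    proof (rule nn_integral_mono_AE)
      show "AE \<omega> in M. indicator (H f) \<omega> * ennreal (prod (?cp \<omega>) (F f)) \<le>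
          c * (\<Prod>z\<in>S. indicator {y. cell y = z} (X (f z) \<omega>) * h z (U (f z) \<omega>))"
        using AE_marks
      proof eventually_elim
        case (elim \<omega>)
        show ?case
        proof (cases "\<omega> \<in> H f")
          case True
          have "prod (?cp \<omega>) (F f) = (\<Prod>r\<in>W. prod (?cp \<omega>) (edge_part r f))"
            unfolding F_def using fin fin_edge edge_disj by (intro prod.UNION_disjoint) auto
          then have "ennreal (prod (?cp \<omega>) (F f)) = (\<Prod>r\<in>W. ennreal (prod (?cp \<omega>) (edge_part r f)))"
            using cp_nonneg by (simp add: prod_ennreal prod_nonneg)
          also have "\<dots> \<le> (\<Prod>r\<in>W. ennreal (req_factor r) * (\<Prod>z\<in>req_cells r. mark_density r (U (f z) \<omega>)))"
          proof (intro prod_mono_ennreal edge_part_bound valid)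
            show "inj_on f (req_cells r)" if "r \<in> W" for r
              using inS[OF that] by (intro inj_on_subset[OF inj]) auto
            show "vertex_part r f \<omega>" if "r \<in> W" for r using True that by (simp add: H_def)
          qed (use elim in auto)
          also have "\<dots> = c * (\<Prod>z\<in>S. h z (U (f z) \<omega>))"
            unfolding prod.distrib c_def prod_S by (simp add: h_def own cong: prod.cong)
          also have "(\<Prod>z\<in>S. h z (U (f z) \<omega>)) =
              (\<Prod>z\<in>S. indicator {y. cell y = z} (X (f z) \<omega>) * h z (U (f z) \<omega>))"
            by (intro prod.cong) (simp_all add: cell_H[OF True])
          finally show ?thesis using True by simp
        qed simp
      qed
    qed
    also have "\<dots> = c * (\<integral>\<^sup>+\<omega>. (\<Prod>z\<in>S. indicator {y. cell y = z} (X (f z) \<omega>) * h z (U (f z) \<omega>)) \<partial>M)"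
    proof (rule nn_integral_cmult)
      have "(\<lambda>\<omega>. indicator {y. cell y = z} (X i \<omega>) * h z (U i \<omega>)) \<in> borel_measurable M" for z i
        unfolding h_def by measurable
      then show "(\<lambda>\<omega>. \<Prod>z\<in>S. indicator {y. cell y = z} (X (f z) \<omega>) * h z (U (f z) \<omega>)) \<in> borel_measurable M"
        by (intro borel_measurable_prod_ennreal) auto
    qed
    also have "\<dots> = c * (\<Prod>z\<in>S. \<integral>\<^sup>+a. h z a \<partial>uniform01) *
        (\<integral>\<^sup>+\<omega>. (\<Prod>z\<in>S. indicator {y. cell y = z} (X (f z) \<omega>)) \<partial>M)"
      by (subst nn_integral_slots[OF S inj]) (auto simp: h_def ac_simps)
    finally show ?thesis .
  qed
  \<comment> \<open>The union bound over assignments, written as an inequality between indicator functions.\<close>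
  have cover: "indicator {\<omega> \<in> space M. \<forall>r\<in>W. occurs r \<omega>} \<omega> \<le>
      (\<integral>\<^sup>+f. indicator (B f) \<omega> \<partial>count_space (PiE S (\<lambda>_. UNIV)))" for \<omega>
  proof (cases "\<omega> \<in> space M \<and> (\<forall>r\<in>W. occurs r \<omega>)")
    case True
    then have "\<forall>r\<in>W. \<exists>f. vertex_part r f \<omega> \<and> edge_part r f \<subseteq> E \<omega>"
      using occurs_witness valid by blast
    from bchoice[OF this] obtain fs
      where fs: "\<And>r. r \<in> W \<Longrightarrow> vertex_part r (fs r) \<omega> \<and> edge_part r (fs r) \<subseteq> E \<omega>"
      by blast
    define f where "f = (\<lambda>z\<in>S. fs (own z) z)"
    have f: "f z = fs r z" if "r \<in> W" "z \<in> req_cells r" for r z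
      using that own by (auto simp: f_def S_def)
    have "vertex_part r f \<omega> \<and> edge_part r f \<subseteq> E \<omega>" if "r \<in> W" for r
      using fs[OF that] vertex_part_cong[of r f "fs r"] f[OF that] by simp
    then have "\<omega> \<in> B f" using True by (auto simp: B_def)
    moreover have "f \<in> PiE S (\<lambda>_. UNIV)" by (auto simp: f_def)
    ultimately have "1 \<le> (\<integral>\<^sup>+f. indicator (B f) \<omega> \<partial>count_space (PiE S (\<lambda>_. UNIV)))"
      using nn_integral_ge_point[of f "PiE S (\<lambda>_. UNIV)" "\<lambda>f. indicator (B f) \<omega> :: ennreal"] by simp
    then show ?thesis using True by simp
  qed auto
  have m: "{\<omega> \<in> space M. \<forall>r\<in>W. occurs r \<omega>} \<in> events"
    using fin by measurable
  have "emeasure M {\<omega> \<in> space M. \<forall>r\<in>W. occurs r \<omega>} =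
      (\<integral>\<^sup>+\<omega>. indicator {\<omega> \<in> space M. \<forall>r\<in>W. occurs r \<omega>} \<omega> \<partial>M)"
    using m by simp
  also have "\<dots> \<le> (\<integral>\<^sup>+\<omega>. (\<integral>\<^sup>+f. indicator (B f) \<omega> \<partial>count_space (PiE S (\<lambda>_. UNIV))) \<partial>M)"
    by (intro nn_integral_mono cover)
  also have "\<dots> = (\<integral>\<^sup>+f. emeasure M (B f) \<partial>count_space (PiE S (\<lambda>_. UNIV)))"
    using S Bm by (subst nn_integral_count_space_nn_integral) (auto intro!: countable_PiE)
  also have "\<dots> \<le> (\<integral>\<^sup>+f. c * (\<Prod>z\<in>S. \<integral>\<^sup>+a. h z a \<partial>uniform01) *
      (\<integral>\<^sup>+\<omega>. (\<Prod>z\<in>S. indicator {y. cell y = z} (X (f z) \<omega>)) \<partial>M) \<partial>count_space (PiE S (\<lambda>_. UNIV)))"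
    by (intro nn_integral_mono one)
  also have "\<dots> = c * (\<Prod>z\<in>S. \<integral>\<^sup>+a. h z a \<partial>uniform01) * (\<integral>\<^sup>+\<omega>. (\<Prod>z\<in>S. vertex_count z \<omega>) \<partial>M)"
    by (subst nn_integral_cmult) (auto simp: nn_integral_all_slots[OF S])
  also have "\<dots> \<le> c * (\<Prod>z\<in>S. \<integral>\<^sup>+a. h z a \<partial>uniform01) * (\<Prod>z\<in>S. ennreal \<nu>)"
    using \<nu>(2)[OF S] by (intro mult_left_mono) auto
  also have "\<dots> = c * (\<Prod>z\<in>S. ennreal \<nu> * (\<integral>\<^sup>+a. h z a \<partial>uniform01))"
    by (simp add: prod.distrib mult_ac)
  also have "\<dots> = (\<Prod>r\<in>W. ennreal (req_factor r) *
      (\<Prod>z\<in>req_cells r. ennreal \<nu> * (\<integral>\<^sup>+a. mark_density r a \<partial>uniform01)))"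
    unfolding prod.distrib[symmetric] c_def prod_S by (simp add: h_def own cong: prod.cong)
  also have "\<dots> \<le> (\<Prod>r\<in>W. ennreal (req_weight \<nu> r))"
  proof (rule prod_mono_ennreal)
    fix r assume "r \<in> W"
    then have v: "valid_req r" by (rule valid)
    show "ennreal (req_factor r) * (\<Prod>z\<in>req_cells r. ennreal \<nu> * (\<integral>\<^sup>+a. mark_density r a \<partial>uniform01)) \<le>
        ennreal (req_weight \<nu> r)"
    proof (cases r)
      case (Strong z u)
      then show ?thesis
        using v \<nu>(1) nn_integral_uniform01_atMost[of u]
        by (simp add: ennreal_mult mult_left_mono)
    next
      case (Long z w l u \<kappa>)
      let ?I = "\<integral>\<^sup>+a. indicator {u..} a * ennreal (1 / a) \<partial>uniform01"
      have uz: "0 < u" "u \<le> 1" "z \<noteq> w" "0 \<le> \<kappa>" using v Long by auto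
      have I: "?I \<le> ennreal (ln (1 / u))" using uz by (intro nn_integral_uniform01_inverse) auto
      have "ennreal (req_factor r) * (\<Prod>z\<in>req_cells r. ennreal \<nu> * (\<integral>\<^sup>+a. mark_density r a \<partial>uniform01)) =
          ennreal \<kappa> * ((ennreal \<nu> * ?I) * (ennreal \<nu> * ?I))"
        using uz by (simp add: Long)
      also have "\<dots> \<le> ennreal \<kappa> * ((ennreal \<nu> * ennreal (ln (1 / u))) * (ennreal \<nu> * ennreal (ln (1 / u))))"
        using I by (intro mult_mono) auto
      also have "\<dots> = ennreal (req_weight \<nu> r)"
        using uz \<nu>(1) by (simp add: Long power2_eq_square ennreal_mult[symmetric] ln_ge_zero)
      finally show ?thesis .
    qed
  qed
  also have "\<dots> = ennreal (\<Prod>r\<in>W. req_weight \<nu> r)"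
    using req_weight_nonneg[OF valid \<nu>(1)] by (intro prod_ennreal) auto
  finally show ?thesis
    using req_weight_nonneg[OF valid \<nu>(1)]
    by (simp add: emeasure_eq_measure prod_nonneg)
qed

end

section \<open>Covers by requirements on disjoint cells\<close>

context wdrcm
begin

text \<open>
  The weight \<open>p\<close> is an upper bound for the probability of \<open>A\<close> that comes with a certificate, a family
  of witnesses over the region \<open>S\<close>. With these bounds one can calculate as if events over disjoint
  regions were independent.
\<close>

definition covered :: "real \<Rightarrow> (int ^ 'd) set \<Rightarrow> 'w set \<Rightarrow> real \<Rightarrow> bool" where
  "covered \<nu> S A p \<longleftrightarrow> (\<exists>\<W>. finite \<W> \<and> (\<forall>W\<in>\<W>. witness W \<and> (\<Union>r\<in>W. req_cells r) \<subseteq> S) \<and>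
     A \<subseteq> (\<Union>W\<in>\<W>. {\<omega>. \<forall>r\<in>W. occurs r \<omega>}) \<and> (\<Sum>W\<in>\<W>. \<Prod>r\<in>W. req_weight \<nu> r) \<le> p)"

lemma witness_weight_nonneg:
  "witness W \<Longrightarrow> 0 \<le> \<nu> \<Longrightarrow> 0 \<le> (\<Prod>r\<in>W. req_weight \<nu> r)"
  by (intro prod_nonneg) (auto simp: witness_def intro: req_weight_nonneg)

lemma coveredI:
  assumes "finite \<W>" "\<And>W. W \<in> \<W> \<Longrightarrow> witness W" "\<And>W r. W \<in> \<W> \<Longrightarrow> r \<in> W \<Longrightarrow> req_cells r \<subseteq> S"
    "\<And>\<omega>. \<omega> \<in> A \<Longrightarrow> \<exists>W\<in>\<W>. \<forall>r\<in>W. occurs r \<omega>" "(\<Sum>W\<in>\<W>. \<Prod>r\<in>W. req_weight \<nu> r) \<le> p"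
  shows "covered \<nu> S A p"
  unfolding covered_def
proof (intro exI conjI)
  show "\<forall>W\<in>\<W>. witness W \<and> (\<Union>r\<in>W. req_cells r) \<subseteq> S" using assms(2,3) by (simp add: UN_least)
  show "A \<subseteq> (\<Union>W\<in>\<W>. {\<omega>. \<forall>r\<in>W. occurs r \<omega>})" using assms(4) by (simp add: subset_iff)
qed (use assms(1,5) in auto)

lemma coveredE:
  assumes "covered \<nu> S A p"
  obtains \<W> where "finite \<W>" "\<And>W. W \<in> \<W> \<Longrightarrow> witness W" "\<And>W r. W \<in> \<W> \<Longrightarrow> r \<in> W \<Longrightarrow> req_cells r \<subseteq> S"
    "\<And>\<omega>. \<omega> \<in> A \<Longrightarrow> \<exists>W\<in>\<W>. \<forall>r\<in>W. occurs r \<omega>" "(\<Sum>W\<in>\<W>. \<Prod>r\<in>W. req_weight \<nu> r) \<le> p"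
proof -
  from assms obtain \<W> where W: "finite \<W>" "\<forall>W\<in>\<W>. witness W \<and> (\<Union>r\<in>W. req_cells r) \<subseteq> S"
     "A \<subseteq> (\<Union>W\<in>\<W>. {\<omega>. \<forall>r\<in>W. occurs r \<omega>})" "(\<Sum>W\<in>\<W>. \<Prod>r\<in>W. req_weight \<nu> r) \<le> p"
    unfolding covered_def by (elim exE conjE)
  show ?thesis
  proof (rule that[OF W(1) _ _ _ W(4)])
    show "witness W" if "W \<in> \<W>" for W using W(2) that by simp
    show "req_cells r \<subseteq> S" if "W \<in> \<W>" "r \<in> W" for W r using bspec[OF W(2) that(1)] that(2) by (simp add: UN_subset_iff)
    show "\<exists>W\<in>\<W>. \<forall>r\<in>W. occurs r \<omega>" if "\<omega> \<in> A" for \<omega> using subsetD[OF W(3) that] by simp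
  qed
qed

lemma covered_mono:
  assumes "covered \<nu> S A p" "S \<subseteq> S'" "A' \<subseteq> A" "p \<le> p'"
  shows "covered \<nu> S' A' p'"
  using assms(1)
proof (rule coveredE)
  fix \<W> assume W: "finite \<W>" "\<And>W. W \<in> \<W> \<Longrightarrow> witness W" "\<And>W r. W \<in> \<W> \<Longrightarrow> r \<in> W \<Longrightarrow> req_cells r \<subseteq> S"
    "\<And>\<omega>. \<omega> \<in> A \<Longrightarrow> \<exists>W\<in>\<W>. \<forall>r\<in>W. occurs r \<omega>" "(\<Sum>W\<in>\<W>. \<Prod>r\<in>W. req_weight \<nu> r) \<le> p"
  show ?thesis
  proof (rule coveredI[OF W(1,2)])
    show "req_cells r \<subseteq> S'" if "W \<in> \<W>" "r \<in> W" for W r using W(3)[OF that] assms(2) by simp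
    show "\<exists>W\<in>\<W>. \<forall>r\<in>W. occurs r \<omega>" if "\<omega> \<in> A'" for \<omega> using W(4) that assms(3) by (simp add: subset_iff)
  qed (use W(5) assms(4) in auto)
qed

lemma covered_empty: "covered \<nu> S {} 0"
  by (rule coveredI[of "{}"]) auto

lemma covered_Un:
  assumes "covered \<nu> S A p" "covered \<nu> S B q" "0 \<le> \<nu>"
  shows "covered \<nu> S (A \<union> B) (p + q)"
proof -
  obtain \<V> where V: "finite \<V>" "\<And>W. W \<in> \<V> \<Longrightarrow> witness W" "\<And>W r. W \<in> \<V> \<Longrightarrow> r \<in> W \<Longrightarrow> req_cells r \<subseteq> S"
     "\<And>\<omega>. \<omega> \<in> A \<Longrightarrow> \<exists>W\<in>\<V>. \<forall>r\<in>W. occurs r \<omega>" "(\<Sum>W\<in>\<V>. \<Prod>r\<in>W. req_weight \<nu> r) \<le> p"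
    by (rule coveredE[OF assms(1)], rule that, (assumption | simp)+)
  obtain \<W> where W: "finite \<W>" "\<And>W. W \<in> \<W> \<Longrightarrow> witness W" "\<And>W r. W \<in> \<W> \<Longrightarrow> r \<in> W \<Longrightarrow> req_cells r \<subseteq> S"
     "\<And>\<omega>. \<omega> \<in> B \<Longrightarrow> \<exists>W\<in>\<W>. \<forall>r\<in>W. occurs r \<omega>" "(\<Sum>W\<in>\<W>. \<Prod>r\<in>W. req_weight \<nu> r) \<le> q"
    by (rule coveredE[OF assms(2)], rule that, (assumption | simp)+)
  have "0 \<le> (\<Sum>W\<in>\<V> \<inter> \<W>. \<Prod>r\<in>W. req_weight \<nu> r)"
    using V(2) assms(3) by (intro sum_nonneg witness_weight_nonneg) auto
  then have "(\<Sum>W\<in>\<V> \<union> \<W>. \<Prod>r\<in>W. req_weight \<nu> r) \<le> p + q"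
    using sum.union_inter[OF V(1) W(1), of "\<lambda>W. \<Prod>r\<in>W. req_weight \<nu> r"] V(5) W(5) by linarith
  then show ?thesis
  proof (rule coveredI[rotated -1])
    fix \<omega> assume "\<omega> \<in> A \<union> B"
    then show "\<exists>W\<in>\<V> \<union> \<W>. \<forall>r\<in>W. occurs r \<omega>"
      using V(4)[of \<omega>] W(4)[of \<omega>] by (simp add: bex_Un) blast
  next
    fix W r assume "W \<in> \<V> \<union> \<W>" "r \<in> W"
    then show "req_cells r \<subseteq> S" using V(3) W(3) by (elim UnE)
  qed (use V(1,2) W(1,2) in auto)
qed

lemma covered_UN:
  assumes "finite I" "\<And>i. i \<in> I \<Longrightarrow> covered \<nu> S (A i) (p i)" "0 \<le> \<nu>"
  shows "covered \<nu> S (\<Union>i\<in>I. A i) (\<Sum>i\<in>I. p i)"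
  using assms(1,2)
  by (induction I rule: finite_induct) (simp_all add: covered_empty covered_Un assms(3))

text \<open>
  Uniting a witness over \<open>S\<close> with a witness over \<open>T\<close> keeps the cells disjoint, and the weights
  multiply.
\<close>

lemma covered_Int:
  assumes "covered \<nu> S A p" "covered \<nu> T B q" "S \<inter> T = {}" "0 \<le> \<nu>"
  shows "covered \<nu> (S \<union> T) (A \<inter> B) (p * q)"
proof -
  obtain \<V> where V: "finite \<V>" "\<And>W. W \<in> \<V> \<Longrightarrow> witness W" "\<And>W r. W \<in> \<V> \<Longrightarrow> r \<in> W \<Longrightarrow> req_cells r \<subseteq> S"
     "\<And>\<omega>. \<omega> \<in> A \<Longrightarrow> \<exists>W\<in>\<V>. \<forall>r\<in>W. occurs r \<omega>" "(\<Sum>W\<in>\<V>. \<Prod>r\<in>W. req_weight \<nu> r) \<le> p"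
    by (rule coveredE[OF assms(1)], rule that, (assumption | simp)+)
  obtain \<W> where W: "finite \<W>" "\<And>W. W \<in> \<W> \<Longrightarrow> witness W" "\<And>W r. W \<in> \<W> \<Longrightarrow> r \<in> W \<Longrightarrow> req_cells r \<subseteq> T"
     "\<And>\<omega>. \<omega> \<in> B \<Longrightarrow> \<exists>W\<in>\<W>. \<forall>r\<in>W. occurs r \<omega>" "(\<Sum>W\<in>\<W>. \<Prod>r\<in>W. req_weight \<nu> r) \<le> q"
    by (rule coveredE[OF assms(2)], rule that, (assumption | simp)+)
  let ?w = "\<lambda>W. \<Prod>r\<in>W. req_weight \<nu> r"
  let ?u = "\<lambda>(V, W). V \<union> W"
  have cells: "req_cells r \<inter> req_cells s = {}" if "V \<in> \<V>" "W \<in> \<W>" "r \<in> V" "s \<in> W" for V W r s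
    using V(3)[OF that(1,3)] W(3)[OF that(2,4)] assms(3) by blast
  have disj: "V \<inter> W = {}" if "V \<in> \<V>" "W \<in> \<W>" for V W
  proof (rule equals0I)
    fix r assume "r \<in> V \<inter> W"
    then show False using cells[OF that, of r r] req_cells_nonempty[of r] by simp
  qed
  have wit: "witness (V \<union> W)" if "V \<in> \<V>" "W \<in> \<W>" for V W
    unfolding witness_def
  proof (intro conjI)
    show "finite (V \<union> W)" "\<forall>r\<in>V \<union> W. valid_req r"
      using V(2)[OF that(1)] W(2)[OF that(2)] by (auto simp: witness_def)
    show "disjoint_family_on req_cells (V \<union> W)"
      unfolding disjoint_family_on_def
    proof (intro ballI impI)
      fix r s assume rs: "r \<in> V \<union> W" "s \<in> V \<union> W" "r \<noteq> s"
      have "disjoint_family_on req_cells V" "disjoint_family_on req_cells W"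
        using V(2)[OF that(1)] W(2)[OF that(2)] unfolding witness_def by simp_all
      note within = this[THEN disjoint_family_onD]
      consider "r \<in> V" "s \<in> V" | "r \<in> W" "s \<in> W" | "r \<in> V" "s \<in> W" | "r \<in> W" "s \<in> V"
        using rs(1,2) by (elim UnE)
      then show "req_cells r \<inter> req_cells s = {}"
      proof cases
        case 1
        then show ?thesis using within(1) rs(3) by simp
      next
        case 2
        then show ?thesis using within(2) rs(3) by simp
      next
        case 3
        then show ?thesis by (rule cells[OF that])
      next
        case 4
        then show ?thesis using cells[OF that 4(2,1)] by (simp only: Int_commute)
      qed
    qed
  qed
  have w: "?w (V \<union> W) = ?w V * ?w W" if "V \<in> \<V>" "W \<in> \<W>" for V W
    using V(2)[OF that(1)] W(2)[OF that(2)] disj[OF that]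
    by (intro prod.union_disjoint) (auto simp: witness_def)
  have "(\<Sum>U\<in>?u ` (\<V> \<times> \<W>). ?w U) \<le> (\<Sum>VW\<in>\<V> \<times> \<W>. ?w (?u VW))"
    using V(1) W(1) wit assms(4)
    by (intro sum_image_le[of _ ?w ?u, unfolded o_def]) (auto intro!: witness_weight_nonneg)
  also have "\<dots> = (\<Sum>V\<in>\<V>. \<Sum>W\<in>\<W>. ?w V * ?w W)"
    unfolding sum.cartesian_product by (intro sum.cong) (auto simp: w)
  also have "\<dots> = (\<Sum>V\<in>\<V>. ?w V) * (\<Sum>W\<in>\<W>. ?w W)"
    by (simp add: sum_product)
  also have "\<dots> \<le> p * q"
  proof (intro mult_mono)
    have "0 \<le> (\<Sum>V\<in>\<V>. ?w V)" using V(2) assms(4) by (intro sum_nonneg witness_weight_nonneg) auto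
    then show "0 \<le> p" using V(5) by linarith
    show "0 \<le> (\<Sum>W\<in>\<W>. ?w W)" using W(2) assms(4) by (intro sum_nonneg witness_weight_nonneg) auto
  qed (use V W in auto)
  finally have "(\<Sum>U\<in>?u ` (\<V> \<times> \<W>). ?w U) \<le> p * q" .
  then show ?thesis
  proof (rule coveredI[rotated -1])
    show "finite (?u ` (\<V> \<times> \<W>))" using V(1) W(1) by simp
    show "witness U" if "U \<in> ?u ` (\<V> \<times> \<W>)" for U using that wit by auto
    show "req_cells r \<subseteq> S \<union> T" if Ur: "U \<in> ?u ` (\<V> \<times> \<W>)" "r \<in> U" for U r
    proof -
      obtain V W where "U = V \<union> W" "V \<in> \<V>" "W \<in> \<W>" using Ur(1) by auto
      then show ?thesis using Ur(2) V(3)[of V r] W(3)[of W r] by blast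
    qed
    fix \<omega> assume "\<omega> \<in> A \<inter> B"
    then obtain V W where VW: "V \<in> \<V>" "W \<in> \<W>" "\<forall>r\<in>V. occurs r \<omega>" "\<forall>r\<in>W. occurs r \<omega>"
      using V(4)[of \<omega>] W(4)[of \<omega>] by auto
    have "V \<union> W \<in> ?u ` (\<V> \<times> \<W>)" using VW(1,2) by (intro image_eqI[of _ ?u "(V, W)"]) auto
    then show "\<exists>U\<in>?u ` (\<V> \<times> \<W>). \<forall>r\<in>U. occurs r \<omega>"
      using VW(3,4) by (intro bexI[of _ "V \<union> W"]) (simp_all add: ball_Un)
  qed
qed

lemma covered_INT:
  assumes "finite Z" "\<And>z. z \<in> Z \<Longrightarrow> covered \<nu> (S z) (A z) p" "disjoint_family_on S Z" "0 \<le> \<nu>"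
  shows "covered \<nu> (\<Union>z\<in>Z. S z) (\<Inter>z\<in>Z. A z) (p ^ card Z)"
  using assms(1-3)
proof (induction Z rule: finite_induct)
  case empty
  have "witness {}" by (simp add: witness_def disjoint_family_on_def)
  then show ?case by (intro coveredI[of "{{}}"]) auto
next
  case (insert z Z)
  have "S z \<inter> (\<Union>z\<in>Z. S z) = {}"
    using insert.prems(2) insert.hyps(2) by (auto simp: disjoint_family_on_def)
  moreover have "disjoint_family_on S Z"
    using insert.prems(2) by (auto simp: disjoint_family_on_def)
  ultimately have "covered \<nu> (S z \<union> (\<Union>z\<in>Z. S z)) (A z \<inter> (\<Inter>z\<in>Z. A z)) (p * p ^ card Z)"
    using insert.prems(1) by (intro covered_Int insert.IH assms(4)) auto
  then show ?case using insert.hyps by simp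
qed

lemma covered_single:
  assumes "valid_req r" "req_cells r \<subseteq> S"
  shows "covered \<nu> S {\<omega>. occurs r \<omega>} (req_weight \<nu> r)"
  using assms by (intro coveredI[of "{{r}}"]) (auto simp: witness_def disjoint_family_on_def)

lemma covered_prob:
  assumes "covered \<nu> S A p" and \<nu>: "0 \<le> \<nu>"
    "\<And>S. finite S \<Longrightarrow> (\<integral>\<^sup>+\<omega>. (\<Prod>z\<in>S. vertex_count z \<omega>) \<partial>M) \<le> ennreal \<nu> ^ card S"
  shows "\<exists>B\<in>events. A \<inter> space M \<subseteq> B \<and> prob B \<le> p"
proof -
  obtain \<W> where W: "finite \<W>" "\<And>W. W \<in> \<W> \<Longrightarrow> witness W"
     "\<And>W r. W \<in> \<W> \<Longrightarrow> r \<in> W \<Longrightarrow> req_cells r \<subseteq> S" "\<And>\<omega>. \<omega> \<in> A \<Longrightarrow> \<exists>W\<in>\<W>. \<forall>r\<in>W. occurs r \<omega>" "(\<Sum>W\<in>\<W>. \<Prod>r\<in>W. req_weight \<nu> r) \<le> p"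
    by (rule coveredE[OF assms(1)], rule that, (assumption | simp)+)
  let ?B = "\<lambda>W. {\<omega> \<in> space M. \<forall>r\<in>W. occurs r \<omega>}"
  have m: "?B W \<in> events" if "W \<in> \<W>" for W
  proof -
    have "finite W" using W(2)[OF that] by (simp add: witness_def)
    then show ?thesis by measurable
  qed
  have "prob (\<Union>W\<in>\<W>. ?B W) \<le> (\<Sum>W\<in>\<W>. prob (?B W))"
    using W(1) m by (intro finite_measure_subadditive_finite) auto
  also have "\<dots> \<le> (\<Sum>W\<in>\<W>. \<Prod>r\<in>W. req_weight \<nu> r)"
    using witness_prob[OF \<nu>] W(2) by (intro sum_mono) auto
  finally have "prob (\<Union>W\<in>\<W>. ?B W) \<le> p" using W(5) by linarith
  moreover have "(\<Union>W\<in>\<W>. ?B W) \<in> events" using W(1) m by auto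
  moreover have "A \<inter> space M \<subseteq> (\<Union>W\<in>\<W>. ?B W)" using W(4) by auto
  ultimately show ?thesis by blast
qed

end

section \<open>Fast crossings\<close>

context wdrcm
begin

text \<open>
  Confining the path to the ball of radius \<open>3 K\<close> makes the event local. The ball is large enough: a
  path that starts within distance \<open>K\<close> of the centre, has no edge longer than \<open>K\<close> and is stopped when
  its displacement reaches \<open>K\<close> does not leave it.
\<close>

definition fast_crossing :: "real ^ 'd \<Rightarrow> real \<Rightarrow> real \<Rightarrow> 'w set" where
  "fast_crossing x K \<eta> = {\<omega> \<in> space M. \<exists>vs. vs \<noteq> [] \<and> successively (\<lambda>a b. (a, b) \<in> E \<omega>) vs \<and>
     (\<forall>v\<in>set vs. X v \<omega> \<in> cball x (3 * K)) \<and> X (hd vs) \<omega> \<in> cball x K \<and>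
     K \<le> dist (X (hd vs) \<omega>) (X (last vs) \<omega>) \<and> real (length vs - 1) < \<eta> * K}"

definition long_edge :: "real ^ 'd \<Rightarrow> real \<Rightarrow> real \<Rightarrow> 'w set" where
  "long_edge x K l = {\<omega> \<in> space M. \<exists>i j. (i, j) \<in> E \<omega> \<and> X i \<omega> \<in> cball x (3 * K) \<and>
     X j \<omega> \<in> cball x (3 * K) \<and> l \<le> dist (X i \<omega>) (X j \<omega>)}"

lemma fast_crossing_mono:
  assumes "\<eta> \<le> \<eta>'" "0 \<le> K"
  shows "fast_crossing x K \<eta> \<subseteq> fast_crossing x K \<eta>'"
  unfolding fast_crossing_def
  by (intro Collect_mono impI, elim conjE exE, intro conjI exI)
    (assumption | rule less_le_trans[OF _ mult_right_mono[OF assms]])+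

text \<open>
  This starts the induction over scales: fewer than one step means that the path does not move.
\<close>

lemma fast_crossing_empty:
  assumes "\<eta> * K \<le> 1" "0 < K"
  shows "fast_crossing x K \<eta> = {}"
proof (rule ccontr)
  assume "fast_crossing x K \<eta> \<noteq> {}"
  then obtain \<omega> vs where vs: "vs \<noteq> []" "K \<le> dist (X (hd vs) \<omega>) (X (last vs) \<omega>)"
    "real (length vs - 1) < \<eta> * K"
    unfolding fast_crossing_def by auto
  then have "length vs - 1 < 1" using assms(1) by linarith
  then have "length vs = 1" using vs(1) by (cases vs) auto
  then obtain v where "vs = [v]" by (auto simp: length_Suc_conv)
  then show False using vs(2) assms(2) by simp
qed

text \<open>
  Suppose that no \<open>c + 1\<close> of the fast boxes of size \<open>k\<close> have mutual distances above \<open>9 k\<close>; this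
  number keeps balls of radius \<open>4 k\<close> around the centres from meeting a common unit cell. A maximal
  separated set of centres then has at most \<open>c\<close> elements, and every path vertex whose box is fast
  lies within \<open>10 k\<close> of one of them. These balls are the bad sets of \<open>path_displacement_bound\<close>: each
  accounts for \<open>20 k + l \<le> 21 k\<close>, and the last stretch for \<open>k\<close>.
\<close>

lemma fast_crossing_subset:
  fixes x :: "real ^ 'd" and c :: nat and k l K \<eta> \<eta>' :: real
  assumes k: "0 < k" "0 \<le> l" "l \<le> k" and \<eta>: "0 < \<eta>" and K: "real (21 * c + 1) * k \<le> K"
    and \<eta>': "\<eta>' \<le> \<eta> * (1 - real (21 * c + 1) * k / K) * (1 - l / k)"
  defines "G \<equiv> grid_point (k / real CARD('d)) ` cball x (3 * K)"
  shows "fast_crossing x K \<eta>' \<subseteq> long_edge x K l \<union>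
    (\<Union>Z\<in>{Z. Z \<subseteq> G \<and> card Z = Suc c \<and> pairwise (\<lambda>a b. 9 * k < dist a b) Z}. \<Inter>z\<in>Z. fast_crossing z k \<eta>)"
proof
  fix \<omega> assume fast: "\<omega> \<in> fast_crossing x K \<eta>'"
  show "\<omega> \<in> long_edge x K l \<union>
    (\<Union>Z\<in>{Z. Z \<subseteq> G \<and> card Z = Suc c \<and> pairwise (\<lambda>a b. 9 * k < dist a b) Z}. \<Inter>z\<in>Z. fast_crossing z k \<eta>)"
  proof (rule ccontr)
    assume contr: "\<not> ?thesis"
    then have not_long: "\<omega> \<notin> long_edge x K l" by (rule contrapos_nn) (rule UnI1)
    have no_slow: "\<exists>z\<in>Z. \<omega> \<notin> fast_crossing z k \<eta>"
      if "Z \<subseteq> G" "card Z = Suc c" "pairwise (\<lambda>a b. 9 * k < dist a b) Z" for Z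
    proof (rule ccontr)
      assume "\<not> ?thesis"
      then have "\<omega> \<in> (\<Inter>z\<in>Z. fast_crossing z k \<eta>)" by simp
      with that have "\<omega> \<in> (\<Union>Z\<in>{Z. Z \<subseteq> G \<and> card Z = Suc c \<and> pairwise (\<lambda>a b. 9 * k < dist a b) Z}.
          \<Inter>z\<in>Z. fast_crossing z k \<eta>)" by (intro UN_I[of Z] CollectI conjI)
      then have "\<omega> \<in> long_edge x K l \<union> (\<Union>Z\<in>{Z. Z \<subseteq> G \<and> card Z = Suc c \<and> pairwise (\<lambda>a b. 9 * k < dist a b) Z}.
          \<Inter>z\<in>Z. fast_crossing z k \<eta>)" by (rule UnI2)
      with contr show False by contradiction
    qed
    have \<omega>: "\<omega> \<in> space M" using fast by (simp add: fast_crossing_def)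
    have Kpos: "0 < K"
    proof -
      have "0 < real (21 * c + 1) * k" using k by simp
      then show ?thesis using K by linarith
    qed
    let ?f = "\<lambda>v. X v \<omega>"
    obtain vs where vs: "vs \<noteq> []" "successively (\<lambda>a b. (a, b) \<in> E \<omega>) vs"
      "\<And>v. v \<in> set vs \<Longrightarrow> ?f v \<in> cball x (3 * K)"
      "K \<le> dist (?f (hd vs)) (?f (last vs))" "real (length vs - 1) < \<eta>' * K"
      using fast unfolding fast_crossing_def by blast
    let ?g = "grid_point (k / real CARD('d)) :: real ^ 'd \<Rightarrow> real ^ 'd"
    have g: "dist y (?g y) \<le> k" for y
      using dist_grid_point[of "k / real CARD('d)" y] k by simp
    have G: "finite G" unfolding G_def using k Kpos by (intro card_grid_points) auto
    define B where "B = {z \<in> G. \<omega> \<in> fast_crossing z k \<eta>}"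
    have "finite B" using G by (simp add: B_def)
    then obtain N where N: "N \<subseteq> B" "pairwise (\<lambda>a b. 9 * k < dist a b) N" "B \<subseteq> (\<Union>a\<in>N. cball a (9 * k))"
      using finite_separated_net[of B "9 * k"] k by auto
    have finN: "finite N" using N(1) \<open>finite B\<close> finite_subset by blast
    have cardN: "card N \<le> c"
    proof (rule ccontr)
      assume "\<not> card N \<le> c"
      then have "Suc c \<le> card N" by simp
      then obtain Z where Z: "Z \<subseteq> N" "card Z = Suc c" by (rule obtain_subset_with_card_n)
      have ZB: "Z \<subseteq> B" using Z(1) N(1) by (rule subset_trans)
      have "pairwise (\<lambda>a b. 9 * k < dist a b) Z" using N(2) Z(1) by (rule pairwise_subset)
      then show False using no_slow[of Z] Z(2) ZB by (auto simp: B_def)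
    qed
    define \<B> where "\<B> = (\<lambda>m. cball m (10 * k)) ` N"
    have card\<B>: "card \<B> \<le> c" unfolding \<B>_def using card_image_le[OF finN] cardN by (rule order_trans)
    have bound: "dist (?f (hd vs)) (?f (last vs)) \<le>
      real (length vs - 1) / (\<eta> * k) * (k + l) + real (card \<B>) * (20 * k + l) + k"
    proof (rule path_displacement_bound)
      show "finite \<B>" using finN by (simp add: \<B>_def)
      show "dist a b \<le> 20 * k" if S: "S \<in> \<B>" "a \<in> S" "b \<in> S" for S a b
      proof -
        obtain m where "S = cball m (10 * k)" using S(1) unfolding \<B>_def by blast
        then have "dist m a \<le> 10 * k" "dist m b \<le> 10 * k" using S(2,3) by auto
        then show ?thesis using dist_triangle3[of a b m] by linarith
      qed
      show "successively (\<lambda>a b. dist (?f a) (?f b) \<le> l) vs"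
        using vs(2)
      proof (rule successively_mono)
        fix a b assume ab: "a \<in> set vs" "b \<in> set vs" "(a, b) \<in> E \<omega>"
        show "dist (?f a) (?f b) \<le> l"
        proof (rule ccontr)
          assume "\<not> ?thesis"
          then have "\<omega> \<in> long_edge x K l"
            unfolding long_edge_def using \<omega> ab vs(3) by (intro CollectI conjI exI[of _ a] exI[of _ b]) auto
          then show False using not_long by contradiction
        qed
      qed
      fix as ws bs
      assume ws: "vs = as @ ws @ bs" "ws \<noteq> []" "?f (hd ws) \<notin> \<Union>\<B>"
        "k \<le> dist (?f (hd ws)) (?f (last ws))"
        "\<And>w. w \<in> set ws \<Longrightarrow> dist (?f (hd ws)) (?f w) \<le> k + l"
      define z where "z = ?g (?f (hd ws))"
      have dz: "dist (?f (hd ws)) z \<le> k" unfolding z_def by (rule g)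
      have "hd ws \<in> set vs" using ws(1,2) by simp
      then have zG: "z \<in> G" unfolding z_def G_def using vs(3) by blast
      have "\<omega> \<notin> fast_crossing z k \<eta>"
      proof
        assume "\<omega> \<in> fast_crossing z k \<eta>"
        then have "z \<in> B" using zG by (simp add: B_def)
        then obtain m where m: "m \<in> N" "dist m z \<le> 9 * k" using N(3) by auto
        then have "dist m (?f (hd ws)) \<le> 10 * k"
          using dz dist_triangle[of m "?f (hd ws)" z] by (simp add: dist_commute)
        then show False using ws(3) m(1) by (auto simp: \<B>_def)
      qed
      moreover have "successively (\<lambda>a b. (a, b) \<in> E \<omega>) ws"
        using vs(2) unfolding ws(1) successively_append_iff by blast
      moreover have "?f w \<in> cball z (3 * k)" if "w \<in> set ws" for w
        using ws(5)[OF that] dz k dist_triangle[of z "?f w" "?f (hd ws)"] by (simp add: dist_commute)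
      moreover have "?f (hd ws) \<in> cball z k" using dz by (simp add: dist_commute)
      ultimately have "\<not> real (length ws - 1) < \<eta> * k"
        unfolding fast_crossing_def using \<omega> ws(2,4) by blast
      then show "\<eta> * k \<le> real (length ws - 1)" by simp
    qed (use k \<eta> vs(1) in auto)
    define t where "t = K - real (21 * c + 1) * k"
    have t: "0 \<le> t" using K by (simp add: t_def)
    have "real (card \<B>) * (20 * k + l) \<le> real c * (21 * k)"
      using card\<B> k by (intro mult_mono) auto
    moreover have "real (21 * c + 1) * k = real c * (21 * k) + k"
      by (simp add: distrib_right)
    ultimately have "t \<le> real (length vs - 1) / (\<eta> * k) * (k + l)"
      using bound vs(4) unfolding t_def by linarith
    also have "\<dots> < \<eta>' * K / (\<eta> * k) * (k + l)"
      using vs(5) k \<eta> by (intro mult_strict_right_mono divide_strict_right_mono) auto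
    also have "\<dots> \<le> (\<eta> * (1 - real (21 * c + 1) * k / K) * (1 - l / k)) * K / (\<eta> * k) * (k + l)"
      using \<eta>' k \<eta> Kpos by (intro mult_right_mono divide_right_mono) auto
    \<comment> \<open>The factor \<open>1 - l / k\<close> in \<open>\<eta>'\<close> makes up for the surplus \<open>l\<close> in each displacement \<open>k + l\<close>.\<close>
    also have "\<dots> = t * ((1 - l / k) * (1 + l / k))"
    proof -
      have "(\<eta> * A * B) * K / (\<eta> * k) * (k + l) = (K * A) * (B * (1 + l / k))" for A B
      proof -
        have "k + l = k * (1 + l / k)" using k by (simp add: distrib_left)
        then have "(\<eta> * A * B) * K / (\<eta> * k) * (k + l) = (\<eta> * A * B) * K / (\<eta> * k) * (k * (1 + l / k))"
          by (simp only:)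
        also have "\<dots> = (K * A) * (B * (1 + l / k)) * ((\<eta> * k) / (\<eta> * k))"
          by (simp only: times_divide_eq_left times_divide_eq_right mult_ac)
        finally show ?thesis using k \<eta> by simp
      qed
      moreover have "K * (1 - real (21 * c + 1) * k / K) = t"
      proof -
        have "K * (1 - b / K) = K - b" for b using Kpos by (simp add: right_diff_distrib)
        from this[of "real (21 * c + 1) * k"] show ?thesis unfolding t_def .
      qed
      ultimately show ?thesis by (simp only:)
    qed
    also have "(1 - l / k) * (1 + l / k) = 1 - (l / k)\<^sup>2" by (simp add: power2_eq_square algebra_simps)
    also have "t * (1 - (l / k)\<^sup>2) \<le> t" using t by (simp add: mult_left_le)
    finally show False by simp
  qed
qed

text \<open>
  The radius \<open>4 K\<close> exceeds the \<open>3 K\<close> of \<open>fast_crossing\<close> to leave room for the boxes of the previous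
  scale, whose centres are path vertices of the ball of radius \<open>3 K\<close> rounded to a grid.
\<close>

definition region :: "real ^ 'd \<Rightarrow> real \<Rightarrow> (int ^ 'd) set" where
  "region x K = cell ` cball x (4 * K)"

lemma region_disjoint:
  fixes a b :: "real ^ 'd"
  assumes "real CARD('d) \<le> k" "9 * k < dist a b"
  shows "region a k \<inter> region b k = {}"
proof (rule ccontr)
  assume "region a k \<inter> region b k \<noteq> {}"
  then obtain y y' where y: "dist a y \<le> 4 * k" "dist b y' \<le> 4 * k" "cell y = cell y'"
    by (auto simp: region_def)
  then show False
    using dist_same_cell[of y y'] assms dist_triangle[of a b y] dist_triangle[of y b y']
    by (simp add: dist_commute)
qed

text \<open>
  The recursion for the certified bounds: there are at most \<open>(card G) ^ (c + 1)\<close> choices for the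
  centres of \<open>c + 1\<close> distant fast boxes, and their regions are disjoint, so that their weights
  multiply.
\<close>

lemma fast_crossing_covered_step:
  assumes k: "real CARD('d) \<le> k" "0 \<le> l" "l \<le> k" and \<eta>: "0 < \<eta>"
    and K: "5 * k \<le> K" "real (21 * c + 1) * k \<le> K"
    and \<nu>: "0 \<le> \<nu>" and p: "0 \<le> p" "\<And>z. covered \<nu> (region z k) (fast_crossing z k \<eta>) p"
    and q: "covered \<nu> (region x K) (long_edge x K l) q"
    and \<eta>': "\<eta>' \<le> \<eta> * (1 - real (21 * c + 1) * k / K) * (1 - l / k)"
  shows "covered \<nu> (region x K) (fast_crossing x K \<eta>')
    (q + ((8 * real CARD('d) * K / k) ^ CARD('d) * p) ^ Suc c)"
proof -
  define G where "G = grid_point (k / real CARD('d)) ` cball x (3 * K)"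
  define \<Z> where "\<Z> = {Z. Z \<subseteq> G \<and> card Z = Suc c \<and> pairwise (\<lambda>a b. 9 * k < dist a b) Z}"
  have d1: "1 \<le> real CARD('d)" by (simp add: Suc_leI)
  have k0: "0 < k" using k(1) d1 by linarith
  then have K0: "0 < K" using K(1) by linarith
  have G: "finite G" "real (card G) \<le> (2 * (3 * K) / (k / real CARD('d)) + 2) ^ CARD('d)"
    unfolding G_def using k0 K0 by (intro card_grid_points; simp)+
  have "2 \<le> 2 * real CARD('d) * K / k"
  proof -
    have "k * 1 \<le> K * real CARD('d)" using K k0 K0 d1 by (intro mult_mono) auto
    then show ?thesis using k0 by (simp add: field_simps)
  qed
  moreover have "2 * (3 * K) / (k / real CARD('d)) = 6 * (real CARD('d) * K / k)"
    "2 * real CARD('d) * K / k = 2 * (real CARD('d) * K / k)"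
    "8 * real CARD('d) * K / k = 8 * (real CARD('d) * K / k)" by simp_all
  ultimately have "2 * (3 * K) / (k / real CARD('d)) + 2 \<le> 8 * real CARD('d) * K / k" by linarith
  then have cardG: "real (card G) \<le> (8 * real CARD('d) * K / k) ^ CARD('d)"
    using G(2) k0 K0 by (elim order_trans) (intro power_mono, auto)
  have sub: "\<Z> \<subseteq> {Z. Z \<subseteq> G \<and> card Z = Suc c}" by (auto simp: \<Z>_def)
  have fin: "finite {Z. Z \<subseteq> G \<and> card Z = Suc c}" using G(1) by simp
  have card\<Z>: "card \<Z> \<le> card G ^ Suc c"
  proof -
    have "card \<Z> \<le> card G choose Suc c"
      using card_mono[OF fin sub] n_subsets[OF G(1), of "Suc c"] by simp
    also have "\<dots> \<le> card G ^ Suc c"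
      by (cases "Suc c \<le> card G") (simp_all only: binomial_le_pow not_le binomial_eq_0 zero_le)
    finally show ?thesis .
  qed
  have one: "covered \<nu> (region x K) (\<Inter>z\<in>Z. fast_crossing z k \<eta>) (p ^ Suc c)" if Z: "Z \<in> \<Z>" for Z
  proof -
    have Z': "Z \<subseteq> G" "card Z = Suc c" "pairwise (\<lambda>a b. 9 * k < dist a b) Z" using Z by (auto simp: \<Z>_def)
    have "covered \<nu> (\<Union>z\<in>Z. region z k) (\<Inter>z\<in>Z. fast_crossing z k \<eta>) (p ^ card Z)"
    proof (rule covered_INT)
      show "finite Z" using Z'(1) G(1) finite_subset by blast
      show "disjoint_family_on (\<lambda>z. region z k) Z"
        using Z'(3) region_disjoint[OF k(1)] by (auto simp: disjoint_family_on_def pairwise_def)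
    qed (use p \<nu> in auto)
    moreover have "(\<Union>z\<in>Z. region z k) \<subseteq> region x K"
    proof -
      have "cball z (4 * k) \<subseteq> cball x (4 * K)" if "z \<in> Z" for z
      proof -
        obtain y where y: "dist x y \<le> 3 * K" "z = grid_point (k / real CARD('d)) y"
          using Z'(1) \<open>z \<in> Z\<close> by (auto simp: G_def)
        have "dist y z \<le> k" using dist_grid_point[of "k / real CARD('d)" y] k0 y(2) by simp
        then have "dist x z \<le> 3 * K + k" using y(1) dist_triangle[of x z y] by linarith
        then have "dist x z + 4 * k \<le> 4 * K" using K by linarith
        then show ?thesis by (simp add: cball_subset_cball_iff dist_commute)
      qed
      then show ?thesis unfolding region_def by blast
    qed
    ultimately show ?thesis using Z'(2) by (auto intro: covered_mono)
  qed
  have "covered \<nu> (region x K) (\<Union>Z\<in>\<Z>. \<Inter>z\<in>Z. fast_crossing z k \<eta>) (\<Sum>Z\<in>\<Z>. p ^ Suc c)"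
    using fin sub finite_subset one \<nu> by (intro covered_UN) auto
  from covered_Un[OF q this \<nu>]
  have "covered \<nu> (region x K) (long_edge x K l \<union> (\<Union>Z\<in>\<Z>. \<Inter>z\<in>Z. fast_crossing z k \<eta>))
      (q + (\<Sum>Z\<in>\<Z>. p ^ Suc c))" .
  then show ?thesis
  proof (rule covered_mono[OF _ order_refl])
    show "fast_crossing x K \<eta>' \<subseteq> long_edge x K l \<union> (\<Union>Z\<in>\<Z>. \<Inter>z\<in>Z. fast_crossing z k \<eta>)"
      unfolding \<Z>_def G_def by (rule fast_crossing_subset[OF k0 k(2,3) \<eta> K(2) \<eta>'])
    have "(\<Sum>Z\<in>\<Z>. p ^ Suc c) = real (card \<Z>) * p ^ Suc c" by simp
    also have "\<dots> \<le> real (card G) ^ Suc c * p ^ Suc c"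
      using card\<Z> p(1) by (intro mult_right_mono) (simp_all only: of_nat_power[symmetric] of_nat_le_iff zero_le_power)
    also have "\<dots> = (real (card G) * p) ^ Suc c" by (simp only: power_mult_distrib)
    also have "\<dots> \<le> ((8 * real CARD('d) * K / k) ^ CARD('d) * p) ^ Suc c"
      using cardG p(1) by (intro power_mono mult_right_mono) auto
    finally show "q + (\<Sum>Z\<in>\<Z>. p ^ Suc c) \<le> q + ((8 * real CARD('d) * K / k) ^ CARD('d) * p) ^ Suc c" by simp
  qed
qed

text \<open>
  Either an endpoint has a mark of at most \<open>u\<close>, or both marks are at least \<open>u\<close>. The length exceeds the
  diameter of a cell, which puts the two endpoints into different cells.
\<close>

lemma long_edge_covered:
  assumes l: "real CARD('d) < l" and K: "0 \<le> K" and u: "0 < u" "u \<le> 1" and \<kappa>: "0 \<le> \<kappa>" and \<nu>: "0 \<le> \<nu>"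
    and \<rho>: "\<And>a b. u \<le> a \<Longrightarrow> a \<le> b \<Longrightarrow> b < 1 \<Longrightarrow> \<rho> (a powr \<gamma> * b powr \<gamma>' * l ^ CARD('d)) \<le> \<kappa> / (a * b)"
  defines "n \<equiv> (6 * K + 2) ^ CARD('d)"
  shows "covered \<nu> (region x K) (long_edge x K l) (n * (\<nu> * u) + n\<^sup>2 * (\<kappa> * (\<nu> * ln (1 / u))\<^sup>2))"
proof -
  define C where "C = cell ` cball x (3 * K)"
  have C: "finite C" "real (card C) \<le> n"
    using card_cells_cball[of "3 * K" x] K by (simp_all add: C_def n_def)
  have CR: "C \<subseteq> region x K" unfolding C_def region_def using K by (intro image_mono subset_cball) simp
  define P where "P = {(z, w). z \<in> C \<and> w \<in> C \<and> z \<noteq> w}"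
  have P: "P \<subseteq> C \<times> C" by (auto simp: P_def)
  have finP: "finite P" using finite_subset[OF P] C(1) by simp
  have "card P \<le> card C * card C" using card_mono[OF _ P] C(1) by (simp add: card_cartesian_product)
  then have "real (card P) \<le> real (card C) * real (card C)" by (metis of_nat_le_iff of_nat_mult)
  also have "\<dots> \<le> n\<^sup>2" using C(2) unfolding power2_eq_square by (intro mult_mono) auto
  finally have cardP: "real (card P) \<le> n\<^sup>2" .
  have "covered \<nu> (region x K) (\<Union>z\<in>C. {\<omega>. occurs (Strong z u) \<omega>}) (\<Sum>z\<in>C. req_weight \<nu> (Strong z u))"
    using C(1) CR u \<nu> by (intro covered_UN covered_single) auto
  moreover have "covered \<nu> (region x K) (\<Union>(z, w)\<in>P. {\<omega>. occurs (Long z w l u \<kappa>) \<omega>})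
      (\<Sum>(z, w)\<in>P. req_weight \<nu> (Long z w l u \<kappa>))"
  proof -
    have "0 \<le> l" using l by linarith
    then have "covered \<nu> (region x K) (case e of (z, w) \<Rightarrow> {\<omega>. occurs (Long z w l u \<kappa>) \<omega>})
        (case e of (z, w) \<Rightarrow> req_weight \<nu> (Long z w l u \<kappa>))" if "e \<in> P" for e
      using that CR u \<kappa> \<rho> unfolding P_def by (cases e) (auto simp del: req_weight.simps occurs.simps intro!: covered_single)
    then show ?thesis by (rule covered_UN[OF finP _ \<nu>])
  qed
  ultimately have "covered \<nu> (region x K)
      ((\<Union>z\<in>C. {\<omega>. occurs (Strong z u) \<omega>}) \<union> (\<Union>(z, w)\<in>P. {\<omega>. occurs (Long z w l u \<kappa>) \<omega>}))
      ((\<Sum>z\<in>C. req_weight \<nu> (Strong z u)) + (\<Sum>(z, w)\<in>P. req_weight \<nu> (Long z w l u \<kappa>)))"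
    by (rule covered_Un[OF _ _ \<nu>])
  then show ?thesis
  proof (rule covered_mono[OF _ order_refl])
    show "long_edge x K l \<subseteq>
        (\<Union>z\<in>C. {\<omega>. occurs (Strong z u) \<omega>}) \<union> (\<Union>(z, w)\<in>P. {\<omega>. occurs (Long z w l u \<kappa>) \<omega>})"
    proof
      fix \<omega> assume "\<omega> \<in> long_edge x K l"
      then obtain i j where ij: "(i, j) \<in> E \<omega>" "X i \<omega> \<in> cball x (3 * K)" "X j \<omega> \<in> cball x (3 * K)"
        "l \<le> dist (X i \<omega>) (X j \<omega>)"
        unfolding long_edge_def by blast
      have cells: "cell (X i \<omega>) \<in> C" "cell (X j \<omega>) \<in> C" using ij by (auto simp: C_def)
      have "cell (X i \<omega>) \<noteq> cell (X j \<omega>)" using dist_same_cell[of "X i \<omega>" "X j \<omega>"] ij(4) l by auto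
      then have inP: "(cell (X i \<omega>), cell (X j \<omega>)) \<in> P" using cells by (simp add: P_def)
      consider "U i \<omega> \<le> u" | "U j \<omega> \<le> u" | "u \<le> U i \<omega>" "u \<le> U j \<omega>" by linarith
      then show "\<omega> \<in> (\<Union>z\<in>C. {\<omega>. occurs (Strong z u) \<omega>}) \<union> (\<Union>(z, w)\<in>P. {\<omega>. occurs (Long z w l u \<kappa>) \<omega>})"
      proof cases
        case 1
        then have "occurs (Strong (cell (X i \<omega>)) u) \<omega>" by auto
        then show ?thesis using cells by blast
      next
        case 2
        then have "occurs (Strong (cell (X j \<omega>)) u) \<omega>" by auto
        then show ?thesis using cells by blast
      next
        case 3
        then have "occurs (Long (cell (X i \<omega>)) (cell (X j \<omega>)) l u \<kappa>) \<omega>" using ij by auto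
        then show ?thesis using inP by blast
      qed
    qed
    have "(\<Sum>z\<in>C. req_weight \<nu> (Strong z u)) = real (card C) * (\<nu> * u)" by simp
    also have "\<dots> \<le> n * (\<nu> * u)" using C(2) \<nu> u by (intro mult_right_mono) auto
    moreover have "(\<Sum>(z, w)\<in>P. req_weight \<nu> (Long z w l u \<kappa>)) = real (card P) * (\<kappa> * (\<nu> * ln (1 / u))\<^sup>2)"
      by (simp add: case_prod_beta)
    moreover have "\<dots> \<le> n\<^sup>2 * (\<kappa> * (\<nu> * ln (1 / u))\<^sup>2)"
      using cardP \<kappa> by (intro mult_right_mono) auto
    ultimately show "(\<Sum>z\<in>C. req_weight \<nu> (Strong z u)) + (\<Sum>(z, w)\<in>P. req_weight \<nu> (Long z w l u \<kappa>)) \<le>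
        n * (\<nu> * u) + n\<^sup>2 * (\<kappa> * (\<nu> * ln (1 / u))\<^sup>2)" by linarith
  qed
qed

end

section \<open>Probability of long edges\<close>

text \<open>
  These inequalities say that \<open>- \<theta>\<close> is not below the four terms of \<open>\<zeta>\<close>, cleared of denominators:
  in the order listed after \<open>0 < \<theta>\<close>, the edge joins two typical vertices, a strong vertex and a typical one, a
  strong vertex and the strongest one nearby, or two equally strong vertices.
\<close>

definition admissible :: "real \<Rightarrow> real \<Rightarrow> real \<Rightarrow> real \<Rightarrow> bool" where
  "admissible \<gamma> \<gamma>' \<delta> \<theta> \<longleftrightarrow> 0 < \<theta> \<and> 2 + \<theta> \<le> \<delta> \<and> 1 \<le> \<delta> * (1 - \<gamma> * (1 + \<theta>)) \<and>
     \<gamma> * (1 + \<theta>) + \<gamma>' \<le> 1 \<and> (\<gamma> + \<gamma>') * (2 + \<theta>) \<le> 2"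

text \<open>
  The linear programme behind \<open>\<zeta>\<close>, with \<open>A\<close>, \<open>B\<close> and \<open>L\<close> the negative logarithms of the marks and the
  logarithm of the volume. For a given sum \<open>s = A + B\<close> the quantity \<open>\<gamma> * A + \<gamma>' * B\<close> is largest at
  \<open>A = B\<close> if \<open>\<gamma> \<le> \<gamma>'\<close>, and at the largest possible \<open>A\<close> otherwise. What remains is linear in \<open>s\<close> on the
  segments between \<open>0\<close>, \<open>(1 + \<theta>) * L\<close> and \<open>(2 + \<theta>) * L\<close>, so it suffices to look at their endpoints.
\<close>

lemma mark_cost_bound:
  fixes A B L :: real
  assumes adm: "admissible \<gamma> \<gamma>' \<delta> \<theta>" and \<gamma>: "0 \<le> \<gamma>" "0 \<le> \<gamma>'"
    and AB: "0 \<le> B" "B \<le> A" "A \<le> (1 + \<theta>) * L" "A + B \<le> (2 + \<theta>) * L"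
  shows "(2 + \<theta>) * L \<le> A + B + \<delta> * (L - \<gamma> * A - \<gamma>' * B)"
proof -
  have \<theta>: "0 < \<theta>" "2 + \<theta> \<le> \<delta>" "1 \<le> \<delta> * (1 - \<gamma> * (1 + \<theta>))" "\<gamma> * (1 + \<theta>) + \<gamma>' \<le> 1"
    "(\<gamma> + \<gamma>') * (2 + \<theta>) \<le> 2"
    using adm by (auto simp: admissible_def)
  have \<delta>: "0 < \<delta>" using \<theta> by linarith
  define s where "s = A + B"
  have s: "0 \<le> s" "s \<le> (2 + \<theta>) * L" using AB by (auto simp: s_def)
  have goal: ?thesis if "(2 + \<theta>) * L - s \<le> \<delta> * R" "R \<le> L - \<gamma> * A - \<gamma>' * B" for R
  proof -
    have "\<delta> * R \<le> \<delta> * (L - \<gamma> * A - \<gamma>' * B)" using that(2) \<delta> by (intro mult_left_mono) auto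
    then show ?thesis using that(1) unfolding s_def by linarith
  qed
  show ?thesis
  proof (cases "\<gamma> \<le> \<gamma>'")
    case True
    have "0 \<le> (\<gamma>' - \<gamma>) * (A - B)" using True AB by simp
    then have "2 * (\<gamma> * A + \<gamma>' * B) \<le> (\<gamma> + \<gamma>') * s" by (simp add: s_def algebra_simps)
    then have "(2 + \<theta>) * (2 * (\<gamma> * A + \<gamma>' * B)) \<le> (2 + \<theta>) * ((\<gamma> + \<gamma>') * s)"
      using \<theta> by (intro mult_left_mono) auto
    also have "\<dots> = ((\<gamma> + \<gamma>') * (2 + \<theta>)) * s" by (simp add: ac_simps)
    also have "\<dots> \<le> 2 * s" using \<theta>(5) s by (intro mult_right_mono) auto
    finally have "(2 + \<theta>) * (\<gamma> * A + \<gamma>' * B) \<le> s" by linarith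
    then have le: "(2 + \<theta>) * L - s \<le> (2 + \<theta>) * (L - \<gamma> * A - \<gamma>' * B)" by (simp add: algebra_simps)
    have "0 \<le> (2 + \<theta>) * (L - \<gamma> * A - \<gamma>' * B)" using le s by linarith
    then have "0 \<le> L - \<gamma> * A - \<gamma>' * B" using \<theta>(1) by (simp add: zero_le_mult_iff)
    then have "(2 + \<theta>) * (L - \<gamma> * A - \<gamma>' * B) \<le> \<delta> * (L - \<gamma> * A - \<gamma>' * B)"
      using \<theta>(2) by (rule mult_right_mono[rotated])
    then show ?thesis using goal[of "L - \<gamma> * A - \<gamma>' * B"] le by linarith
  next
    case False
    show ?thesis
    proof (cases "s \<le> (1 + \<theta>) * L")
      case True
      have "\<gamma>' * B \<le> \<gamma> * B" using False AB by (intro mult_right_mono) auto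
      then have R: "L - \<gamma> * s \<le> L - \<gamma> * A - \<gamma>' * B" by (simp add: s_def algebra_simps)
      have "(2 + \<theta>) * ((1 + \<theta>) * L - s) + 1 * s \<le>
          \<delta> * ((1 + \<theta>) * L - s) + (\<delta> * (1 - \<gamma> * (1 + \<theta>))) * s"
        using True \<theta> s by (intro add_mono mult_right_mono) auto
      also have "\<dots> = (1 + \<theta>) * (\<delta> * (L - \<gamma> * s))" by (simp add: algebra_simps)
      finally have "(1 + \<theta>) * ((2 + \<theta>) * L - s) \<le> (1 + \<theta>) * (\<delta> * (L - \<gamma> * s))"
        by (simp add: algebra_simps)
      then have "(2 + \<theta>) * L - s \<le> \<delta> * (L - \<gamma> * s)" using \<theta>(1) by simp
      then show ?thesis using goal R by blast
    next
      case gt: False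
      define e where "e = s - (1 + \<theta>) * L"
      have e: "0 \<le> e" "e \<le> L" using gt s(2) by (auto simp: e_def algebra_simps)
      have "(\<gamma> - \<gamma>') * A \<le> (\<gamma> - \<gamma>') * ((1 + \<theta>) * L)" using False AB by (intro mult_left_mono) auto
      then have "\<gamma> * A + \<gamma>' * B \<le> \<gamma> * (1 + \<theta>) * L + \<gamma>' * e" by (simp add: e_def s_def algebra_simps)
      also have "\<dots> \<le> \<gamma> * (1 + \<theta>) * L + (1 - \<gamma> * (1 + \<theta>)) * e"
        using \<theta>(4) e by (intro add_left_mono mult_right_mono) auto
      finally have R: "(1 - \<gamma> * (1 + \<theta>)) * (L - e) \<le> L - \<gamma> * A - \<gamma>' * B" by (simp add: algebra_simps)
      have "1 * (L - e) \<le> (\<delta> * (1 - \<gamma> * (1 + \<theta>))) * (L - e)"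
        using \<theta>(3) e by (intro mult_right_mono) auto
      moreover have "(2 + \<theta>) * L - s = L - e" by (simp add: e_def algebra_simps)
      ultimately have "(2 + \<theta>) * L - s \<le> \<delta> * ((1 - \<gamma> * (1 + \<theta>)) * (L - e))" by (simp add: ac_simps)
      then show ?thesis using goal R by blast
    qed
  qed
qed

text \<open>
  In logarithmic coordinates this is \<open>mark_cost_bound\<close> if \<open>a * b\<close> is not too small; otherwise the
  bound on \<open>a * b\<close> alone suffices.
\<close>

lemma profile_mark_bound:
  assumes adm: "admissible \<gamma> \<gamma>' \<delta> \<theta>" and \<gamma>: "0 \<le> \<gamma>" "0 \<le> \<gamma>'"
    and \<rho>: "\<And>x. 0 < x \<Longrightarrow> \<rho> x \<le> C * min 1 (x powr (- \<delta>))" and C: "0 \<le> C"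
    and D: "1 \<le> D" and ab: "D powr (- (1 + \<theta>)) \<le> a" "a \<le> b" "b < 1"
  shows "\<rho> (a powr \<gamma> * b powr \<gamma>' * D) \<le> C * D powr (- (2 + \<theta>)) / (a * b)"
proof -
  define A B L where "A = - ln a" and "B = - ln b" and "L = ln D"
  have a: "0 < a" using D ab(1) by (auto intro: less_le_trans[OF _ ab(1)])
  have b: "0 < b" using a ab(2) by linarith
  have A: "A \<le> (1 + \<theta>) * L"
  proof -
    have "ln (D powr (- (1 + \<theta>))) \<le> ln a" using ab(1) a D by (subst ln_le_cancel_iff) auto
    then show ?thesis using D by (simp add: A_def L_def ln_powr algebra_simps)
  qed
  have BA: "B \<le> A" "0 \<le> B" using ab a b by (auto simp: A_def B_def)
  let ?x = "a powr \<gamma> * b powr \<gamma>' * D"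
  have x: "?x = exp (L - \<gamma> * A - \<gamma>' * B)"
  proof -
    have "exp (L - \<gamma> * A - \<gamma>' * B) = exp (\<gamma> * ln a) * exp (\<gamma>' * ln b) * exp (ln D)"
      unfolding exp_add[symmetric] by (simp add: A_def B_def L_def)
    then show ?thesis using a b D by (simp add: powr_def)
  qed
  have ab': "a * b = exp (- (A + B))"
    using a b by (simp add: A_def B_def exp_add)
  have D': "D powr (- (2 + \<theta>)) = exp (- ((2 + \<theta>) * L))"
    using D by (simp add: powr_def L_def algebra_simps)
  have "min 1 (?x powr (- \<delta>)) * (a * b) \<le> D powr (- (2 + \<theta>))"
  proof (cases "A + B \<le> (2 + \<theta>) * L")
    case True
    have "min 1 (?x powr (- \<delta>)) * (a * b) \<le> ?x powr (- \<delta>) * (a * b)"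
      using a b by (intro mult_right_mono) auto
    also have "\<dots> = exp (- (A + B + \<delta> * (L - \<gamma> * A - \<gamma>' * B)))"
      unfolding x ab' exp_powr_real exp_add[symmetric] by (simp add: algebra_simps)
    also have "\<dots> \<le> exp (- ((2 + \<theta>) * L))"
      using mark_cost_bound[OF adm \<gamma> BA(2,1) A True] by simp
    finally show ?thesis unfolding D' .
  next
    case False
    have "min 1 (?x powr (- \<delta>)) * (a * b) \<le> 1 * (a * b)"
      using a b by (intro mult_right_mono) auto
    also have "\<dots> \<le> exp (- ((2 + \<theta>) * L))" unfolding ab' using False by simp
    finally show ?thesis unfolding D' .
  qed
  then have "C * (min 1 (?x powr (- \<delta>)) * (a * b)) \<le> C * D powr (- (2 + \<theta>))"
    using C by (rule mult_left_mono)
  then have "C * min 1 (?x powr (- \<delta>)) \<le> C * D powr (- (2 + \<theta>)) / (a * b)"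
    using a b by (simp add: pos_le_divide_eq mult.assoc)
  moreover have "\<rho> ?x \<le> C * min 1 (?x powr (- \<delta>))" using a b D by (intro \<rho>) simp
  ultimately show ?thesis by linarith
qed

lemma eventually_powr_absorb:
  fixes c e e' :: real
  assumes "e < e'"
  shows "\<forall>\<^sub>F k in at_top. c * k powr e \<le> k powr e' / 2"
proof -
  have "((\<lambda>k. k powr (- (e' - e))) \<longlongrightarrow> 0) at_top"
    using assms by (intro tendsto_neg_powr filterlim_ident) auto
  then have "((\<lambda>k. c * k powr (- (e' - e))) \<longlongrightarrow> c * 0) at_top" by (intro tendsto_intros)
  then have "\<forall>\<^sub>F k in at_top. c * k powr (- (e' - e)) < 1 / 2"
    by (rule order_tendstoD) simp
  then show ?thesis
    using eventually_gt_at_top[of 0]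
  proof eventually_elim
    case (elim k)
    have "c * k powr e = (c * k powr (- (e' - e))) * k powr e'"
      using elim(2) by (simp add: powr_add[symmetric])
    also have "\<dots> \<le> (1 / 2) * k powr e'" using elim(1) by (intro mult_right_mono) auto
    finally show ?case by simp
  qed
qed

lemma eventually_log_absorb:
  fixes c c' e :: real
  assumes "0 < e"
  shows "\<forall>\<^sub>F l in at_top. c + c' * (ln l)\<^sup>2 \<le> l powr e"
proof -
  have 1: "\<forall>\<^sub>F l in at_top. \<bar>c\<bar> * l powr 0 \<le> l powr e / 2"
    using assms by (intro eventually_powr_absorb)
  have 2: "\<forall>\<^sub>F l in at_top. (\<bar>c'\<bar> * (4 / e)\<^sup>2) * l powr (e / 2) \<le> l powr e / 2"
    using assms by (intro eventually_powr_absorb) auto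
  show ?thesis
    using 1 2 eventually_ge_at_top[of 1]
  proof eventually_elim
    case (elim l)
    have "ln l \<le> l powr (e / 4) / (e / 4)" using elim(3) assms by (intro ln_powr_bound) auto
    then have "(ln l)\<^sup>2 \<le> (l powr (e / 4) / (e / 4))\<^sup>2" using elim(3) by (intro power_mono) auto
    also have "\<dots> = (4 / e)\<^sup>2 * l powr (e / 2)"
      using elim(3) by (simp add: power2_eq_square powr_add[symmetric])
    finally have "\<bar>c'\<bar> * (ln l)\<^sup>2 \<le> \<bar>c'\<bar> * ((4 / e)\<^sup>2 * l powr (e / 2))" by (intro mult_left_mono) auto
    moreover have "c' * (ln l)\<^sup>2 \<le> \<bar>c'\<bar> * (ln l)\<^sup>2" by (intro mult_right_mono) auto
    moreover have "c \<le> \<bar>c\<bar> * l powr 0" using elim(3) by simp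
    ultimately show ?case using elim(1,2) by (simp add: mult.assoc)
  qed
qed

lemma zeta_negative:
  assumes "0 \<le> \<gamma>" "0 \<le> \<gamma>'" "2 < \<delta>" "ereal \<gamma> < 1 - 1 / \<delta>" "\<gamma>' < 1 - \<gamma>"
  shows "zeta \<gamma> \<gamma>' \<delta> < 0"
proof -
  have "\<gamma> < (if \<delta> = \<infinity> then 1 else (real_of_ereal \<delta> - 1) / real_of_ereal \<delta>)"
  proof (cases \<delta>)
    case (real r)
    have "2 < r" using assms(3) unfolding real numeral_eq_ereal by simp
    moreover have "1 - 1 / \<delta> = ereal (1 - 1 / r)"
      using real \<open>2 < r\<close> by (simp add: one_ereal_def)
    ultimately show ?thesis using assms(4) real by (simp add: diff_divide_distrib)
  qed (use assms in \<open>auto simp: one_ereal_def\<close>)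
  moreover have "2 - \<delta> < 0"
    using assms(3) by (cases \<delta>) (auto simp: numeral_eq_ereal zero_ereal_def)
  moreover have "\<gamma>' + \<gamma> < 1" using assms(5) by linarith
  ultimately show ?thesis
    using assms(1,2)
    by (auto simp: zeta_def Let_def zero_ereal_def divide_neg_pos mult_neg_pos)
qed

text \<open>
  For \<open>\<delta> = \<infinity>\<close> the profile is an indicator function and lies below \<open>min 1 (x powr (- \<delta>'))\<close> for every
  \<open>\<delta>' \<ge> 0\<close>, so a large finite \<open>\<delta>'\<close> takes the place of \<open>\<delta>\<close>.
\<close>

lemma zeta_admissible:
  assumes \<gamma>: "0 \<le> \<gamma>" "0 \<le> \<gamma>'" "2 < \<delta>" "\<gamma>' < 1 - \<gamma>" and \<theta>: "0 < \<theta>" "zeta \<gamma> \<gamma>' \<delta> < ereal (- \<theta>)"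
    and profile: "profile_function \<delta> \<rho>"
  obtains \<delta>' C where "admissible \<gamma> \<gamma>' \<delta>' \<theta>" "0 \<le> C"
    "\<And>x. 0 < x \<Longrightarrow> \<rho> x \<le> C * min 1 (x powr (- \<delta>'))"
proof -
  define r where "r = (if \<delta> = \<infinity> then 1 else (real_of_ereal \<delta> - 1) / real_of_ereal \<delta>)"
  have z: "2 - \<delta> < ereal (- \<theta>)" "\<gamma> \<noteq> 0 \<Longrightarrow> 1 - r / \<gamma> < - \<theta>" "\<gamma> \<noteq> 0 \<Longrightarrow> (\<gamma>' + \<gamma> - 1) / \<gamma> < - \<theta>"
    "\<gamma> + \<gamma>' \<noteq> 0 \<Longrightarrow> 2 * (\<gamma>' + \<gamma> - 1) / (\<gamma>' + \<gamma>) < - \<theta>"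
    using \<theta>(2) by (auto simp: zeta_def Let_def r_def split: if_splits)
  have c1: "\<gamma> * (1 + \<theta>) + \<gamma>' \<le> 1"
  proof (cases "\<gamma> = 0")
    case False
    then have "\<gamma>' + \<gamma> - 1 < - \<theta> * \<gamma>" using z(3) \<gamma>(1) by (simp add: pos_divide_less_eq)
    then show ?thesis by (simp add: algebra_simps)
  qed (use \<gamma> in auto)
  have c2: "(\<gamma> + \<gamma>') * (2 + \<theta>) \<le> 2"
  proof (cases "\<gamma> + \<gamma>' = 0")
    case False
    then have "2 * (\<gamma>' + \<gamma> - 1) < - \<theta> * (\<gamma>' + \<gamma>)" using z(4) \<gamma>(1,2) by (simp add: pos_divide_less_eq)
    then show ?thesis by (simp add: algebra_simps)
  qed auto
  have c3: "\<gamma> * (1 + \<theta>) < r" if "0 < r"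
  proof (cases "\<gamma> = 0")
    case False
    then have "1 + \<theta> < r / \<gamma>" using z(2) by simp
    then show ?thesis using False \<gamma>(1) by (simp add: pos_less_divide_eq mult.commute)
  qed (use that in auto)
  show ?thesis
  proof (cases \<delta>)
    case (real d)
    have d: "2 < d" using \<gamma>(3) unfolding real numeral_eq_ereal by simp
    have dt: "2 + \<theta> \<le> d" using z(1) unfolding real numeral_eq_ereal by simp
    have r: "r = (d - 1) / d" using real by (simp add: r_def)
    have "\<gamma> * (1 + \<theta>) < (d - 1) / d" using c3 d unfolding r by simp
    then have "1 \<le> d * (1 - \<gamma> * (1 + \<theta>))" using d by (simp add: pos_less_divide_eq algebra_simps)
    then have adm: "admissible \<gamma> \<gamma>' d \<theta>" using c1 c2 dt \<theta>(1) by (simp add: admissible_def)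
    obtain C where "0 < C" "\<forall>x>0. \<rho> x \<le> C * min 1 (x powr (- d))"
      using profile real by (auto simp: profile_function_def)
    then show ?thesis using that[OF adm, of C] by simp
  next
    case PInf
    have r: "r = 1" using PInf by (simp add: r_def)
    have lt: "\<gamma> * (1 + \<theta>) < 1" using c3 unfolding r by simp
    \<comment> \<open>The smallest finite exponent that satisfies the two conditions involving \<open>\<delta>\<close>.\<close>
    define d where "d = max (2 + \<theta>) (1 / (1 - \<gamma> * (1 + \<theta>)))"
    have "1 = 1 / (1 - \<gamma> * (1 + \<theta>)) * (1 - \<gamma> * (1 + \<theta>))" using lt by simp
    also have "\<dots> \<le> d * (1 - \<gamma> * (1 + \<theta>))" using lt by (intro mult_right_mono) (auto simp: d_def)
    finally have adm: "admissible \<gamma> \<gamma>' d \<theta>" using c1 c2 \<theta>(1) by (simp add: admissible_def d_def)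
    have "\<rho> x \<le> 1 * min 1 (x powr (- d))" if "0 < x" for x
    proof -
      have \<rho>: "\<rho> x = indicator {0..1} x" using profile PInf that by (simp add: profile_function_def)
      have "0 \<le> d" using \<theta>(1) by (simp add: d_def)
      then have "1 \<le> x powr (- d)" if "x \<le> 1"
        using \<open>0 < x\<close> that by (simp add: powr_def mult_nonneg_nonpos)
      then show ?thesis using \<open>0 < x\<close> unfolding \<rho> by (auto simp: indicator_def)
    qed
    then show ?thesis using that[OF adm, of 1] by simp
  qed (use \<gamma>(3) in auto)
qed

context wdrcm
begin

text \<open>
  The factor \<open>(K / l) ^ (2 * d)\<close> arises because a box of size \<open>K\<close> instead of \<open>l\<close> is searched for pairs of
  vertices. It is harmless, as the scales will be chosen such that \<open>K / l\<close> is a small power of \<open>l\<close>.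
\<close>

definition long_edge_decay :: "real \<Rightarrow> real \<Rightarrow> bool" where
  "long_edge_decay \<nu> \<sigma> \<longleftrightarrow> (\<forall>\<^sub>F l in at_top. \<forall>K x. l \<le> K \<longrightarrow>
     covered \<nu> (region x K) (long_edge x K l) ((K / l) ^ (2 * CARD('d)) * l powr (- \<sigma>)))"

text \<open>
  Apply \<open>long_edge_covered\<close> with the cutoff \<open>u = D powr (- (1 + \<theta>))\<close>, \<open>D = l ^ d\<close>. The squared logarithm
  is absorbed by the gap between \<open>\<sigma>\<close> and \<open>d * \<theta>\<close>.
\<close>

lemma long_edge_decay_below_zeta:
  assumes \<gamma>: "0 \<le> \<gamma>" "0 \<le> \<gamma>'" "2 < \<delta>" "\<gamma>' < 1 - \<gamma>"
    and \<theta>: "0 < \<theta>" "zeta \<gamma> \<gamma>' \<delta> < ereal (- \<theta>)" and \<sigma>: "\<sigma> < real CARD('d) * \<theta>" and \<nu>: "0 \<le> \<nu>"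
  shows "long_edge_decay \<nu> \<sigma>"
proof -
  obtain \<delta>' C where adm: "admissible \<gamma> \<gamma>' \<delta>' \<theta>" and C: "0 \<le> C"
    and \<rho>: "\<And>x. 0 < x \<Longrightarrow> \<rho> x \<le> C * min 1 (x powr (- \<delta>'))"
    using zeta_admissible[OF \<gamma> \<theta> profile] by blast
  define d where "d = CARD('d)"
  define c where "c = 8 ^ d * \<nu>"
  define c' where "c' = 64 ^ d * C * \<nu>\<^sup>2 * (real d * (1 + \<theta>))\<^sup>2"
  have e: "0 < real d * \<theta> - \<sigma>" using \<sigma> by (simp add: d_def)
  show ?thesis
    unfolding long_edge_decay_def
    using eventually_log_absorb[OF e, of c c'] eventually_gt_at_top[of "real d"] eventually_ge_at_top[of 1]
  proof eventually_elim
    case (elim l)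
    have l: "0 < l" "1 \<le> l" using elim(3) by auto
    define D where "D = l ^ d"
    have D: "1 \<le> D" using l by (simp add: D_def)
    define u where "u = D powr (- (1 + \<theta>))"
    define \<kappa> where "\<kappa> = C * D powr (- (2 + \<theta>))"
    have u: "0 < u" "u \<le> 1" using D \<theta>(1) by (auto simp: u_def powr_def mult_nonpos_nonneg)
    have ln_u: "ln (1 / u) = real d * (1 + \<theta>) * ln l"
      using D l by (simp add: u_def ln_div ln_powr D_def ln_realpow algebra_simps)
    have Dpow: "D powr a = l powr (real d * a)" for a
      using l by (simp add: D_def powr_powr flip: powr_realpow)
    show ?case
    proof (intro allI impI)
      fix K and x :: "real ^ 'd" assume K: "l \<le> K"
      define n where "n = (6 * K + 2) ^ d"
      have n: "n \<le> 8 ^ d * K ^ d" "0 \<le> n"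
      proof -
        have "0 \<le> 6 * K + 2" "6 * K + 2 \<le> 8 * K" using K l by simp_all
        then show "n \<le> 8 ^ d * K ^ d" "0 \<le> n"
          unfolding n_def power_mult_distrib[symmetric] by (auto simp only: power_mono zero_le_power)
      qed
      have "covered \<nu> (region x K) (long_edge x K l)
          (n * (\<nu> * u) + n\<^sup>2 * (\<kappa> * (\<nu> * ln (1 / u))\<^sup>2))"
        unfolding n_def d_def
      proof (rule long_edge_covered[OF _ _ u])
        show "\<rho> (a powr \<gamma> * b powr \<gamma>' * l ^ CARD('d)) \<le> \<kappa> / (a * b)" if "u \<le> a" "a \<le> b" "b < 1" for a b
          unfolding \<kappa>_def d_def[symmetric] D_def[symmetric]
          by (rule profile_mark_bound[OF adm \<gamma>(1,2) \<rho> C D]) (use that in \<open>simp_all add: u_def\<close>)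
      qed (use elim(2) K l C \<nu> in \<open>simp_all add: d_def \<kappa>_def\<close>)
      moreover have "n * (\<nu> * u) + n\<^sup>2 * (\<kappa> * (\<nu> * ln (1 / u))\<^sup>2) \<le> (K / l) ^ (2 * d) * l powr (- \<sigma>)"
      proof -
        have Kl: "1 \<le> K / l" using K l by simp
        have "n * (\<nu> * u) \<le> (8 ^ d * K ^ d) * (\<nu> * u)" using n u \<nu> by (intro mult_right_mono) auto
        also have "\<dots> = c * (K / l) ^ d * l powr (- (real d * \<theta>))"
        proof -
          have "u = l powr (- real d) * l powr (- (real d * \<theta>))"
            using l by (simp add: u_def Dpow powr_add[symmetric] algebra_simps)
          also have "l powr (- real d) = 1 / l ^ d"
            using l by (simp add: powr_minus powr_realpow divide_inverse)
          finally show ?thesis by (simp add: c_def power_divide)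
        qed
        also have "\<dots> \<le> c * (K / l) ^ (2 * d) * l powr (- (real d * \<theta>))"
          using Kl \<nu> by (intro mult_right_mono mult_left_mono power_increasing) (auto simp: c_def)
        finally have 1: "n * (\<nu> * u) \<le> c * ((K / l) ^ (2 * d) * l powr (- (real d * \<theta>)))" by (simp add: mult.assoc)
        have "n\<^sup>2 \<le> (8 ^ d * K ^ d)\<^sup>2" using n by (intro power_mono) auto
        also have "\<dots> = 64 ^ d * K ^ (2 * d)"
        proof -
          have "(8 ^ d)\<^sup>2 = ((8::real)\<^sup>2) ^ d" "(K ^ d)\<^sup>2 = K ^ (2 * d)"
            by (simp_all only: power_mult[symmetric] mult.commute)
          then show ?thesis by (simp add: power_mult_distrib)
        qed
        finally have "n\<^sup>2 * (\<kappa> * (\<nu> * ln (1 / u))\<^sup>2) \<le> (64 ^ d * K ^ (2 * d)) * (\<kappa> * (\<nu> * ln (1 / u))\<^sup>2)"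
          using C by (intro mult_right_mono) (auto simp: \<kappa>_def)
        also have "\<dots> = c' * (ln l)\<^sup>2 * (K / l) ^ (2 * d) * l powr (- (real d * \<theta>))"
        proof -
          have "D powr (- (2 + \<theta>)) = l powr (- real (2 * d)) * l powr (- (real d * \<theta>))"
            using l by (simp add: Dpow powr_add[symmetric] algebra_simps)
          also have "l powr (- real (2 * d)) = 1 / l ^ (2 * d)"
            using l by (simp only: powr_minus powr_realpow divide_inverse mult_1)
          finally have "\<kappa> = C * (1 / l ^ (2 * d) * l powr (- (real d * \<theta>)))" by (simp add: \<kappa>_def)
          then show ?thesis by (simp add: ln_u c'_def power_divide power_mult_distrib ac_simps)
        qed
        finally have 2: "n\<^sup>2 * (\<kappa> * (\<nu> * ln (1 / u))\<^sup>2) \<le>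
            c' * (ln l)\<^sup>2 * ((K / l) ^ (2 * d) * l powr (- (real d * \<theta>)))" by (simp add: mult.assoc)
        have "n * (\<nu> * u) + n\<^sup>2 * (\<kappa> * (\<nu> * ln (1 / u))\<^sup>2) \<le>
            (c + c' * (ln l)\<^sup>2) * ((K / l) ^ (2 * d) * l powr (- (real d * \<theta>)))"
          using 1 2 by (simp add: distrib_right)
        also have "\<dots> \<le> l powr (real d * \<theta> - \<sigma>) * ((K / l) ^ (2 * d) * l powr (- (real d * \<theta>)))"
          using elim(1) Kl by (intro mult_right_mono) auto
        also have "\<dots> = (K / l) ^ (2 * d) * (l powr (real d * \<theta> - \<sigma>) * l powr (- (real d * \<theta>)))"
          by (simp only: ac_simps)
        also have "l powr (real d * \<theta> - \<sigma>) * l powr (- (real d * \<theta>)) = l powr (- \<sigma>)"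
          unfolding powr_add[symmetric] by simp
        finally show ?thesis .
      qed
      ultimately show "covered \<nu> (region x K) (long_edge x K l) ((K / l) ^ (2 * CARD('d)) * l powr (- \<sigma>))"
        unfolding d_def by (rule covered_mono[OF _ order_refl order_refl])
    qed
  qed
qed

end

section \<open>Renormalisation\<close>

context wdrcm
begin

text \<open>
  The two conditions on \<open>\<alpha>\<close> compare exponents of \<open>k\<close>: the first makes long edges, the second the
  occurrence of \<open>c + 1\<close> distant fast boxes less likely than \<open>(k powr (1 + \<alpha>)) powr (- t)\<close>.
\<close>

lemma renormalisation_step:
  assumes decay: "long_edge_decay \<nu> \<sigma>" and \<nu>: "0 \<le> \<nu>" and \<alpha>: "0 < \<alpha>" "\<alpha> < 1" and s: "0 < s"
    and e1: "\<alpha> * (4 * real CARD('d) + \<sigma> + t) + t < \<sigma>"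
    and e2: "real (Suc c) * (\<alpha> * real CARD('d) - s) + (1 + \<alpha>) * t < 0"
  shows "\<forall>\<^sub>F k in at_top. \<forall>\<eta>>0. (\<forall>z. covered \<nu> (region z k) (fast_crossing z k \<eta>) (k powr (- s))) \<longrightarrow>
    (\<forall>x. covered \<nu> (region x (k powr (1 + \<alpha>)))
       (fast_crossing x (k powr (1 + \<alpha>)) (\<eta> * (1 - real (21 * c + 1) * k powr (- \<alpha>)) * (1 - k powr (- \<alpha>))))
       ((k powr (1 + \<alpha>)) powr (- t)))"
proof -
  define d where "d = CARD('d)"
  define c' where "c' = ((8 * real d) ^ d) ^ Suc c"
  obtain l0 where l0: "\<And>l K x. l0 \<le> l \<Longrightarrow> l \<le> K \<Longrightarrow>
      covered \<nu> (region x K) (long_edge x K l) ((K / l) ^ (2 * CARD('d)) * l powr (- \<sigma>))"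
    using decay unfolding long_edge_decay_def eventually_at_top_linorder by blast
  have large: "\<forall>\<^sub>F k in at_top. b \<le> k powr e" if "0 < e" for b e :: real
    using eventually_powr_absorb[OF that, of "\<bar>b\<bar>"] eventually_gt_at_top[of 0]
    by eventually_elim auto
  have l_large: "\<forall>\<^sub>F k in at_top. l0 \<le> k powr (1 - \<alpha>)" using \<alpha> by (intro large) simp
  have K_large: "\<forall>\<^sub>F k in at_top. real (21 * c + 5) \<le> k powr \<alpha>" using \<alpha> by (intro large)
  have long: "\<forall>\<^sub>F k in at_top. 1 * k powr (4 * real d * \<alpha> - (1 - \<alpha>) * \<sigma>) \<le> k powr (- (1 + \<alpha>) * t) / 2"
    using e1 by (intro eventually_powr_absorb) (simp add: d_def algebra_simps)
  have bad: "\<forall>\<^sub>F k in at_top. c' * k powr (real (Suc c) * (\<alpha> * real d - s)) \<le> k powr (- (1 + \<alpha>) * t) / 2"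
    using e2 by (intro eventually_powr_absorb) (simp add: d_def algebra_simps)
  show ?thesis
    using l_large K_large long bad eventually_ge_at_top[of "real d"] eventually_ge_at_top[of 1]
  proof eventually_elim
    case (elim k)
    define K where "K = k powr (1 + \<alpha>)"
    define l where "l = k powr (1 - \<alpha>)"
    have k: "1 \<le> k" "0 < k" using elim(6) by auto
    have Kk: "K = k * k powr \<alpha>" using k by (simp add: K_def powr_add)
    have lk: "l = k * k powr (- \<alpha>)" using k by (simp add: l_def powr_add[symmetric] powr_mult_base)
    have K0: "0 < K" and l_pos: "0 < l" using k by (auto simp: K_def l_def)
    have le1: "k powr (- \<alpha>) \<le> 1" using k \<alpha> by (simp add: powr_def)
    have l: "l \<le> k" unfolding lk using k le1 by simp
    have Kc: "real (21 * c + 5) * k \<le> K"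
      unfolding Kk using mult_right_mono[OF elim(2), of k] k by (simp add: mult.commute)
    have "5 * k \<le> real (21 * c + 5) * k" using k by (intro mult_right_mono) auto
    then have K5: "5 * k \<le> K" using Kc by linarith
    have "real (21 * c + 1) * k \<le> real (21 * c + 5) * k" using k by (intro mult_right_mono) auto
    then have Kc1: "real (21 * c + 1) * k \<le> K" using Kc by linarith
    have kK: "k / K = k powr (- \<alpha>)" unfolding Kk using k by (simp add: powr_minus divide_inverse)
    show ?case
    proof (intro allI impI)
      fix \<eta> :: real and x :: "real ^ 'd"
      assume \<eta>: "0 < \<eta>" and IH: "\<forall>z. covered \<nu> (region z k) (fast_crossing z k \<eta>) (k powr (- s))"
      have q: "covered \<nu> (region x K) (long_edge x K l) ((K / l) ^ (2 * CARD('d)) * l powr (- \<sigma>))"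
        using elim(1) K5 l k by (intro l0) (auto simp: l_def[symmetric])
      have "covered \<nu> (region x K)
          (fast_crossing x K (\<eta> * (1 - real (21 * c + 1) * k powr (- \<alpha>)) * (1 - k powr (- \<alpha>))))
          ((K / l) ^ (2 * CARD('d)) * l powr (- \<sigma>) + ((8 * real CARD('d) * K / k) ^ CARD('d) * k powr (- s)) ^ Suc c)"
      proof (rule fast_crossing_covered_step[OF _ _ l \<eta> K5 Kc1 \<nu> _ _ q])
        show "real CARD('d) \<le> k" using elim(5) by (simp add: d_def)
        have "l / k = k powr (- \<alpha>)" unfolding lk using k by simp
        then show "\<eta> * (1 - real (21 * c + 1) * k powr (- \<alpha>)) * (1 - k powr (- \<alpha>))
            \<le> \<eta> * (1 - real (21 * c + 1) * k / K) * (1 - l / k)"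
          unfolding kK[symmetric] by simp
      qed (use IH l_pos in auto)
      moreover have "(K / l) ^ (2 * CARD('d)) * l powr (- \<sigma>) +
          ((8 * real CARD('d) * K / k) ^ CARD('d) * k powr (- s)) ^ Suc c \<le> K powr (- t)"
      proof -
        have "K / l = k powr (2 * \<alpha>)" unfolding K_def l_def using k by (simp add: powr_diff[symmetric])
        then have "(K / l) ^ (2 * CARD('d)) = k powr (4 * real d * \<alpha>)"
          using k by (simp add: powr_realpow[symmetric] powr_powr d_def mult_ac)
        moreover have "l powr (- \<sigma>) = k powr (- ((1 - \<alpha>) * \<sigma>))" by (simp add: l_def powr_powr)
        ultimately have 1: "(K / l) ^ (2 * CARD('d)) * l powr (- \<sigma>) = 1 * k powr (4 * real d * \<alpha> - (1 - \<alpha>) * \<sigma>)"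
          by (simp add: powr_add[symmetric])
        have "8 * real CARD('d) * K / k = (8 * real d) * k powr \<alpha>" unfolding Kk using k by (simp add: d_def)
        then have "(8 * real CARD('d) * K / k) ^ CARD('d) = (8 * real d) ^ d * k powr (\<alpha> * real d)"
          using k by (simp add: power_mult_distrib powr_realpow[symmetric] powr_powr d_def)
        then have "(8 * real CARD('d) * K / k) ^ CARD('d) * k powr (- s) = (8 * real d) ^ d * k powr (\<alpha> * real d - s)"
          by (simp add: powr_add[symmetric])
        then have 2: "((8 * real CARD('d) * K / k) ^ CARD('d) * k powr (- s)) ^ Suc c =
            c' * k powr (real (Suc c) * (\<alpha> * real d - s))"
        proof -
          have "(k powr (\<alpha> * real d - s)) ^ Suc c = k powr ((\<alpha> * real d - s) * real (Suc c))"
            using k by (subst powr_realpow[symmetric]) (auto simp: powr_powr)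
          then show ?thesis
            unfolding \<open>(8 * real CARD('d) * K / k) ^ CARD('d) * k powr (- s) = _\<close> power_mult_distrib c'_def
            by (simp only: mult.commute)
        qed
        have "K powr (- t) = k powr (- (1 + \<alpha>) * t)" unfolding K_def powr_powr by (simp only: mult_minus_left mult_minus_right)
        then show ?thesis unfolding 1 2 using elim(3,4) by linarith
      qed
      ultimately show "covered \<nu> (region x (k powr (1 + \<alpha>)))
         (fast_crossing x (k powr (1 + \<alpha>)) (\<eta> * (1 - real (21 * c + 1) * k powr (- \<alpha>)) * (1 - k powr (- \<alpha>))))
         ((k powr (1 + \<alpha>)) powr (- t))"
        unfolding K_def[symmetric] by (rule covered_mono[OF _ order_refl order_refl])
    qed
  qed
qed

text \<open>
  Induction over the scales \<open>T n = K0 powr ((1 + \<alpha>) ^ n)\<close> with \<open>c = 1\<close>. In each step the claim for all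
  sizes up to \<open>T (n + 1)\<close> yields the one for all sizes up to \<open>T (n + 2)\<close>, with a slightly smaller speed
  constant.
\<close>

lemma fast_crossing_decay:
  assumes decay: "long_edge_decay \<nu> \<sigma>" and \<nu>: "0 \<le> \<nu>" and \<sigma>: "0 < \<sigma>"
  obtains \<eta> s K0 where "0 < \<eta>" "0 < s"
    "\<And>K x. K0 \<le> K \<Longrightarrow> covered \<nu> (region x K) (fast_crossing x K \<eta>) (K powr (- s))"
proof -
  define d where "d = real CARD('d)"
  have d: "1 \<le> d" by (simp add: d_def Suc_leI)
  define s where "s = \<sigma> / 2"
  have s: "0 < s" "\<sigma> = 2 * s" using \<sigma> by (auto simp: s_def)
  define \<alpha> where "\<alpha> = (s / 2) / (4 * d + 3 * s)"
  have pos: "0 < 4 * d + 3 * s" using d s by simp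
  have "a / b * b = a" if "b \<noteq> 0" for a b :: real using that by simp
  from this[of "4 * d + 3 * s" "s / 2"] have \<alpha>s: "\<alpha> * (4 * d + 3 * s) = s / 2"
    unfolding \<alpha>_def using pos by linarith
  have \<alpha>: "0 < \<alpha>" "\<alpha> < 1" using pos s d by (auto simp: \<alpha>_def)
  have \<alpha>d: "0 \<le> \<alpha> * d" "0 \<le> \<alpha> * s" using \<alpha> d s by auto
  define P where "P k \<longleftrightarrow> (\<forall>\<eta>>0. (\<forall>z. covered \<nu> (region z k) (fast_crossing z k \<eta>) (k powr (- s))) \<longrightarrow>
    (\<forall>x. covered \<nu> (region x (k powr (1 + \<alpha>)))
       (fast_crossing x (k powr (1 + \<alpha>)) (\<eta> * (1 - real (21 * 1 + 1) * k powr (- \<alpha>)) * (1 - k powr (- \<alpha>))))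
       ((k powr (1 + \<alpha>)) powr (- s))))" for k
  have "\<forall>\<^sub>F k in at_top. P k"
    unfolding P_def
  proof (rule renormalisation_step[OF decay \<nu> \<alpha> s(1)])
    show "\<alpha> * (4 * real CARD('d) + \<sigma> + s) + s < \<sigma>"
      using \<alpha>s s by (simp add: d_def algebra_simps)
    have "4 * (\<alpha> * d) + 3 * (\<alpha> * s) = s / 2" using \<alpha>s by (simp add: algebra_simps)
    then have "2 * (\<alpha> * d) - 2 * s + (s + \<alpha> * s) < 0" using \<alpha>d s by linarith
    then show "real (Suc 1) * (\<alpha> * real CARD('d) - s) + (1 + \<alpha>) * s < 0"
      by (simp add: d_def algebra_simps)
  qed
  then obtain k0 where k0: "\<forall>k\<ge>k0. P k" unfolding eventually_at_top_linorder by (rule exE)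
  have step: "k0 \<le> k \<Longrightarrow> 0 < \<eta> \<Longrightarrow>
      (\<And>z. covered \<nu> (region z k) (fast_crossing z k \<eta>) (k powr (- s))) \<Longrightarrow>
      covered \<nu> (region x (k powr (1 + \<alpha>)))
       (fast_crossing x (k powr (1 + \<alpha>)) (\<eta> * (1 - 22 * k powr (- \<alpha>)) * (1 - k powr (- \<alpha>))))
       ((k powr (1 + \<alpha>)) powr (- s))" for k \<eta> x
    using k0 unfolding P_def by simp
  have "\<forall>\<^sub>F k in at_top. 1 * k powr (- \<alpha>) \<le> k powr 0 / 2" "\<forall>\<^sub>F k in at_top. 46 * k powr (- \<alpha>) \<le> k powr 0 / 2"
    "\<forall>\<^sub>F k in at_top. 1 * k powr (- (\<alpha> * \<alpha>)) \<le> k powr 0 / 2"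
    using \<alpha> by (intro eventually_powr_absorb; simp)+
  then have "\<forall>\<^sub>F k in at_top. k0 \<le> k \<and> 2 \<le> k \<and> 92 * k powr (- \<alpha>) \<le> 1 \<and> 2 * k powr (- (\<alpha> * \<alpha>)) \<le> 1"
    using eventually_ge_at_top[of k0] eventually_ge_at_top[of 2] by eventually_elim auto
  then obtain K0 where K0: "k0 \<le> K0" "2 \<le> K0" "92 * K0 powr (- \<alpha>) \<le> 1" "2 * K0 powr (- (\<alpha> * \<alpha>)) \<le> 1"
    unfolding eventually_at_top_linorder by blast
  define T where "T n = K0 powr ((1 + \<alpha>) ^ n)" for n :: nat
  \<comment> \<open>So small that \<open>\<eta>0 * K \<le> 1\<close> for all sizes up to \<open>T 1\<close>.\<close>
  define \<eta>0 where "\<eta>0 = K0 powr (- (1 + \<alpha>))"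
  have \<eta>0: "0 < \<eta>0" using K0 by (simp add: \<eta>0_def)
  \<comment> \<open>The difference \<open>\<eta>0 * (1 / 2) ^ n / 4\<close> of consecutive terms is at least the loss
    \<open>\<eta> n * (23 * T n powr (- \<alpha>))\<close> of the renormalisation step.\<close>
  define \<eta> where "\<eta> n = \<eta>0 * (1 / 2 + (1 / 2) ^ Suc n)" for n
  have \<eta>_ge: "\<eta>0 / 2 \<le> \<eta> n" for n using \<eta>0 by (simp add: \<eta>_def algebra_simps)
  have T_ge: "K0 \<le> T n" for n
  proof -
    have "K0 powr 1 \<le> T n" unfolding T_def using K0 \<alpha> by (intro powr_mono one_le_power) auto
    then show ?thesis using K0 by simp
  qed
  have T_Suc: "T (Suc n) = T n powr (1 + \<alpha>)" for n
    by (simp add: T_def powr_powr mult.commute)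
  have T_small: "92 * T n powr (- \<alpha>) \<le> (1 / 2) ^ n" for n
  proof -
    have "1 + real n * \<alpha> \<le> (1 + \<alpha>) ^ n" using \<alpha> by (intro Bernoulli_inequality) auto
    then have "\<alpha> * (1 + real n * \<alpha>) \<le> \<alpha> * (1 + \<alpha>) ^ n" using \<alpha> by (intro mult_left_mono) auto
    then have "T n powr (- \<alpha>) \<le> K0 powr (- (\<alpha> * (1 + real n * \<alpha>)))"
      unfolding T_def powr_powr using K0 by (intro powr_mono) (auto simp: mult.commute)
    also have "- (\<alpha> * (1 + real n * \<alpha>)) = - \<alpha> + (- (\<alpha> * \<alpha>)) * real n" by (simp add: algebra_simps)
    also have "K0 powr \<dots> = K0 powr (- \<alpha>) * (K0 powr (- (\<alpha> * \<alpha>))) ^ n"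
      unfolding powr_add using K0 by (subst powr_realpow[symmetric]) (simp_all add: powr_powr)
    also have "\<dots> \<le> (1 / 92) * (1 / 2) ^ n"
      using K0 by (intro mult_mono power_mono) auto
    finally show ?thesis by simp
  qed
  have main: "covered \<nu> (region x K) (fast_crossing x K (\<eta> n)) (K powr (- s))"
    if "K0 \<le> K" "K \<le> T (Suc n)" for n K x
    using that
  proof (induction n arbitrary: K x)
    case 0
    have "\<eta> 0 * K \<le> \<eta>0 * K0 powr (1 + \<alpha>)"
      using 0 \<eta>0 by (simp add: \<eta>_def T_def)
    also have "\<dots> = 1" using K0 by (simp add: \<eta>0_def powr_add[symmetric])
    finally have "fast_crossing x K (\<eta> 0) = {}" using 0 K0 by (intro fast_crossing_empty) auto
    then show ?case by (simp add: covered_mono[OF covered_empty order_refl])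
  next
    case (Suc n)
    have Kpos: "0 < K" using Suc.prems K0 by linarith
    have mono: "\<eta> (Suc n) \<le> \<eta> n"
    proof -
      have "(1 / 2 :: real) ^ Suc (Suc n) \<le> (1 / 2) ^ Suc n" by simp
      then show ?thesis unfolding \<eta>_def using \<eta>0 by (intro mult_left_mono add_left_mono) auto
    qed
    show ?case
    proof (cases "K \<le> T (Suc n)")
      case True
      show ?thesis
        by (rule covered_mono[OF Suc.IH[OF Suc.prems(1) True] order_refl fast_crossing_mono[OF mono] order_refl])
          (use Kpos in simp)
    next
      case False
      define k where "k = K powr (1 / (1 + \<alpha>))"
      have Kk: "K = k powr (1 + \<alpha>)" using Kpos \<alpha> by (simp add: k_def powr_powr)
      have kpos: "0 < k" using Kpos by (simp add: k_def)
      have root: "T m powr (1 + \<alpha>) < k powr (1 + \<alpha>) \<longleftrightarrow> T m < k" for m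
      proof -
        have Tpos: "0 < T m" using T_ge[of m] K0 by linarith
        have \<alpha>1: "0 < 1 + \<alpha>" using \<alpha> by simp
        show ?thesis
          using powr_less_cancel2[OF \<alpha>1 Tpos kpos] powr_less_mono2[OF \<alpha>1 less_imp_le[OF Tpos]] by (rule iffI)
      qed
      have k_gt: "T n < k" using False unfolding root[symmetric] Kk[symmetric] T_Suc[symmetric] by simp
      have k_le: "k \<le> T (Suc n)"
        using Suc.prems(2) unfolding not_less[symmetric] root[symmetric] Kk[symmetric] T_Suc[symmetric] .
      have kK0: "K0 \<le> k" using k_gt T_ge[of n] by linarith
      have \<eta>n: "0 < \<eta> n" using \<eta>_ge[of n] \<eta>0 by linarith
      have "covered \<nu> (region x (k powr (1 + \<alpha>)))
         (fast_crossing x (k powr (1 + \<alpha>)) (\<eta> n * (1 - 22 * k powr (- \<alpha>)) * (1 - k powr (- \<alpha>))))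
         ((k powr (1 + \<alpha>)) powr (- s))"
        using kK0 K0(1) \<eta>n Suc.IH[OF kK0 k_le] by (intro step) auto
      then have "covered \<nu> (region x K)
         (fast_crossing x K (\<eta> n * (1 - 22 * k powr (- \<alpha>)) * (1 - k powr (- \<alpha>)))) (K powr (- s))"
        unfolding Kk[symmetric] .
      note larger = this
      have "\<eta> (Suc n) \<le> \<eta> n * (1 - 22 * k powr (- \<alpha>)) * (1 - k powr (- \<alpha>))"
      proof -
        define \<epsilon> where "\<epsilon> = k powr (- \<alpha>)"
        have "\<epsilon> \<le> T n powr (- \<alpha>)"
          unfolding \<epsilon>_def using k_gt T_ge[of n] K0 \<alpha> by (intro powr_mono2') auto
        then have \<epsilon>: "92 * \<epsilon> \<le> (1 / 2) ^ n" "0 \<le> \<epsilon>" using T_small[of n] by (auto simp: \<epsilon>_def)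
        have pow: "(1 / 2) ^ n \<le> (1 :: real)" by (simp add: power_le_one)
        have half: "\<eta>0 * (1 / 2 + (1 / 2) ^ Suc n) \<le> \<eta>0 * 1"
          using pow \<eta>0 by (intro mult_left_mono) auto
        have "\<eta> (Suc n) = \<eta>0 * (1 / 2 + (1 / 2) ^ Suc n) - \<eta>0 * (1 / 4 * (1 / 2) ^ n)"
          by (simp add: \<eta>_def algebra_simps)
        also have "\<dots> \<le> \<eta> n - \<eta>0 * (23 * \<epsilon>)"
          unfolding \<eta>_def using \<epsilon> \<eta>0 by (intro diff_left_mono mult_left_mono) auto
        also have "\<dots> \<le> \<eta> n - \<eta> n * (23 * \<epsilon>)"
          using half \<epsilon> by (intro diff_left_mono mult_right_mono) (auto simp: \<eta>_def)
        also have "\<dots> \<le> \<eta> n * (1 - 22 * \<epsilon>) * (1 - \<epsilon>)"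
        proof -
          have "\<eta> n * (1 - 22 * \<epsilon>) * (1 - \<epsilon>) = \<eta> n - \<eta> n * (23 * \<epsilon>) + 22 * (\<eta> n * (\<epsilon> * \<epsilon>))"
            by (simp add: algebra_simps)
          then show ?thesis using \<eta>n by simp
        qed
        finally show ?thesis unfolding \<epsilon>_def .
      qed
      note smaller = fast_crossing_mono[OF this less_imp_le[OF Kpos]]
      show ?thesis by (rule covered_mono[OF larger order_refl smaller order_refl])
    qed
  qed
  have final: "covered \<nu> (region x K) (fast_crossing x K (\<eta>0 / 2)) (K powr (- s))" if K: "K0 \<le> K" for K x
  proof -
    have lnK0: "0 < ln K0" using K0 by simp
    obtain n where n: "ln K / ln K0 < (1 + \<alpha>) ^ n" using real_arch_pow[of "1 + \<alpha>"] \<alpha> by auto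
    have "(1 + \<alpha>) ^ n \<le> (1 + \<alpha>) ^ Suc n" using \<alpha> by simp
    with n have "ln K / ln K0 \<le> (1 + \<alpha>) ^ Suc n" by linarith
    then have "ln K \<le> (1 + \<alpha>) ^ Suc n * ln K0" using lnK0 by (simp only: pos_divide_le_eq)
    then have exp_le: "exp (ln K) \<le> exp ((1 + \<alpha>) ^ Suc n * ln K0)" by (simp only: exp_le_cancel_iff)
    have "0 < K" "0 < K0" using K K0 by auto
    with exp_le have "K \<le> T (Suc n)" by (simp add: T_def powr_def)
    from main[OF K this] show ?thesis
      by (rule covered_mono[OF _ order_refl fast_crossing_mono[OF \<eta>_ge] order_refl])
        (use \<open>0 < K\<close> in simp)
  qed
  show ?thesis using that[of "\<eta>0 / 2" s K0] \<eta>0 s(1) final by simp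
qed

text \<open>
  One more step. The exponent \<open>s\<close> that is known so far is multiplied by \<open>c + 1\<close>, which beats any target;
  then only the long edges matter, and they allow every \<open>t < \<sigma>\<close>.
\<close>

lemma fast_crossing_decay_boost:
  assumes decay: "long_edge_decay \<nu> \<sigma>" and \<nu>: "0 \<le> \<nu>" and t: "0 < t" "t < \<sigma>"
    and \<eta>: "0 < \<eta>" "0 < s"
    and base: "\<And>K x. K0 \<le> K \<Longrightarrow> covered \<nu> (region x K) (fast_crossing x K \<eta>) (K powr (- s))"
  shows "\<forall>\<^sub>F K in at_top. \<forall>x. covered \<nu> (region x K) (fast_crossing x K (\<eta> / 2)) (K powr (- t))"
proof -
  define d where "d = real CARD('d)"
  have d: "1 \<le> d" by (simp add: d_def Suc_leI)
  define \<alpha> where "\<alpha> = Min {1 / 2, s / (2 * d), ((\<sigma> - t) / 2) / (4 * d + \<sigma> + t)}"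
  have pos: "0 < 4 * d + \<sigma> + t" using d t by simp
  have \<alpha>: "0 < \<alpha>" "\<alpha> < 1" "\<alpha> \<le> s / (2 * d)" "\<alpha> \<le> ((\<sigma> - t) / 2) / (4 * d + \<sigma> + t)"
    using pos t d \<eta> by (auto simp: \<alpha>_def)
  have \<alpha>1: "\<alpha> * d \<le> s / 2" using \<alpha>(3) d by (simp add: field_simps)
  have \<alpha>2: "\<alpha> * (4 * d + \<sigma> + t) \<le> (\<sigma> - t) / 2"
    using \<alpha>(4) pos by (simp only: pos_le_divide_eq)
  obtain c where c: "4 * t / s < real c" using reals_Archimedean2 by blast
  then have c: "4 * t < real c * s" using \<eta> by (simp add: pos_divide_less_eq)
  have "\<forall>\<^sub>F k in at_top. \<forall>\<eta>>0. (\<forall>z. covered \<nu> (region z k) (fast_crossing z k \<eta>) (k powr (- s))) \<longrightarrow>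
    (\<forall>x. covered \<nu> (region x (k powr (1 + \<alpha>)))
       (fast_crossing x (k powr (1 + \<alpha>)) (\<eta> * (1 - real (21 * c + 1) * k powr (- \<alpha>)) * (1 - k powr (- \<alpha>))))
       ((k powr (1 + \<alpha>)) powr (- t)))"
  proof (rule renormalisation_step[OF decay \<nu> \<alpha>(1,2) \<eta>(2)])
    have "\<alpha> * (4 * d + \<sigma> + t) + t \<le> (\<sigma> - t) / 2 + t" using \<alpha>2 by (rule add_right_mono)
    also have "\<dots> < \<sigma>" using t by (simp add: field_simps)
    finally show "\<alpha> * (4 * real CARD('d) + \<sigma> + t) + t < \<sigma>" unfolding d_def .
    have "real (Suc c) * (\<alpha> * d - s) \<le> real (Suc c) * (- (s / 2))" using \<alpha>1 by (intro mult_left_mono) auto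
    also have "\<dots> = - (real c * s) / 2 - s / 2" by (simp add: field_simps)
    also have "\<dots> < - 2 * t" using c \<eta>(2) by simp
    finally have "real (Suc c) * (\<alpha> * d - s) < - 2 * t" .
    moreover have "(1 + \<alpha>) * t \<le> 2 * t" using \<alpha> t by (intro mult_right_mono) auto
    ultimately show "real (Suc c) * (\<alpha> * real CARD('d) - s) + (1 + \<alpha>) * t < 0"
      unfolding d_def by linarith
  qed
  moreover have "\<forall>\<^sub>F k in at_top. (8 * real (21 * c + 1)) * k powr (- \<alpha>) \<le> k powr 0 / 2"
    using \<alpha> by (intro eventually_powr_absorb) auto
  ultimately have ev: "\<forall>\<^sub>F k in at_top. \<forall>x. covered \<nu> (region x (k powr (1 + \<alpha>)))
       (fast_crossing x (k powr (1 + \<alpha>)) (\<eta> / 2)) ((k powr (1 + \<alpha>)) powr (- t))"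
    using eventually_ge_at_top[of K0] eventually_ge_at_top[of 1]
  proof eventually_elim
    case (elim k)
    define \<epsilon> where "\<epsilon> = k powr (- \<alpha>)"
    define a where "a = real (21 * c + 1) * \<epsilon>"
    have \<epsilon>: "0 \<le> \<epsilon>" by (simp add: \<epsilon>_def)
    have "8 * a = (8 * real (21 * c + 1)) * k powr (- \<alpha>)" by (simp only: a_def \<epsilon>_def mult.assoc)
    also have "\<dots> \<le> k powr 0 / 2" by (rule elim(2))
    finally have a: "8 * a \<le> 1 / 2" using elim(4) by simp
    have \<epsilon>a: "\<epsilon> \<le> a" using mult_right_mono[of 1 "real (21 * c + 1)" \<epsilon>] \<epsilon> by (simp add: a_def)
    have "1 / 2 \<le> (1 - a) * (1 - a)"
    proof -
      have "(1 - a) * (1 - a) = 1 - 2 * a + a * a" by (simp add: algebra_simps)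
      moreover have "0 \<le> a * a" by simp
      ultimately show ?thesis using a by linarith
    qed
    also have "\<dots> \<le> (1 - a) * (1 - \<epsilon>)" using a \<epsilon>a by (intro mult_left_mono) auto
    finally have "\<eta> * (1 / 2) \<le> \<eta> * ((1 - a) * (1 - \<epsilon>))" using \<eta>(1) by (intro mult_left_mono) auto
    then have "\<eta> / 2 \<le> \<eta> * (1 - real (21 * c + 1) * k powr (- \<alpha>)) * (1 - k powr (- \<alpha>))"
      by (simp add: a_def \<epsilon>_def mult.assoc)
    note sub = fast_crossing_mono[OF this]
    show ?case
    proof
      fix x
      have "covered \<nu> (region x (k powr (1 + \<alpha>)))
       (fast_crossing x (k powr (1 + \<alpha>)) (\<eta> * (1 - real (21 * c + 1) * k powr (- \<alpha>)) * (1 - k powr (- \<alpha>))))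
       ((k powr (1 + \<alpha>)) powr (- t))"
        using elim(1) \<eta>(1) base[OF elim(3)] by simp
      then show "covered \<nu> (region x (k powr (1 + \<alpha>)))
       (fast_crossing x (k powr (1 + \<alpha>)) (\<eta> / 2)) ((k powr (1 + \<alpha>)) powr (- t))"
        by (rule covered_mono[OF _ order_refl _ order_refl]) (rule sub, simp)
    qed
  qed
  then obtain k1 where k1: "\<And>k x. k1 \<le> k \<Longrightarrow> covered \<nu> (region x (k powr (1 + \<alpha>)))
       (fast_crossing x (k powr (1 + \<alpha>)) (\<eta> / 2)) ((k powr (1 + \<alpha>)) powr (- t))"
    unfolding eventually_at_top_linorder by blast
  have "\<forall>\<^sub>F K in at_top. \<bar>k1\<bar> * K powr 0 \<le> K powr (1 / (1 + \<alpha>)) / 2"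
    using \<alpha> by (intro eventually_powr_absorb) auto
  then show ?thesis
    using eventually_gt_at_top[of 0]
  proof eventually_elim
    case (elim K)
    have "(K powr (1 / (1 + \<alpha>))) powr (1 + \<alpha>) = K" using elim(2) \<alpha> by (simp add: powr_powr)
    moreover have "\<bar>k1\<bar> \<le> K powr (1 / (1 + \<alpha>)) / 2" using elim by simp
    then have "k1 \<le> K powr (1 / (1 + \<alpha>))" by linarith
    ultimately show ?case using k1[of "K powr (1 / (1 + \<alpha>))"] by simp
  qed
qed

end

section \<open>Distances between remote vertices\<close>

context wdrcm
begin

text \<open>
  Take the first of the balls of radius \<open>r n = 2 ^ n * m / 4\<close> that contains the whole path, and stop the
  path when it leaves the previous ball. This initial piece has moved by a third of the radius, has
  at most as many steps as the whole path, and the endpoints of the whole path are no further apart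
  than the diameter of the ball.
\<close>

lemma not_linear_dist_subset:
  assumes m: "0 < m" and L: "12 * (real CARD('d) * L) \<le> m"
  shows "space M - linear_dist_event X E (\<eta> / 6) L m \<subseteq>
    (\<Union>n. fast_crossing 0 (2 ^ n * m / 6) \<eta>)"
proof
  fix \<omega> assume "\<omega> \<in> space M - linear_dist_event X E (\<eta> / 6) L m"
  then obtain i j where \<omega>: "\<omega> \<in> space M" and i: "X i \<omega> \<in> cube L 0" and j: "X j \<omega> \<notin> cube m 0"
    and not_le: "\<not> ereal (\<eta> / 6 * norm (X i \<omega> - X j \<omega>)) \<le> ereal_of_enat (graph_dist (E \<omega>) i j)"
    unfolding linear_dist_event_def by auto
  from not_le[unfolded le_graph_dist_iff] obtain vs where vs: "vs \<in> graph_paths (E \<omega>) i j"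
    "real (length vs - 1) < \<eta> / 6 * norm (X i \<omega> - X j \<omega>)"
    by (auto simp: not_le)
  have path: "vs \<noteq> []" "hd vs = i" "last vs = j" "successively (\<lambda>a b. (a, b) \<in> E \<omega>) vs"
    using vs(1) by (auto simp: graph_paths_def)
  have Xi: "norm (X i \<omega>) \<le> m / 24"
  proof -
    have "\<bar>X i \<omega> $ k\<bar> \<le> L / 2" for k
    proof -
      have "0 - L / 2 \<le> X i \<omega> $ k" "X i \<omega> $ k < 0 + L / 2" using i by (auto simp: cube_def)
      then show ?thesis by linarith
    qed
    then have "(\<Sum>k\<in>UNIV. \<bar>X i \<omega> $ k\<bar>) \<le> (\<Sum>k\<in>(UNIV::'d set). L / 2)" by (intro sum_mono) auto
    then have "norm (X i \<omega>) \<le> real CARD('d) * (L / 2)"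
      using norm_le_l1_cart[of "X i \<omega>"] by simp
    then show ?thesis using L by simp
  qed
  have Xj: "m / 2 \<le> norm (X j \<omega>)"
  proof -
    obtain k where "\<not> (0 - m / 2 \<le> X j \<omega> $ k \<and> X j \<omega> $ k < 0 + m / 2)" using j by (auto simp: cube_def)
    then have "m / 2 \<le> \<bar>X j \<omega> $ k\<bar>" by linarith
    then show ?thesis using component_le_norm_cart[of "X j \<omega>" k] by linarith
  qed
  define r where "r n = 2 ^ n * m / 4" for n :: nat
  have r_Suc: "r (Suc n) = 2 * r n" for n by (simp add: r_def)
  have "\<exists>n. \<forall>v\<in>set vs. norm (X v \<omega>) \<le> r n"
  proof -
    define B where "B = Max ((\<lambda>v. norm (X v \<omega>)) ` set vs)"
    have B: "norm (X v \<omega>) \<le> B" if "v \<in> set vs" for v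
      unfolding B_def using that by (intro Max_ge) auto
    obtain n where "B / (m / 4) < 2 ^ n" using real_arch_pow[of 2 "B / (m / 4)"] by auto
    then have "B < r n" using m by (simp add: r_def pos_divide_less_eq)
    then show ?thesis using B by (intro exI[of _ n] ballI) (rule order_trans[OF _ less_imp_le])
  qed
  then obtain N where N: "\<forall>v\<in>set vs. norm (X v \<omega>) \<le> r N"
      and N_least: "\<forall>n<N. \<not> (\<forall>v\<in>set vs. norm (X v \<omega>) \<le> r n)"
    unfolding exists_least_iff[of "\<lambda>n. \<forall>v\<in>set vs. norm (X v \<omega>) \<le> r n"] by (elim exE conjE)
  have "j \<in> set vs" using path by auto
  then have "m / 2 \<le> r N" using bspec[OF N, of j] Xj by linarith
  then have "N \<noteq> 0" using m by (intro notI) (simp add: r_def)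
  then obtain n where n: "N = Suc n" using not0_implies_Suc by blast
  \<comment> \<open>A third of the radius \<open>r N\<close>, so that \<open>cball 0 (3 * K)\<close> is the ball that contains the path.\<close>
  define K where "K = 2 ^ n * m / 6"
  have rK: "r N = 3 * K" "r n = 3 / 2 * K" by (simp_all add: n r_def K_def)
  have mK: "m \<le> 6 * K"
  proof -
    have "1 * m \<le> 2 ^ n * m" using m by (intro mult_right_mono) auto
    then show ?thesis by (simp add: K_def)
  qed
  then have K: "0 < K" using m by linarith
  obtain v where v: "v \<in> set vs" "r n < norm (X v \<omega>)" using N_least n by (auto simp: not_le)
  obtain as bs where split: "vs = as @ v # bs" using split_list[OF v(1)] by blast
  define ws where "ws = as @ [v]"
  have ws: "ws \<noteq> []" "vs = ws @ bs" "last ws = v" "hd ws = i"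
    using split path(2) by (auto simp: ws_def hd_append split: if_splits)
  have sub: "set ws \<subseteq> set vs" using ws(2) by auto
  have "successively (\<lambda>a b. (a, b) \<in> E \<omega>) ws"
    using path(4) unfolding ws(2) successively_append_iff by blast
  moreover have "X w \<omega> \<in> cball 0 (3 * K)" if "w \<in> set ws" for w
    using bspec[OF N subsetD[OF sub that]] rK by simp
  moreover have "X (hd ws) \<omega> \<in> cball 0 K"
  proof -
    have "norm (X i \<omega>) \<le> K" using Xi mK K by linarith
    then show ?thesis using ws(4) by simp
  qed
  moreover have "K \<le> dist (X (hd ws) \<omega>) (X (last ws) \<omega>)"
  proof -
    have "norm (X v \<omega>) \<le> norm (X i \<omega>) + dist (X i \<omega>) (X v \<omega>)"
      using norm_triangle_sub[of "X v \<omega>" "X i \<omega>"] by (simp add: dist_norm norm_minus_commute)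
    then show ?thesis using v(2) Xi mK rK(2) K unfolding ws(3,4) by linarith
  qed
  moreover have "real (length ws - 1) < \<eta> * K"
  proof -
    have "real (length ws - 1) \<le> real (length vs - 1)" by (simp add: ws(2))
    then have lt: "real (length ws - 1) < \<eta> / 6 * norm (X i \<omega> - X j \<omega>)" using vs(2) by linarith
    then have "0 < \<eta> / 6 * norm (X i \<omega> - X j \<omega>)" by linarith
    then have "0 < \<eta>" by (simp add: zero_less_mult_iff)
    have "i \<in> set vs" using path by auto
    then have "norm (X i \<omega> - X j \<omega>) \<le> 6 * K"
      using bspec[OF N \<open>i \<in> set vs\<close>] bspec[OF N \<open>j \<in> set vs\<close>]
        norm_triangle_ineq4[of "X i \<omega>" "X j \<omega>"] unfolding rK by linarith
    then have "\<eta> / 6 * norm (X i \<omega> - X j \<omega>) \<le> \<eta> / 6 * (6 * K)"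
      using \<open>0 < \<eta>\<close> by (intro mult_left_mono) auto
    then show ?thesis using lt by simp
  qed
  ultimately have "\<omega> \<in> fast_crossing 0 K \<eta>"
    unfolding fast_crossing_def using \<omega> ws(1) by (intro CollectI conjI exI[of _ ws]) auto
  then show "\<omega> \<in> (\<Union>n. fast_crossing 0 (2 ^ n * m / 6) \<eta>)" unfolding K_def by blast
qed

text \<open>
  The bounds for the scales \<open>2 ^ n * m / 6\<close> form a geometric series.
\<close>

lemma prob_not_linear_dist_le:
  assumes \<nu>: "0 \<le> \<nu>" "\<And>S. finite S \<Longrightarrow> (\<integral>\<^sup>+\<omega>. (\<Prod>z\<in>S. vertex_count z \<omega>) \<partial>M) \<le> ennreal \<nu> ^ card S"
    and t: "0 < t"
    and decay: "\<And>K. K1 \<le> K \<Longrightarrow> covered \<nu> (region 0 K) (fast_crossing 0 K \<eta>) (K powr (- t))"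
    and m: "0 < m" "6 * K1 \<le> m" "12 * (real CARD('d) * L) \<le> m"
  shows "prob (space M - linear_dist_event X E (\<eta> / 6) L m) \<le> 6 powr t / (1 - 2 powr (- t)) * m powr (- t)"
proof -
  define q where "q = 2 powr (- t)"
  have q: "0 \<le> q" "q < 1" using t by (auto simp: q_def powr_less_one)
  define p where "p = (m / 6) powr (- t)"
  have pow: "(2 ^ n * m / 6) powr (- t) = p * q ^ n" for n :: nat
  proof -
    have "(2 ^ n * m / 6) powr (- t) = (2 ^ n * (m / 6)) powr (- t)" by simp
    also have "\<dots> = (2 ^ n) powr (- t) * p" using m by (subst powr_mult) (auto simp: p_def)
    also have "(2 ^ n :: real) powr (- t) = q ^ n"
      by (simp add: q_def powr_powr mult.commute flip: powr_realpow)
    finally show ?thesis by simp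
  qed
  have "\<exists>B\<in>events. fast_crossing 0 (2 ^ n * m / 6) \<eta> \<inter> space M \<subseteq> B \<and> prob B \<le> p * q ^ n" for n :: nat
    unfolding pow[symmetric]
  proof (rule covered_prob[OF decay \<nu>])
    have "1 * m \<le> 2 ^ n * m" using m by (intro mult_right_mono) auto
    then have "6 * K1 \<le> 2 ^ n * m" using m(2) by linarith
    then show "K1 \<le> 2 ^ n * m / 6" by simp
  qed
  then have "\<forall>n. \<exists>B. B \<in> events \<and> fast_crossing 0 (2 ^ n * m / 6) \<eta> \<inter> space M \<subseteq> B \<and> prob B \<le> p * q ^ n"
    by (simp only: Bex_def) simp
  from choice[OF this] obtain B where B': "\<forall>n. B n \<in> events \<and>
      fast_crossing 0 (2 ^ n * m / 6) \<eta> \<inter> space M \<subseteq> B n \<and> prob (B n) \<le> p * q ^ n"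
    by (rule exE)
  have B: "B n \<in> events" "fast_crossing 0 (2 ^ n * m / 6) \<eta> \<inter> space M \<subseteq> B n" "prob (B n) \<le> p * q ^ n" for n
    using B' by simp_all
  have sums: "(\<lambda>n. p * q ^ n) sums (p * (1 / (1 - q)))"
    using q by (intro sums_mult geometric_sums) simp
  have summ: "summable (\<lambda>n. prob (B n))"
    by (rule summable_comparison_test'[OF sums_summable[OF sums], of 0]) (simp add: B(3))
  have "prob (space M - linear_dist_event X E (\<eta> / 6) L m) \<le> prob (\<Union>n. B n)"
  proof (rule finite_measure_mono)
    have "space M - linear_dist_event X E (\<eta> / 6) L m \<subseteq> (\<Union>n. fast_crossing 0 (2 ^ n * m / 6) \<eta>) \<inter> space M"
      using not_linear_dist_subset[OF m(1,3), of \<eta>] by blast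
    also have "\<dots> \<subseteq> (\<Union>n. B n)" using B(2) by blast
    finally show "space M - linear_dist_event X E (\<eta> / 6) L m \<subseteq> (\<Union>n. B n)" .
  qed (use B(1) in auto)
  also have "\<dots> \<le> (\<Sum>n. prob (B n))"
    using B(1) summ by (intro finite_measure_subadditive_countably) auto
  also have "\<dots> \<le> (\<Sum>n. p * q ^ n)"
    by (rule suminf_le[OF B(3) summ sums_summable[OF sums]])
  also have "\<dots> = p * (1 / (1 - q))"
    by (rule sums_unique[OF sums, symmetric])
  also have "p = 6 powr t * m powr (- t)"
  proof -
    have "(m / 6) powr (- t) = m powr (- t) / 6 powr (- t)" using m(1) by (simp add: powr_divide)
    also have "6 powr (- t) = 1 / 6 powr t" by (rule powr_minus_divide)
    finally show ?thesis by (simp only: p_def) simp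
  qed
  finally show ?thesis unfolding q_def by (simp only: times_divide_eq_right times_divide_eq_left mult_1_right)
qed

end

lemma Limsup_log_ext_le:
  fixes p :: "real \<Rightarrow> real"
  assumes "\<And>t. t < s \<Longrightarrow> \<exists>C>0. \<forall>\<^sub>F m in at_top. 0 \<le> p m \<and> p m \<le> C * m powr (- t)"
  shows "Limsup at_top (\<lambda>m. log_ext (p m) / ereal (ln m)) \<le> ereal (- s)"
proof (rule ereal_le_epsilon2)
  fix e :: real assume e: "0 < e"
  obtain C where C: "0 < C" "\<forall>\<^sub>F m in at_top. 0 \<le> p m \<and> p m \<le> C * m powr (- (s - e / 2))"
    using assms[of "s - e / 2"] e by auto
  have "\<forall>\<^sub>F m in at_top. C * m powr (- (s - e / 2)) \<le> m powr (- (s - e)) / 2"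
    using e by (intro eventually_powr_absorb) auto
  then have "\<forall>\<^sub>F m in at_top. log_ext (p m) / ereal (ln m) \<le> ereal (- s) + ereal e"
    using C(2) eventually_gt_at_top[of 1]
  proof eventually_elim
    case (elim m)
    have ln: "0 < ln m" using elim(3) by simp
    show ?case
    proof (cases "p m = 0")
      case True
      then show ?thesis using ln by (simp add: log_ext_def)
    next
      case False
      have "p m \<le> m powr (- (s - e))" using elim(1,2) powr_ge_zero[of m "- (s - e)"] by linarith
      then have "ln (p m) \<le> ln (m powr (- (s - e)))" using False elim by (subst ln_le_cancel_iff) auto
      then have "ln (p m) \<le> (- s + e) * ln m" using elim(3) by (simp add: ln_powr)
      then have "ln (p m) / ln m \<le> - s + e" using ln by (simp add: pos_divide_le_eq)
      then show ?thesis using False ln by (simp add: log_ext_def)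
    qed
  qed
  then show "Limsup at_top (\<lambda>m. log_ext (p m) / ereal (ln m)) \<le> ereal (- s) + ereal e"
    by (rule Limsup_bounded)
qed

theorem corollary3:
  fixes M :: "'w measure"
    and \<gamma> \<gamma>' :: real and \<delta> :: ereal and \<rho> :: "real \<Rightarrow> real"
    and X :: "nat \<Rightarrow> 'w \<Rightarrow> real ^ 'd" and U :: "nat \<Rightarrow> 'w \<Rightarrow> real"
    and E :: "'w \<Rightarrow> (nat \<times> nat) set"
  assumes "wdrcm M \<gamma> \<gamma>' \<delta> \<rho> X U E"
    and "0 \<le> \<gamma>" "\<gamma> < 1"
    and "0 \<le> \<gamma>'" "\<gamma>' < 2 - \<gamma>"
    and "1 < \<delta>"
    and "2 < \<delta>" "ereal \<gamma> < 1 - 1 / \<delta>" "\<gamma>' < 1 - \<gamma>"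
  shows "zeta \<gamma> \<gamma>' \<delta> < 0 \<and>
    (\<exists>\<eta> > 0. \<forall>L :: nat.
       Limsup at_top
         (\<lambda>m :: real.
            log_ext (measure M (space M - linear_dist_event X E \<eta> (real L) m)) / ereal (ln m))
       \<le> ereal (real CARD('d)) * zeta \<gamma> \<gamma>' \<delta>)"
proof -
  interpret wdrcm M \<gamma> \<gamma>' \<delta> \<rho> X U E by fact
  define d where "d = real CARD('d)"
  have d: "0 < d" by (simp add: d_def)
  have neg: "zeta \<gamma> \<gamma>' \<delta> < 0" using assms by (intro zeta_negative) auto
  obtain \<nu> where \<nu>: "0 \<le> \<nu>" "\<And>S. finite S \<Longrightarrow> (\<integral>\<^sup>+\<omega>. (\<Prod>z\<in>S. vertex_count z \<omega>) \<partial>M) \<le> ennreal \<nu> ^ card S"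
    using vertex_count_moments by (meson order_trans zero_le_one)
  have decay: "long_edge_decay \<nu> \<sigma>" if "0 < \<theta>" "zeta \<gamma> \<gamma>' \<delta> < ereal (- \<theta>)" "\<sigma> < d * \<theta>" for \<theta> \<sigma>
    using that assms \<nu>(1) by (intro long_edge_decay_below_zeta[of \<theta>]) (auto simp: d_def)
  obtain b where b: "zeta \<gamma> \<gamma>' \<delta> < ereal b" "ereal b < 0" using ereal_dense2[OF neg] by blast
  \<comment> \<open>Any exponent strictly between \<open>d * zeta \<gamma> \<gamma>' \<delta>\<close> and \<open>0\<close> can be used to fix \<open>\<eta>\<close>.\<close>
  define \<theta>0 where "\<theta>0 = - b"
  have \<theta>0: "0 < \<theta>0" "zeta \<gamma> \<gamma>' \<delta> < ereal (- \<theta>0)" using b by (auto simp: \<theta>0_def zero_ereal_def)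
  have "long_edge_decay \<nu> (d * \<theta>0 / 2)" using \<theta>0 d by (intro decay[of \<theta>0]) auto
  moreover have "0 < d * \<theta>0 / 2" using \<theta>0 d by simp
  ultimately obtain \<eta> s K0 where \<eta>: "0 < \<eta>" "0 < s"
    and base: "\<And>K x. K0 \<le> K \<Longrightarrow> covered \<nu> (region x K) (fast_crossing x K \<eta>) (K powr (- s))"
    by (rule fast_crossing_decay[OF _ \<nu>(1)]) blast
  define p where "p L m = prob (space M - linear_dist_event X E (\<eta> / 2 / 6) (real L) m)" for L :: nat and m
  have bound: "\<exists>C>0. \<forall>\<^sub>F m in at_top. 0 \<le> p L m \<and> p L m \<le> C * m powr (- t)"
    if \<theta>: "0 < \<theta>" "zeta \<gamma> \<gamma>' \<delta> < ereal (- \<theta>)" and t: "0 < t" "t < d * \<theta>" for \<theta> t L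
  proof -
    obtain \<sigma> where \<sigma>: "t < \<sigma>" "\<sigma> < d * \<theta>" using dense[OF t(2)] by blast
    have "\<forall>\<^sub>F K in at_top. \<forall>x. covered \<nu> (region x K) (fast_crossing x K (\<eta> / 2)) (K powr (- t))"
      using decay[OF \<theta> \<sigma>(2)] \<nu>(1) t(1) \<sigma>(1) \<eta> base by (rule fast_crossing_decay_boost)
    then obtain K1 where K1: "\<And>K. K1 \<le> K \<Longrightarrow> covered \<nu> (region 0 K) (fast_crossing 0 K (\<eta> / 2)) (K powr (- t))"
      unfolding eventually_at_top_linorder by blast
    define C where "C = 6 powr t / (1 - 2 powr (- t))"
    have "2 powr (- t) < 1" using t by (simp add: powr_less_one)
    then have "0 < C" by (simp add: C_def)
    moreover have "\<forall>\<^sub>F m in at_top. 0 \<le> p L m \<and> p L m \<le> C * m powr (- t)"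
      using eventually_gt_at_top[of 0] eventually_ge_at_top[of "6 * K1"]
        eventually_ge_at_top[of "12 * (d * real L)"]
    proof eventually_elim
      case (elim m)
      then show ?case
        using prob_not_linear_dist_le[OF \<nu> t(1) K1, where m = m and L = "real L"] by (simp add: p_def C_def d_def)
    qed
    ultimately show ?thesis by blast
  qed
  have bound': "\<exists>C>0. \<forall>\<^sub>F m in at_top. 0 \<le> p L m \<and> p L m \<le> C * m powr (- t)"
    if \<theta>: "0 < \<theta>" "zeta \<gamma> \<gamma>' \<delta> < ereal (- \<theta>)" and t: "t < d * \<theta>" for \<theta> t L
  proof -
    have "max t (d * \<theta> / 2) < d * \<theta>" "0 < max t (d * \<theta> / 2)" using t \<theta> d by (auto simp: less_max_iff_disj)
    then obtain C where C: "0 < C" "\<forall>\<^sub>F m in at_top. 0 \<le> p L m \<and> p L m \<le> C * m powr (- max t (d * \<theta> / 2))"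
      using bound[OF \<theta>] by blast
    have "\<forall>\<^sub>F m in at_top. 0 \<le> p L m \<and> p L m \<le> C * m powr (- t)"
      using C(2) eventually_ge_at_top[of 1]
    proof eventually_elim
      case (elim m)
      have "m powr (- max t (d * \<theta> / 2)) \<le> m powr (- t)" using elim(2) by (intro powr_mono) auto
      then have "C * m powr (- max t (d * \<theta> / 2)) \<le> C * m powr (- t)" using C(1) by (intro mult_left_mono) auto
      then show ?case using elim(1) by linarith
    qed
    then show ?thesis using C(1) by blast
  qed
  have limsup: "Limsup at_top (\<lambda>m. log_ext (p L m) / ereal (ln m)) \<le> ereal (- (d * \<theta>))"
    if "0 < \<theta>" "zeta \<gamma> \<gamma>' \<delta> < ereal (- \<theta>)" for L \<theta>
    by (rule Limsup_log_ext_le) (rule bound'[OF that])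
  have "Limsup at_top (\<lambda>m. log_ext (p L m) / ereal (ln m)) \<le> ereal d * zeta \<gamma> \<gamma>' \<delta>" for L
  proof (rule dense_ge)
    fix y assume y: "ereal d * zeta \<gamma> \<gamma>' \<delta> < y"
    have "ereal d * zeta \<gamma> \<gamma>' \<delta> < 0" using neg d by (simp add: ereal_mult_less_0_iff)
    then have "ereal d * zeta \<gamma> \<gamma>' \<delta> < min y 0" using y by simp
    then obtain w where w: "ereal d * zeta \<gamma> \<gamma>' \<delta> < ereal w" "ereal w < min y 0" using ereal_dense2 by blast
    define \<theta> where "\<theta> = - w / d"
    have "w < 0" "ereal w < y" using w(2) by (auto simp: zero_ereal_def)
    then have "0 < \<theta>" using d by (simp add: \<theta>_def divide_neg_pos)
    moreover have "zeta \<gamma> \<gamma>' \<delta> < ereal (- \<theta>)"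
      using w(1) d by (cases "zeta \<gamma> \<gamma>' \<delta>") (auto simp: \<theta>_def pos_less_divide_eq mult.commute)
    ultimately have "Limsup at_top (\<lambda>m. log_ext (p L m) / ereal (ln m)) \<le> ereal (- (d * \<theta>))" by (rule limsup)
    also have "- (d * \<theta>) = w" using d by (simp add: \<theta>_def)
    finally show "Limsup at_top (\<lambda>m. log_ext (p L m) / ereal (ln m)) \<le> y"
      using \<open>ereal w < y\<close> by (meson less_imp_le order_trans)
  qed
  then have "\<exists>\<eta> > 0. \<forall>L :: nat. Limsup at_top
      (\<lambda>m :: real. log_ext (measure M (space M - linear_dist_event X E \<eta> (real L) m)) / ereal (ln m))
       \<le> ereal d * zeta \<gamma> \<gamma>' \<delta>"
    using \<eta>(1) unfolding p_def by (intro exI[of _ "\<eta> / 2 / 6"]) simp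
  then show ?thesis using neg unfolding d_def by blast
qed

end
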